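(* A Frith frame $(L,S)$ is complete if and only if for every Frith frame $(M,T)$ and every morphism of Frith frames $h:(M,T)\to(L,S)$ such that $\mathbf L_{\rm Frith}(h)$ is an isomorphism of lattices, $h$ is an isomorphism of Frith frames.
   Context: A Frith frame is a pair $(L,S)$ with $L$ a frame and $S$ a bounded sublattice of $L$ such that every element of $L$ is a join of elements of $S$. A morphism $(L,S)\to(M,T)$ is a frame homomorphism $h:L\to M$ with $h[S]\subseteq T$; $\mathbf L_{\rm Frith}(h):S\to T$ denotes its restriction and co-restriction, a bounded lattice homomorphism. $h$ is dense if $h(a)=0$ implies $a=0$; it is an extremal epimorphism if and only if $h[S]=T$; it is an isomorphism if and only if it is injective and $h[S]=T$. $(L,S)$ is symmetric if $S$ is a Boolean algebra. A symmetric Frith frame $(L,B)$ is complete if every dense extremal epimorphism $(M,C)\to(L,B)$ with $(M,C)$ symmetric is an isomorphism. For a general $(L,S)$, let $\mathcal CL$ be the frame of congruences of $L$ ordered by inclusion, $\nabla_a=\{(x,y)\mid a\vee x=a\vee y\}$, $\Delta_a=\{(x,y)\mid a\wedge x=a\wedge y\}$ (complements of each other in $\mathcal CL$), $\mathcal C_SL$ the subframe of $\mathcal CL$ generated by $\{\nabla_a\mid a\in L\}\cup\{\Delta_s\mid s\in S\}$, and $\overline S$ the sublattice of $\mathcal C_SL$ generated by $\{\nabla_s,\Delta_s\mid s\in S\}$. $(L,S)$ is complete if the symmetric Frith frame $(\mathcal C_SL,\overline S)$ is complete. *)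

theory Defs
  imports "HOL-Algebra.Complete_Lattice"
begin

locale frame = complete_lattice L for L :: "'a gorder" (structure) +
  assumes meet_sup_distrib:
    "x \<in> carrier L \<Longrightarrow> A \<subseteq> carrier L \<Longrightarrow> x \<sqinter> \<Squnion>A = \<Squnion>((\<lambda>a. x \<sqinter> a) ` A)"

definition sublattice :: "'a set \<Rightarrow> 'a gorder \<Rightarrow> bool" where
  "sublattice S L \<longleftrightarrow> S \<subseteq> carrier L \<and>
     (\<forall>x\<in>S. \<forall>y\<in>S. x \<squnion>\<^bsub>L\<^esub> y \<in> S \<and> x \<sqinter>\<^bsub>L\<^esub> y \<in> S)"

definition bounded_sublattice :: "'a set \<Rightarrow> 'a gorder \<Rightarrow> bool" where
  "bounded_sublattice S L \<longleftrightarrow> sublattice S L \<and> \<bottom>\<^bsub>L\<^esub> \<in> S \<and> \<top>\<^bsub>L\<^esub> \<in> S"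

definition frith_frame :: "'a gorder \<Rightarrow> 'a set \<Rightarrow> bool" where
  "frith_frame L S \<longleftrightarrow> frame L \<and> bounded_sublattice S L \<and>
     (\<forall>x\<in>carrier L. \<exists>A\<subseteq>S. x = \<Squnion>\<^bsub>L\<^esub>A)"

definition frame_hom :: "'a gorder \<Rightarrow> 'b gorder \<Rightarrow> ('a \<Rightarrow> 'b) \<Rightarrow> bool" where
  "frame_hom L M h \<longleftrightarrow> h \<in> carrier L \<rightarrow> carrier M \<and>
     sup_pres L M h \<and> meet_pres L M h \<and> h \<top>\<^bsub>L\<^esub> = \<top>\<^bsub>M\<^esub>"

definition frith_mor :: "'a gorder \<Rightarrow> 'a set \<Rightarrow> 'b gorder \<Rightarrow> 'b set \<Rightarrow> ('a \<Rightarrow> 'b) \<Rightarrow> bool" where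
  "frith_mor L S M T h \<longleftrightarrow> frame_hom L M h \<and> h ` S \<subseteq> T"

definition frith_iso :: "'a gorder \<Rightarrow> 'a set \<Rightarrow> 'b gorder \<Rightarrow> 'b set \<Rightarrow> ('a \<Rightarrow> 'b) \<Rightarrow> bool" where
  "frith_iso L S M T h \<longleftrightarrow> frith_mor L S M T h \<and>
     (\<exists>g. frith_mor M T L S g \<and> (\<forall>x\<in>carrier L. g (h x) = x) \<and> (\<forall>y\<in>carrier M. h (g y) = y))"

definition dense :: "'a gorder \<Rightarrow> 'b gorder \<Rightarrow> ('a \<Rightarrow> 'b) \<Rightarrow> bool" where
  "dense L M h \<longleftrightarrow> (\<forall>a\<in>carrier L. h a = \<bottom>\<^bsub>M\<^esub> \<longrightarrow> a = \<bottom>\<^bsub>L\<^esub>)"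

text \<open>The extremal epimorphisms of Frith frames are the morphisms that map the
  distinguished sublattice onto the distinguished sublattice.\<close>

definition frith_extremal_epi ::
    "'a gorder \<Rightarrow> 'a set \<Rightarrow> 'b gorder \<Rightarrow> 'b set \<Rightarrow> ('a \<Rightarrow> 'b) \<Rightarrow> bool" where
  "frith_extremal_epi L S M T h \<longleftrightarrow> frith_mor L S M T h \<and> h ` S = T"

definition bounded_lattice_hom :: "'a gorder \<Rightarrow> 'b gorder \<Rightarrow> ('a \<Rightarrow> 'b) \<Rightarrow> bool" where
  "bounded_lattice_hom P Q f \<longleftrightarrow> f \<in> carrier P \<rightarrow> carrier Q \<and>
     join_pres P Q f \<and> meet_pres P Q f \<and> f \<bottom>\<^bsub>P\<^esub> = \<bottom>\<^bsub>Q\<^esub> \<and> f \<top>\<^bsub>P\<^esub> = \<top>\<^bsub>Q\<^esub>"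

definition lattice_iso :: "'a gorder \<Rightarrow> 'b gorder \<Rightarrow> ('a \<Rightarrow> 'b) \<Rightarrow> bool" where
  "lattice_iso P Q f \<longleftrightarrow> bounded_lattice_hom P Q f \<and> bij_betw f (carrier P) (carrier Q)"

text \<open>A bounded sublattice as a lattice in its own right, with the restricted order.\<close>

abbreviation sublat :: "'a gorder \<Rightarrow> 'a set \<Rightarrow> 'a gorder" where
  "sublat L S \<equiv> L\<lparr>carrier := S\<rparr>"

text \<open>As a sublattice of a frame is distributive, it is a Boolean algebra as soon as it is
  complemented.\<close>

definition symmetric_frith_frame :: "'a gorder \<Rightarrow> 'a set \<Rightarrow> bool" where
  "symmetric_frith_frame L S \<longleftrightarrow> frith_frame L S \<and>
     (\<forall>s\<in>S. \<exists>t\<in>S. s \<sqinter>\<^bsub>L\<^esub> t = \<bottom>\<^bsub>L\<^esub> \<and> s \<squnion>\<^bsub>L\<^esub> t = \<top>\<^bsub>L\<^esub>)"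

text \<open>In \<open>symmetric_complete\<close>, \<open>M\<close> ranges over the frames whose carrier is a set of sets of
  elements of the type of \<open>L\<close>. This loses nothing: for a dense extremal epimorphism \<open>h\<close>, the
  elements \<open>m\<close> of \<open>M\<close> are determined by the sets \<open>h ` {c \<in> C. c \<le> m}\<close>. Lemma
  \<open>symmetric_completeD\<close> below shows that \<open>M\<close> may have an arbitrary type.\<close>

definition symmetric_complete :: "'a gorder \<Rightarrow> 'a set \<Rightarrow> bool" where
  "symmetric_complete L B \<longleftrightarrow>
     (\<forall>(M :: 'a set gorder) C h. symmetric_frith_frame M C \<longrightarrow>
        frith_extremal_epi M C L B h \<longrightarrow> dense M L h \<longrightarrow> frith_iso M C L B h)"

definition transport :: "('a \<Rightarrow> 'b) \<Rightarrow> 'a gorder \<Rightarrow> 'b gorder" where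
  "transport f M = \<lparr>carrier = f ` carrier M, eq = (=),
     le = (\<lambda>x y. inv_into (carrier M) f x \<sqsubseteq>\<^bsub>M\<^esub> inv_into (carrier M) f y)\<rparr>"

context
  fixes M :: "'a gorder" and f :: "'a \<Rightarrow> 'b"
  assumes M: "frame M" and f: "inj_on f (carrier M)"
begin

interpretation M: frame M by (rule M)

private abbreviation "N \<equiv> transport f M"

lemma transport_carrier: "carrier N = f ` carrier M"
  by (simp add: transport_def)

lemma transport_le: "x \<in> carrier M \<Longrightarrow> y \<in> carrier M \<Longrightarrow> f x \<sqsubseteq>\<^bsub>N\<^esub> f y \<longleftrightarrow> x \<sqsubseteq>\<^bsub>M\<^esub> y"
  using f by (simp add: transport_def)

lemma transport_partial_order: "partial_order N"
proof
  have eq: "(.=\<^bsub>N\<^esub>) = (=)" by (simp add: transport_def)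
  then show "(.=\<^bsub>N\<^esub>) = (=)" .
  fix x y z assume x: "x \<in> carrier N"
  show "x .=\<^bsub>N\<^esub> x" "x \<sqsubseteq>\<^bsub>N\<^esub> x" using x by (auto simp: eq transport_carrier transport_le)
  assume y: "y \<in> carrier N"
  show "x .=\<^bsub>N\<^esub> y \<Longrightarrow> y .=\<^bsub>N\<^esub> x" by (simp add: eq)
  show "x \<sqsubseteq>\<^bsub>N\<^esub> y \<Longrightarrow> y \<sqsubseteq>\<^bsub>N\<^esub> x \<Longrightarrow> x .=\<^bsub>N\<^esub> y"
    using x y unfolding eq transport_carrier by (clarsimp simp: transport_le) (metis M.le_antisym)
  assume z: "z \<in> carrier N"
  show "x .=\<^bsub>N\<^esub> y \<Longrightarrow> y .=\<^bsub>N\<^esub> z \<Longrightarrow> x .=\<^bsub>N\<^esub> z" by (simp add: eq)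
  show "x \<sqsubseteq>\<^bsub>N\<^esub> y \<Longrightarrow> y \<sqsubseteq>\<^bsub>N\<^esub> z \<Longrightarrow> x \<sqsubseteq>\<^bsub>N\<^esub> z"
    using x y z unfolding transport_carrier by (clarsimp simp: transport_le) (metis M.le_trans)
  fix w show "x .=\<^bsub>N\<^esub> y \<Longrightarrow> z .=\<^bsub>N\<^esub> w \<Longrightarrow> (x \<sqsubseteq>\<^bsub>N\<^esub> z) = (y \<sqsubseteq>\<^bsub>N\<^esub> w)" by (simp add: eq)
qed

interpretation N: partial_order N by (rule transport_partial_order)

lemma transport_Upper: "A \<subseteq> carrier M \<Longrightarrow> Upper N (f ` A) = f ` Upper M A"
proof -
  assume A: "A \<subseteq> carrier M"
  have iff: "f a \<in> Upper N (f ` A) \<longleftrightarrow> a \<in> Upper M A" if a: "a \<in> carrier M" for a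
  proof -
    have "(f x \<sqsubseteq>\<^bsub>N\<^esub> f a) = (x \<sqsubseteq>\<^bsub>M\<^esub> a)" if "x \<in> A" for x
      using that a A by (simp add: transport_le subset_iff)
    moreover have int: "f ` A \<inter> carrier N = f ` A" "A \<inter> carrier M = A"
      using A by (auto simp: transport_carrier)
    ultimately show ?thesis
      using a unfolding Upper_def int by (auto simp: transport_carrier)
  qed
  show ?thesis
  proof (intro subset_antisym subsetI)
    fix u assume u: "u \<in> Upper N (f ` A)"
    then have "u \<in> f ` carrier M"
      using Upper_closed[of N "f ` A"] unfolding transport_carrier by (rule subsetD[rotated])
    then obtain a where "a \<in> carrier M" "u = f a" by (rule imageE)
    with u iff show "u \<in> f ` Upper M A" by (simp add: imageI)
  next
    fix u assume "u \<in> f ` Upper M A"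
    then obtain a where a: "a \<in> Upper M A" "u = f a" by (rule imageE)
    from a(1) have "a \<in> carrier M" using Upper_closed[of M A] by (rule subsetD[rotated])
    with a iff show "u \<in> Upper N (f ` A)" by simp
  qed
qed

lemma transport_Lower: "A \<subseteq> carrier M \<Longrightarrow> Lower N (f ` A) = f ` Lower M A"
proof -
  assume A: "A \<subseteq> carrier M"
  have iff: "f a \<in> Lower N (f ` A) \<longleftrightarrow> a \<in> Lower M A" if a: "a \<in> carrier M" for a
  proof -
    have "(f a \<sqsubseteq>\<^bsub>N\<^esub> f x) = (a \<sqsubseteq>\<^bsub>M\<^esub> x)" if "x \<in> A" for x
      using that a A by (simp add: transport_le subset_iff)
    moreover have int: "f ` A \<inter> carrier N = f ` A" "A \<inter> carrier M = A"
      using A by (auto simp: transport_carrier)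
    ultimately show ?thesis
      using a unfolding Lower_def int by (auto simp: transport_carrier)
  qed
  show ?thesis
  proof (intro subset_antisym subsetI)
    fix u assume u: "u \<in> Lower N (f ` A)"
    then have "u \<in> f ` carrier M"
      using Lower_closed[of N "f ` A"] unfolding transport_carrier by (rule subsetD[rotated])
    then obtain a where "a \<in> carrier M" "u = f a" by (rule imageE)
    with u iff show "u \<in> f ` Lower M A" by (simp add: imageI)
  next
    fix u assume "u \<in> f ` Lower M A"
    then obtain a where a: "a \<in> Lower M A" "u = f a" by (rule imageE)
    from a(1) have "a \<in> carrier M" using Lower_closed[of M A] by (rule subsetD[rotated])
    with a iff show "u \<in> Lower N (f ` A)" by simp
  qed
qed

lemma transport_least: "least M x A \<Longrightarrow> least N (f x) (f ` A)"
  by (auto simp: least_def transport_carrier transport_le subset_iff)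

lemma transport_greatest: "greatest M x A \<Longrightarrow> greatest N (f x) (f ` A)"
  by (auto simp: greatest_def transport_carrier transport_le subset_iff)

lemma transport_lub: "A \<subseteq> carrier M \<Longrightarrow> least N (f (\<Squnion>\<^bsub>M\<^esub>A)) (Upper N (f ` A))"
  by (simp add: transport_Upper transport_least M.sup_lub)

lemma transport_glb: "A \<subseteq> carrier M \<Longrightarrow> greatest N (f (\<Sqinter>\<^bsub>M\<^esub>A)) (Lower N (f ` A))"
  by (simp add: transport_Lower transport_greatest M.inf_glb)

lemma transport_complete_lattice: "complete_lattice N"
proof
  fix B assume "B \<subseteq> carrier N"
  then obtain A where "A \<subseteq> carrier M" "B = f ` A"
    unfolding transport_carrier by (rule subset_imageE)
  then show "\<exists>s. least N s (Upper N B)" "\<exists>i. greatest N i (Lower N B)"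
    using transport_lub transport_glb by blast+
qed

interpretation N: complete_lattice N by (rule transport_complete_lattice)

lemma transport_image: "A \<subseteq> carrier M \<Longrightarrow> f ` A \<subseteq> carrier N"
  by (auto simp: transport_carrier)

lemma transport_sup: "A \<subseteq> carrier M \<Longrightarrow> \<Squnion>\<^bsub>N\<^esub>(f ` A) = f (\<Squnion>\<^bsub>M\<^esub>A)"
  by (meson N.least_unique N.sup_lub transport_lub transport_image)

lemma transport_inf: "A \<subseteq> carrier M \<Longrightarrow> \<Sqinter>\<^bsub>N\<^esub>(f ` A) = f (\<Sqinter>\<^bsub>M\<^esub>A)"
  by (meson N.greatest_unique N.inf_glb transport_glb transport_image)

lemma transport_join:
  "x \<in> carrier M \<Longrightarrow> y \<in> carrier M \<Longrightarrow> f x \<squnion>\<^bsub>N\<^esub> f y = f (x \<squnion>\<^bsub>M\<^esub> y)"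
  using transport_sup[of "{x, y}"] by (simp add: join_def)

lemma transport_meet:
  "x \<in> carrier M \<Longrightarrow> y \<in> carrier M \<Longrightarrow> f x \<sqinter>\<^bsub>N\<^esub> f y = f (x \<sqinter>\<^bsub>M\<^esub> y)"
  using transport_inf[of "{x, y}"] by (simp add: meet_def)

lemma transport_bottom: "\<bottom>\<^bsub>N\<^esub> = f \<bottom>\<^bsub>M\<^esub>"
  by (metis N.bottom_least N.least_unique M.bottom_least transport_least transport_carrier)

lemma transport_top: "\<top>\<^bsub>N\<^esub> = f \<top>\<^bsub>M\<^esub>"
  by (metis N.top_greatest N.greatest_unique M.top_greatest transport_greatest transport_carrier)

lemma transport_frame: "frame N"
proof
  fix x B assume x: "x \<in> carrier N" and B: "B \<subseteq> carrier N"
  from x obtain a where a: "a \<in> carrier M" "x = f a"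
    unfolding transport_carrier by (rule imageE)
  from B obtain A where A: "A \<subseteq> carrier M" "B = f ` A"
    unfolding transport_carrier by (rule subset_imageE)
  note * = a A
  have "x \<sqinter>\<^bsub>N\<^esub> \<Squnion>\<^bsub>N\<^esub>B = f (a \<sqinter>\<^bsub>M\<^esub> \<Squnion>\<^bsub>M\<^esub>A)"
    using * by (simp add: transport_sup transport_meet)
  also have "\<dots> = f (\<Squnion>\<^bsub>M\<^esub>((\<lambda>c. a \<sqinter>\<^bsub>M\<^esub> c) ` A))"
    using * by (simp add: M.meet_sup_distrib)
  also have "\<dots> = \<Squnion>\<^bsub>N\<^esub>(f ` (\<lambda>c. a \<sqinter>\<^bsub>M\<^esub> c) ` A)"
    using * by (subst transport_sup) auto
  also have "f ` (\<lambda>c. a \<sqinter>\<^bsub>M\<^esub> c) ` A = (\<lambda>c. x \<sqinter>\<^bsub>N\<^esub> c) ` B"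
    unfolding *(2,4) image_image
    by (intro image_cong refl) (use * in \<open>simp add: transport_meet subset_iff\<close>)
  finally show "x \<sqinter>\<^bsub>N\<^esub> \<Squnion>\<^bsub>N\<^esub>B = \<Squnion>\<^bsub>N\<^esub>((\<lambda>c. x \<sqinter>\<^bsub>N\<^esub> c) ` B)" .
qed

lemma transport_frith_frame:
  assumes "frith_frame M T"
  shows "frith_frame N (f ` T)"
proof -
  have T: "T \<subseteq> carrier M" using assms
    by (simp add: frith_frame_def bounded_sublattice_def sublattice_def)
  have bT: "\<bottom>\<^bsub>M\<^esub> \<in> T" "\<top>\<^bsub>M\<^esub> \<in> T"
    and cl: "\<And>x y. x \<in> T \<Longrightarrow> y \<in> T \<Longrightarrow> x \<squnion>\<^bsub>M\<^esub> y \<in> T \<and> x \<sqinter>\<^bsub>M\<^esub> y \<in> T"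
    using assms by (simp_all add: frith_frame_def bounded_sublattice_def sublattice_def)
  have "u \<squnion>\<^bsub>N\<^esub> v \<in> f ` T \<and> u \<sqinter>\<^bsub>N\<^esub> v \<in> f ` T" if uv: "u \<in> f ` T" "v \<in> f ` T" for u v
  proof -
    obtain x y where xy: "x \<in> T" "u = f x" "y \<in> T" "v = f y" using uv by blast
    then have "x \<in> carrier M" "y \<in> carrier M" using T by blast+
    then show ?thesis using xy cl by (simp add: transport_join transport_meet)
  qed
  then have "bounded_sublattice (f ` T) N"
    using bT T by (simp add: bounded_sublattice_def sublattice_def transport_carrier
        transport_bottom transport_top image_mono)
  moreover have "\<exists>B\<subseteq>f ` T. y = \<Squnion>\<^bsub>N\<^esub>B" if y: "y \<in> carrier N" for y
  proof -
    obtain x where x: "x \<in> carrier M" "y = f x" using y unfolding transport_carrier by blast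
    then obtain A where "A \<subseteq> T" "x = \<Squnion>\<^bsub>M\<^esub>A" using assms by (auto simp: frith_frame_def)
    then have "f ` A \<subseteq> f ` T" "y = \<Squnion>\<^bsub>N\<^esub>(f ` A)"
      using x T transport_sup[of A] by (simp_all add: image_mono)
    then show ?thesis by blast
  qed
  ultimately show ?thesis by (simp add: frith_frame_def transport_frame)
qed

lemma transport_symmetric:
  assumes "symmetric_frith_frame M T"
  shows "symmetric_frith_frame N (f ` T)"
proof -
  have fr: "frith_frame M T" using assms by (simp add: symmetric_frith_frame_def)
  then have T: "x \<in> T \<Longrightarrow> x \<in> carrier M" for x
    by (auto simp: frith_frame_def bounded_sublattice_def sublattice_def)
  show ?thesis unfolding symmetric_frith_frame_def
  proof (intro conjI ballI)
    fix s assume "s \<in> f ` T"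
    then obtain a where a: "a \<in> T" "s = f a" by auto
    then obtain b where b: "b \<in> T" "a \<sqinter>\<^bsub>M\<^esub> b = \<bottom>\<^bsub>M\<^esub>" "a \<squnion>\<^bsub>M\<^esub> b = \<top>\<^bsub>M\<^esub>"
      using assms unfolding symmetric_frith_frame_def by blast
    show "\<exists>t\<in>f ` T. s \<sqinter>\<^bsub>N\<^esub> t = \<bottom>\<^bsub>N\<^esub> \<and> s \<squnion>\<^bsub>N\<^esub> t = \<top>\<^bsub>N\<^esub>"
      using a b T by (intro bexI[of _ "f b"])
        (auto simp: transport_meet transport_join transport_bottom transport_top)
  qed (rule transport_frith_frame[OF fr])
qed

lemma transport_mor: "frith_mor M T N (f ` T) f"
  using M.complete_lattice_axioms N.complete_lattice_axioms M.lattice_axioms N.lattice_axioms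
  by (auto simp: frith_mor_def frame_hom_def sup_pres_def meet_pres_def transport_carrier
      transport_sup transport_meet transport_top)

lemma transport_mor_inv:
  assumes T: "T \<subseteq> carrier M"
  shows "frith_mor N (f ` T) M T (inv_into (carrier M) f)"
proof -
  let ?g = "inv_into (carrier M) f"
  have g: "?g (f x) = x" if "x \<in> carrier M" for x using f that by simp
  have "?g (\<Squnion>\<^bsub>N\<^esub>B) = \<Squnion>\<^bsub>M\<^esub>(?g ` B)" if B: "B \<subseteq> carrier N" for B
  proof -
    obtain A where A: "A \<subseteq> carrier M" "B = f ` A"
      using B unfolding transport_carrier by (rule subset_imageE)
    then have "?g ` B = A" using f by (simp add: inv_into_image_cancel)
    then show ?thesis using A by (simp add: transport_sup g)
  qed
  then show ?thesis
    using M.complete_lattice_axioms N.complete_lattice_axioms M.lattice_axioms N.lattice_axioms T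
    by (auto simp: frith_mor_def frame_hom_def sup_pres_def meet_pres_def transport_carrier
      transport_meet transport_top g subset_iff)
qed

end

lemma frame_hom_comp:
  assumes "frame_hom L M h" "frame_hom M N k"
  shows "frame_hom L N (k \<circ> h)"
proof -
  have h: "x \<in> carrier L \<Longrightarrow> h x \<in> carrier M" for x using assms by (auto simp: frame_hom_def)
  then have hA: "A \<subseteq> carrier L \<Longrightarrow> h ` A \<subseteq> carrier M" for A by blast
  have "sup_pres L N (k \<circ> h)"
    using assms hA unfolding frame_hom_def sup_pres_def o_apply image_comp[symmetric] by simp
  moreover have "meet_pres L N (k \<circ> h)"
    using assms h unfolding frame_hom_def meet_pres_def by simp
  ultimately show ?thesis
    using assms h unfolding frame_hom_def by (simp add: Pi_iff)
qed

lemma frith_mor_comp: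
  "frith_mor L S M T h \<Longrightarrow> frith_mor M T N U k \<Longrightarrow> frith_mor L S N U (k \<circ> h)"
  by (auto simp: frith_mor_def intro: frame_hom_comp)

lemma symmetric_completeD:
  fixes L :: "'a gorder" and M :: "'m gorder"
  assumes complete: "symmetric_complete L B"
    and M: "symmetric_frith_frame M C"
    and h: "frith_extremal_epi M C L B h" and dense: "dense M L h"
  shows "frith_iso M C L B h"
proof -
  have fr: "frith_frame M C" and "frame M"
    using M by (auto simp: symmetric_frith_frame_def frith_frame_def)
  interpret M: frame M by fact
  have mor: "frith_mor M C L B h" and hC: "h ` C = B"
    using h by (auto simp: frith_extremal_epi_def)
  then have hom: "frame_hom M L h" by (simp add: frith_mor_def)
  then interpret L: complete_lattice L by (simp add: frame_hom_def sup_pres_def)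
  have C: "C \<subseteq> carrier M" using fr by (simp add: frith_frame_def bounded_sublattice_def sublattice_def)
  have h_in: "x \<in> carrier M \<Longrightarrow> h x \<in> carrier L" for x using hom by (auto simp: frame_hom_def)
  have h_meet: "x \<in> carrier M \<Longrightarrow> y \<in> carrier M \<Longrightarrow> h (x \<sqinter>\<^bsub>M\<^esub> y) = h x \<sqinter>\<^bsub>L\<^esub> h y" for x y
    using hom by (auto simp: frame_hom_def meet_pres_def)
  have h_bot: "h \<bottom>\<^bsub>M\<^esub> = \<bottom>\<^bsub>L\<^esub>"
  proof -
    have "h (\<Squnion>\<^bsub>M\<^esub>{}) = \<Squnion>\<^bsub>L\<^esub>(h ` {})"
      using hom unfolding frame_hom_def sup_pres_def by blast
    then show ?thesis
      using M.weak_sup_empty L.weak_sup_empty by (simp add: M.eq_is_equal L.eq_is_equal)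
  qed
  have le: "c \<sqsubseteq>\<^bsub>M\<^esub> d" if cd: "c \<in> C" "d \<in> C" "h c = h d" for c d
  proof -
    obtain d' where d': "d' \<in> C" "d \<sqinter>\<^bsub>M\<^esub> d' = \<bottom>\<^bsub>M\<^esub>" "d \<squnion>\<^bsub>M\<^esub> d' = \<top>\<^bsub>M\<^esub>"
      using M cd unfolding symmetric_frith_frame_def by blast
    have car: "c \<in> carrier M" "d \<in> carrier M" "d' \<in> carrier M" using cd d' C by auto
    have "h (c \<sqinter>\<^bsub>M\<^esub> d') = h (d \<sqinter>\<^bsub>M\<^esub> d')" using cd car by (simp add: h_meet)
    then have "h (c \<sqinter>\<^bsub>M\<^esub> d') = \<bottom>\<^bsub>L\<^esub>" using d' h_bot by simp
    then have 0: "c \<sqinter>\<^bsub>M\<^esub> d' = \<bottom>\<^bsub>M\<^esub>" using dense car by (simp add: dense_def)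
    have "c = c \<sqinter>\<^bsub>M\<^esub> \<Squnion>\<^bsub>M\<^esub>{d, d'}"
      using d'(3) car by (metis M.le_iff_join M.top_closed M.top_higher join_def)
    also have "\<dots> = \<Squnion>\<^bsub>M\<^esub>{c \<sqinter>\<^bsub>M\<^esub> d, c \<sqinter>\<^bsub>M\<^esub> d'}"
      using M.meet_sup_distrib[of c "{d, d'}"] car by simp
    also have "\<dots> \<sqsubseteq>\<^bsub>M\<^esub> d"
      using car by (intro M.sup_least) (auto simp: 0 M.meet_right)
    finally show ?thesis .
  qed
  define e where "e m = h ` {c \<in> C. c \<sqsubseteq>\<^bsub>M\<^esub> m}" for m
  have e_le: "m \<sqsubseteq>\<^bsub>M\<^esub> n" if mn: "m \<in> carrier M" "n \<in> carrier M" "e m \<subseteq> e n" for m n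
  proof -
    obtain A where A: "A \<subseteq> C" "m = \<Squnion>\<^bsub>M\<^esub>A" using fr mn by (auto simp: frith_frame_def)
    have "a \<sqsubseteq>\<^bsub>M\<^esub> n" if a: "a \<in> A" for a
    proof -
      have "a \<sqsubseteq>\<^bsub>M\<^esub> m" using A C a by (auto intro: M.sup_upper)
      then have "h a \<in> e n" using mn A a by (auto simp: e_def)
      then obtain c where c: "c \<in> C" "c \<sqsubseteq>\<^bsub>M\<^esub> n" "h a = h c" by (auto simp: e_def)
      then have "a \<sqsubseteq>\<^bsub>M\<^esub> c" using le a A by auto
      then show ?thesis using c a A C mn by (meson M.le_trans subsetD)
    qed
    then show ?thesis using A C mn by (auto intro!: M.sup_least)
  qed
  have inj: "inj_on e (carrier M)" by (intro inj_onI M.le_antisym e_le) auto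
  define N where "N = transport e M"
  define g where "g = inv_into (carrier M) e"
  have ge: "g (e x) = x" if "x \<in> carrier M" for x using inj that by (simp add: g_def)
  have N: "symmetric_frith_frame N (e ` C)"
    unfolding N_def by (rule transport_symmetric[OF \<open>frame M\<close> inj M])
  have e: "frith_mor M C N (e ` C) e"
    unfolding N_def by (rule transport_mor[OF \<open>frame M\<close> inj])
  have g: "frith_mor N (e ` C) M C g"
    unfolding N_def g_def by (rule transport_mor_inv[OF \<open>frame M\<close> inj C])
  have carN: "carrier N = e ` carrier M" by (simp add: N_def transport_def)
  have "g ` e ` C = C" using C by (simp add: g_def inv_into_image_cancel[OF inj])
  then have "(h \<circ> g) ` e ` C = B" by (simp only: image_comp[symmetric] hC)
  with frith_mor_comp[OF g mor] have "frith_extremal_epi N (e ` C) L B (h \<circ> g)"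
    by (simp only: frith_extremal_epi_def)
  moreover have "dense N L (h \<circ> g)"
  proof -
    have "\<bottom>\<^bsub>N\<^esub> = e \<bottom>\<^bsub>M\<^esub>"
      unfolding N_def by (rule transport_bottom[OF \<open>frame M\<close> inj])
    then show ?thesis using dense by (simp add: dense_def carN ge)
  qed
  ultimately have "frith_iso N (e ` C) L B (h \<circ> g)"
    using complete N unfolding symmetric_complete_def by blast
  then obtain k where k: "frith_mor L B N (e ` C) k"
      "\<forall>x\<in>carrier N. k (h (g x)) = x" "\<forall>y\<in>carrier L. h (g (k y)) = y"
    by (auto simp: frith_iso_def)
  show ?thesis unfolding frith_iso_def
  proof (intro conjI exI[of _ "g \<circ> k"] ballI)
    show "frith_mor L B M C (g \<circ> k)" by (rule frith_mor_comp[OF k(1) g])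
    show "(g \<circ> k) (h x) = x" if "x \<in> carrier M" for x
    proof -
      have "k (h (g (e x))) = e x" using k(2) that carN by blast
      then show ?thesis using that by (simp add: ge)
    qed
  qed (use mor k in auto)
qed

definition congruence :: "'a gorder \<Rightarrow> ('a \<times> 'a) set \<Rightarrow> bool" where
  "congruence L R \<longleftrightarrow> equiv (carrier L) R \<and>
     (\<forall>(x, y)\<in>R. \<forall>(x', y')\<in>R. (x \<sqinter>\<^bsub>L\<^esub> x', y \<sqinter>\<^bsub>L\<^esub> y') \<in> R) \<and>
     (\<forall>P\<subseteq>R. (\<Squnion>\<^bsub>L\<^esub>(fst ` P), \<Squnion>\<^bsub>L\<^esub>(snd ` P)) \<in> R)"

definition congruence_frame :: "'a gorder \<Rightarrow> ('a \<times> 'a) set gorder" where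
  "congruence_frame L = \<lparr>carrier = {R. congruence L R}, eq = (=), le = (\<subseteq>)\<rparr>"

definition nabla :: "'a gorder \<Rightarrow> 'a \<Rightarrow> ('a \<times> 'a) set" where
  "nabla L a = {(x, y). x \<in> carrier L \<and> y \<in> carrier L \<and> a \<squnion>\<^bsub>L\<^esub> x = a \<squnion>\<^bsub>L\<^esub> y}"

definition delta :: "'a gorder \<Rightarrow> 'a \<Rightarrow> ('a \<times> 'a) set" where
  "delta L a = {(x, y). x \<in> carrier L \<and> y \<in> carrier L \<and> a \<sqinter>\<^bsub>L\<^esub> x = a \<sqinter>\<^bsub>L\<^esub> y}"

text \<open>The empty join gives \<open>\<bottom>\<close>; binary meets and \<open>\<top>\<close> give all finite meets.\<close>

definition subframe :: "'a set \<Rightarrow> 'a gorder \<Rightarrow> bool" where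
  "subframe U L \<longleftrightarrow> U \<subseteq> carrier L \<and> \<top>\<^bsub>L\<^esub> \<in> U \<and>
     (\<forall>x\<in>U. \<forall>y\<in>U. x \<sqinter>\<^bsub>L\<^esub> y \<in> U) \<and> (\<forall>A\<subseteq>U. \<Squnion>\<^bsub>L\<^esub>A \<in> U)"

definition subframe_generated :: "'a gorder \<Rightarrow> 'a set \<Rightarrow> 'a set" where
  "subframe_generated L G = \<Inter>{U. subframe U L \<and> G \<subseteq> U}"

definition sublattice_generated :: "'a gorder \<Rightarrow> 'a set \<Rightarrow> 'a set" where
  "sublattice_generated L G = \<Inter>{U. sublattice U L \<and> G \<subseteq> U}"

definition CS_frame :: "'a gorder \<Rightarrow> 'a set \<Rightarrow> ('a \<times> 'a) set gorder" where
  "CS_frame L S = (congruence_frame L)\<lparr>carrier :=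
     subframe_generated (congruence_frame L) (nabla L ` carrier L \<union> delta L ` S)\<rparr>"

definition S_bar :: "'a gorder \<Rightarrow> 'a set \<Rightarrow> ('a \<times> 'a) set set" where
  "S_bar L S = sublattice_generated (CS_frame L S) (nabla L ` S \<union> delta L ` S)"

definition frith_complete :: "'a gorder \<Rightarrow> 'a set \<Rightarrow> bool" where
  "frith_complete L S \<longleftrightarrow> symmetric_complete (CS_frame L S) (S_bar L S)"

end

theory Submission
  imports Defs
begin

text \<open>Both conditions of the theorem say that the elements of \<open>S\<close> are compact in \<open>L\<close>, that is, that \<open>L\<close> is the frame
of ideals of \<open>S\<close>; the predicate \<open>coherent\<close> expresses this compactness.

For the condition on morphisms: if the elements of \<open>S\<close> are compact, a morphism that is bijective on the
distinguished sublattices is an isomorphism: it is surjective since \<open>S\<close> generates \<open>L\<close>, and injective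
because an inequality between joins reduces to inequalities between finite joins, which belong to the sublattices (\<open>coherent_imp_frith_iso\<close>). Conversely, the join map
from the ideals of \<open>S\<close> to \<open>L\<close> is bijective between the principal ideals and \<open>S\<close>, and its injectivity is
compactness of the elements of \<open>S\<close> (\<open>ideal_sup_inj_imp_coherent\<close>).

For symmetric Frith frames, completeness is the same property (\<open>symmetric_complete_iff_coherent\<close>): the join
map is dense, it has a symmetric domain if \<open>S\<close> is Boolean, and density of a morphism between symmetric
Frith frames makes it injective on the distinguished Boolean algebra.

It remains to transfer compactness between \<open>S\<close> and the sublattice \<open>S_bar L S\<close> of congruences. From \<open>S_bar L S\<close>
to \<open>S\<close> this holds because \<open>nabla L\<close> embeds \<open>L\<close> into its congruences and preserves joins. From \<open>S\<close> to
\<open>S_bar L S\<close>, complements reduce the claim to covers of the top congruence (\<open>coherent_CS_frame\<close>). By compactness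
of the elements of \<open>S\<close>, a lattice congruence \<open>R\<close> induces a frame congruence \<open>extension L S R\<close>, which relates two
elements of \<open>L\<close> when the elements of \<open>S\<close> below them agree modulo \<open>R\<close>. Every member of \<open>S_bar L S\<close> is contained in
its own extension (\<open>S_bar_extension\<close>). If no finite part of a cover had the full congruence as its join, the
directed union of these finite joins would be a lattice congruence that does not relate top and bottom;
its extension would then be a proper congruence above the whole cover (\<open>S_bar_top_compact\<close>).

All this takes place in the frame of congruences. Its frame law comes from a Heyting implication given by
retractions onto intervals (\<open>congruence_heyting\<close>).\<close>

section \<open>Frames\<close>

context frame
begin

lemma sup_empty_bottom: "\<Squnion>{} = \<bottom>"
  using weak_sup_empty by (simp add: eq_is_equal)

lemma sup_insert:
  "a \<in> carrier L \<Longrightarrow> A \<subseteq> carrier L \<Longrightarrow> \<Squnion>(insert a A) = a \<squnion> \<Squnion>A"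
  using weak_sup_insert by (simp add: eq_is_equal)

lemma bottom_join_eq: "x \<in> carrier L \<Longrightarrow> \<bottom> \<squnion> x = x"
  using bottom_join by (simp add: eq_is_equal)

lemma bottom_meet_eq: "x \<in> carrier L \<Longrightarrow> \<bottom> \<sqinter> x = \<bottom>"
  using bottom_meet by (simp add: eq_is_equal)

lemma top_join_eq: "x \<in> carrier L \<Longrightarrow> \<top> \<squnion> x = \<top>"
  using top_join by (simp add: eq_is_equal)

lemma top_meet_eq: "x \<in> carrier L \<Longrightarrow> \<top> \<sqinter> x = x"
  using top_meet by (simp add: eq_is_equal)

lemma meet_join_distrib:
  assumes "x \<in> carrier L" "y \<in> carrier L" "z \<in> carrier L"
  shows "x \<sqinter> (y \<squnion> z) = (x \<sqinter> y) \<squnion> (x \<sqinter> z)"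
  using assms meet_sup_distrib[of x "{y, z}"] by (simp add: join_def)

lemma meet_join_absorb: "x \<in> carrier L \<Longrightarrow> y \<in> carrier L \<Longrightarrow> x \<sqinter> (x \<squnion> y) = x"
  using join_left le_iff_join by fastforce

lemma join_meet_absorb: "x \<in> carrier L \<Longrightarrow> y \<in> carrier L \<Longrightarrow> x \<squnion> (x \<sqinter> y) = x"
  by (metis join_comm le_iff_meet meet_closed meet_left)

lemma join_meet_distrib:
  assumes x: "x \<in> carrier L" and y: "y \<in> carrier L" and z: "z \<in> carrier L"
  shows "x \<squnion> (y \<sqinter> z) = (x \<squnion> y) \<sqinter> (x \<squnion> z)"
proof -
  have "(x \<squnion> y) \<sqinter> (x \<squnion> z) = ((x \<squnion> y) \<sqinter> x) \<squnion> ((x \<squnion> y) \<sqinter> z)"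
    using assms by (simp add: meet_join_distrib)
  also have "\<dots> = x \<squnion> ((z \<sqinter> x) \<squnion> (z \<sqinter> y))"
    using assms by (metis join_closed meet_comm meet_join_absorb meet_join_distrib)
  also have "\<dots> = (x \<squnion> (x \<sqinter> z)) \<squnion> (y \<sqinter> z)"
    using assms by (metis join_assoc meet_closed meet_comm)
  also have "\<dots> = x \<squnion> (y \<sqinter> z)" using assms by (simp add: join_meet_absorb)
  finally show ?thesis by simp
qed

lemma sup_mono: "A \<subseteq> B \<Longrightarrow> B \<subseteq> carrier L \<Longrightarrow> \<Squnion>A \<sqsubseteq> \<Squnion>B"
  by (rule sup_least) (auto intro: sup_upper)

lemma meet_mono:
  "x \<sqsubseteq> x' \<Longrightarrow> y \<sqsubseteq> y' \<Longrightarrow> x \<in> carrier L \<Longrightarrow> x' \<in> carrier L \<Longrightarrow> y \<in> carrier L \<Longrightarrow> y' \<in> carrier L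
    \<Longrightarrow> x \<sqinter> y \<sqsubseteq> x' \<sqinter> y'"
  by (meson le_trans meet_closed meet_le meet_left meet_right)

lemma join_mono:
  "x \<sqsubseteq> x' \<Longrightarrow> y \<sqsubseteq> y' \<Longrightarrow> x \<in> carrier L \<Longrightarrow> x' \<in> carrier L \<Longrightarrow> y \<in> carrier L \<Longrightarrow> y' \<in> carrier L
    \<Longrightarrow> x \<squnion> y \<sqsubseteq> x' \<squnion> y'"
  using le_trans[of x x' "x' \<squnion> y'"] le_trans[of y y' "x' \<squnion> y'"]
  by (intro join_le) (simp_all add: join_left join_right)

lemma cover_by_complement:
  assumes "x \<in> carrier L" "c \<in> carrier L" "y \<in> carrier L"
    and "x \<sqinter> c = \<bottom>" and "c \<squnion> y = \<top>"
  shows "x \<sqsubseteq> y"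
proof -
  have "x = x \<sqinter> (c \<squnion> y)" using assms(1,5) top_meet_eq[of x] by (simp add: meet_comm)
  also have "\<dots> = x \<sqinter> y" using assms(1-4) by (simp add: meet_join_distrib bottom_join_eq)
  finally show ?thesis using assms(1,3) by (simp add: le_iff_join)
qed

lemma complement_join:
  assumes c: "x \<in> carrier L" "y \<in> carrier L" "c \<in> carrier L" "d \<in> carrier L"
    and x: "x \<sqinter> c = \<bottom>" "x \<squnion> c = \<top>" and y: "y \<sqinter> d = \<bottom>" "y \<squnion> d = \<top>"
  shows "(x \<squnion> y) \<sqinter> (c \<sqinter> d) = \<bottom>" "(x \<squnion> y) \<squnion> (c \<sqinter> d) = \<top>"
proof -
  have "x \<sqinter> (c \<sqinter> d) = (x \<sqinter> c) \<sqinter> d" using c by (simp add: meet_assoc)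
  then have 1: "x \<sqinter> (c \<sqinter> d) = \<bottom>" using c x by (simp add: bottom_meet_eq)
  have "y \<sqinter> (c \<sqinter> d) = (y \<sqinter> d) \<sqinter> c" using c by (simp add: meet_assoc meet_comm[of _ c d])
  then have 2: "y \<sqinter> (c \<sqinter> d) = \<bottom>" using c y by (simp add: bottom_meet_eq)
  have "(x \<squnion> y) \<sqinter> (c \<sqinter> d) = (c \<sqinter> d) \<sqinter> (x \<squnion> y)" by (simp add: meet_comm)
  also have "\<dots> = (x \<sqinter> (c \<sqinter> d)) \<squnion> (y \<sqinter> (c \<sqinter> d))"
    using meet_join_distrib[of "c \<sqinter> d" x y] c unfolding meet_comm[of L "c \<sqinter> d"] by simp
  finally show "(x \<squnion> y) \<sqinter> (c \<sqinter> d) = \<bottom>" using 1 2 bottom_join_eq[of \<bottom>] by simp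
  have "(x \<squnion> y) \<squnion> c = (x \<squnion> c) \<squnion> y" using c by (simp add: join_assoc join_comm[of _ y c])
  then have 3: "(x \<squnion> y) \<squnion> c = \<top>" using c x by (simp add: top_join_eq)
  have "(x \<squnion> y) \<squnion> d = (y \<squnion> d) \<squnion> x" using c by (simp add: join_assoc join_comm[of _ x])
  then have 4: "(x \<squnion> y) \<squnion> d = \<top>" using c y by (simp add: top_join_eq)
  show "(x \<squnion> y) \<squnion> (c \<sqinter> d) = \<top>"
    using c 3 4 top_meet_eq[of \<top>] by (simp add: join_meet_distrib)
qed

lemma complement_meet:
  assumes c: "x \<in> carrier L" "y \<in> carrier L" "c \<in> carrier L" "d \<in> carrier L"
    and x: "x \<sqinter> c = \<bottom>" "x \<squnion> c = \<top>" and y: "y \<sqinter> d = \<bottom>" "y \<squnion> d = \<top>"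
  shows "(x \<sqinter> y) \<sqinter> (c \<squnion> d) = \<bottom>" "(x \<sqinter> y) \<squnion> (c \<squnion> d) = \<top>"
  using complement_join[of c d x y] assms by (simp_all add: meet_comm join_comm)

text \<open>The frame law turns a meet of two joins of elements of \<open>B\<close> into the join of the pairwise meets, which
lie in \<open>B\<close> again. Hence a sublattice that contains the generators of a subframe generates it by
joins alone.\<close>

lemma sups_subframe:
  assumes B: "bounded_sublattice B L"
  shows "subframe {\<Squnion>A | A. A \<subseteq> B} L"
proof -
  have Bc: "B \<subseteq> carrier L" and top: "\<top> \<in> B" and meet: "\<And>x y. x \<in> B \<Longrightarrow> y \<in> B \<Longrightarrow> x \<sqinter> y \<in> B"
    using B by (auto simp: bounded_sublattice_def sublattice_def)
  have sups_c: "{\<Squnion>A | A. A \<subseteq> B} \<subseteq> carrier L"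
  proof clarify
    fix A assume "A \<subseteq> B"
    then show "\<Squnion>A \<in> carrier L" using Bc by (intro sup_closed) blast
  qed
  have meets: "\<exists>D\<subseteq>B. \<Squnion>A \<sqinter> \<Squnion>A' = \<Squnion>D" if A: "A \<subseteq> B" "A' \<subseteq> B" for A A'
  proof (intro exI conjI)
    let ?D = "{a \<sqinter> a' | a a'. a \<in> A \<and> a' \<in> A'}"
    have c: "A \<subseteq> carrier L" "A' \<subseteq> carrier L" using A Bc by auto
    show D: "?D \<subseteq> B" using A meet by blast
    then have Dc: "?D \<subseteq> carrier L" using Bc by blast
    show "\<Squnion>A \<sqinter> \<Squnion>A' = \<Squnion>?D"
    proof (rule le_antisym)
      have "\<Squnion>A \<sqinter> a' \<sqsubseteq> \<Squnion>?D" if a': "a' \<in> A'" for a'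
      proof -
        have a'c: "a' \<in> carrier L" using a' c by blast
        have "a' \<sqinter> a \<sqsubseteq> \<Squnion>?D" if "a \<in> A" for a
          using that a' by (intro sup_upper[OF Dc]) (auto simp: meet_comm[of _ a'])
        then have "a' \<sqinter> \<Squnion>A \<sqsubseteq> \<Squnion>?D"
          unfolding meet_sup_distrib[OF a'c c(1)] using Dc a'c c by (intro sup_least) auto
        then show ?thesis by (simp add: meet_comm)
      qed
      then show "\<Squnion>A \<sqinter> \<Squnion>A' \<sqsubseteq> \<Squnion>?D"
        unfolding meet_sup_distrib[OF sup_closed[OF c(1)] c(2)] using Dc c by (intro sup_least) auto
      show "\<Squnion>?D \<sqsubseteq> \<Squnion>A \<sqinter> \<Squnion>A'"
      proof (rule sup_least[OF Dc])
        fix x assume "x \<in> ?D"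
        then obtain a a' where "a \<in> A" "a' \<in> A'" "x = a \<sqinter> a'" by blast
        then show "x \<sqsubseteq> \<Squnion>A \<sqinter> \<Squnion>A'"
          using c sup_upper[OF c(1)] sup_upper[OF c(2)] by (auto intro!: meet_mono)
      qed (use c in simp)
    qed (use c Dc in auto)
  qed
  have sups: "\<exists>D\<subseteq>B. \<Squnion>Q = \<Squnion>D" if Q: "Q \<subseteq> {\<Squnion>A | A. A \<subseteq> B}" for Q
  proof (intro exI conjI)
    let ?D = "{b \<in> B. \<exists>x\<in>Q. b \<sqsubseteq> x}"
    show D: "?D \<subseteq> B" by blast
    then have Dc: "?D \<subseteq> carrier L" using Bc by blast
    have Qc: "Q \<subseteq> carrier L" using Q sups_c by (rule subset_trans)
    show "\<Squnion>Q = \<Squnion>?D"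
    proof (rule le_antisym)
      have "x \<sqsubseteq> \<Squnion>?D" if x: "x \<in> Q" for x
      proof -
        obtain A where A: "A \<subseteq> B" "x = \<Squnion>A" using x Q by blast
        have "A \<subseteq> ?D" using A x Bc by (auto intro!: bexI[OF _ x] sup_upper)
        then show ?thesis unfolding A(2) by (rule sup_mono[OF _ Dc])
      qed
      then show "\<Squnion>Q \<sqsubseteq> \<Squnion>?D" using Qc Dc by (intro sup_least) auto
      have "b \<sqsubseteq> \<Squnion>Q" if b: "b \<in> ?D" for b
      proof -
        obtain x where "x \<in> Q" "b \<sqsubseteq> x" using b by blast
        then show ?thesis using b Dc Qc sup_upper[OF Qc] by (meson le_trans subsetD sup_closed)
      qed
      then show "\<Squnion>?D \<sqsubseteq> \<Squnion>Q" using Qc Dc by (intro sup_least) auto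
    qed (use Qc Dc in auto)
  qed
  show ?thesis unfolding subframe_def
  proof (intro conjI ballI allI impI sups_c)
    have "\<top> = \<Squnion>{\<top>}" by simp
    then show "\<top> \<in> {\<Squnion>A | A. A \<subseteq> B}" using top by (intro CollectI exI[of _ "{\<top>}"]) simp
    show "x \<sqinter> y \<in> {\<Squnion>A | A. A \<subseteq> B}" if "x \<in> {\<Squnion>A | A. A \<subseteq> B}" "y \<in> {\<Squnion>A | A. A \<subseteq> B}" for x y
    proof -
      obtain A A' where "A \<subseteq> B" "x = \<Squnion>A" "A' \<subseteq> B" "y = \<Squnion>A'" using \<open>x \<in> _\<close> \<open>y \<in> _\<close> by blast
      then show ?thesis using meets[of A A'] by auto
    qed
    show "\<Squnion>Q \<in> {\<Squnion>A | A. A \<subseteq> B}" if "Q \<subseteq> {\<Squnion>A | A. A \<subseteq> B}" for Q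
      using sups[OF that] by auto
  qed
qed

lemma carrier_subframe: "subframe (carrier L) L"
  by (simp add: subframe_def)

lemma subframe_generated_subframe:
  assumes "G \<subseteq> carrier L"
  shows "subframe (subframe_generated L G) L"
proof -
  let ?U = "subframe_generated L G"
  have U: "?U = \<Inter>{U. subframe U L \<and> G \<subseteq> U}" by (simp add: subframe_generated_def)
  have "carrier L \<in> {U. subframe U L \<and> G \<subseteq> U}" using carrier_subframe assms by simp
  then have "?U \<subseteq> carrier L" unfolding U by blast
  moreover have "\<top> \<in> ?U" unfolding U by (auto simp: subframe_def)
  moreover have "x \<sqinter> y \<in> ?U" if "x \<in> ?U" "y \<in> ?U" for x y
    using that unfolding U by (auto simp: subframe_def)
  moreover have "\<Squnion>A \<in> ?U" if "A \<subseteq> ?U" for A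
    using that unfolding U subframe_def by blast
  ultimately show ?thesis by (simp add: subframe_def)
qed

end

section \<open>Sublattices and subframes\<close>

lemma suborder_partial_order:
  assumes "partial_order L" "U \<subseteq> carrier L"
  shows "partial_order (L\<lparr>carrier := U\<rparr>)"
proof -
  interpret partial_order L by fact
  interpret weak_partial_order "L\<lparr>carrier := U\<rparr>"
    by (rule weak_partial_order_subset) (use assms(2) weak_partial_order_axioms in auto)
  show ?thesis by standard (simp add: eq_is_equal)
qed

text \<open>A bound that is optimal in the whole order and lies in the subset is optimal in the subset. So the
operations of a sublattice or subframe, computed in the restricted order, are those of the ambient frame.\<close>

lemma suborder_sup:
  assumes "partial_order L" "U \<subseteq> carrier L" "A \<subseteq> U" "x \<in> U" "least L x (Upper L A)"
  shows "least (L\<lparr>carrier := U\<rparr>) x (Upper (L\<lparr>carrier := U\<rparr>) A)" "\<Squnion>\<^bsub>L\<lparr>carrier := U\<rparr>\<^esub>A = x"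
proof -
  interpret U: partial_order "L\<lparr>carrier := U\<rparr>" by (rule suborder_partial_order[OF assms(1,2)])
  show *: "least (L\<lparr>carrier := U\<rparr>) x (Upper (L\<lparr>carrier := U\<rparr>) A)"
  proof (rule least_UpperI)
    fix y assume "y \<in> Upper (L\<lparr>carrier := U\<rparr>) A"
    then have "y \<in> Upper L A" using assms(2,3) by (auto simp: Upper_def)
    then show "x \<sqsubseteq>\<^bsub>L\<lparr>carrier := U\<rparr>\<^esub> y" using assms(5) by (simp add: least_def)
  next
    fix a assume "a \<in> A"
    then show "a \<sqsubseteq>\<^bsub>L\<lparr>carrier := U\<rparr>\<^esub> x" using assms(2,3) least_Upper_above[OF assms(5)] by simp
  qed (use assms in simp_all)
  then show "\<Squnion>\<^bsub>L\<lparr>carrier := U\<rparr>\<^esub>A = x"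
    unfolding sup_def by (metis (lifting) U.least_unique someI_ex)
qed

lemma suborder_inf:
  assumes "partial_order L" "U \<subseteq> carrier L" "A \<subseteq> U" "x \<in> U" "greatest L x (Lower L A)"
  shows "greatest (L\<lparr>carrier := U\<rparr>) x (Lower (L\<lparr>carrier := U\<rparr>) A)" "\<Sqinter>\<^bsub>L\<lparr>carrier := U\<rparr>\<^esub>A = x"
proof -
  interpret U: partial_order "L\<lparr>carrier := U\<rparr>" by (rule suborder_partial_order[OF assms(1,2)])
  show *: "greatest (L\<lparr>carrier := U\<rparr>) x (Lower (L\<lparr>carrier := U\<rparr>) A)"
  proof (rule greatest_LowerI)
    fix y assume "y \<in> Lower (L\<lparr>carrier := U\<rparr>) A"
    then have "y \<in> Lower L A" using assms(2,3) by (auto simp: Lower_def)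
    then show "y \<sqsubseteq>\<^bsub>L\<lparr>carrier := U\<rparr>\<^esub> x" using assms(5) by (simp add: greatest_def)
  next
    fix a assume "a \<in> A"
    then show "x \<sqsubseteq>\<^bsub>L\<lparr>carrier := U\<rparr>\<^esub> a" using assms(2,3) greatest_Lower_below[OF assms(5)] by simp
  qed (use assms in simp_all)
  then show "\<Sqinter>\<^bsub>L\<lparr>carrier := U\<rparr>\<^esub>A = x"
    unfolding inf_def by (metis (lifting) U.greatest_unique someI_ex)
qed

lemma suborder_bottom:
  assumes "complete_lattice L" "U \<subseteq> carrier L" "\<bottom>\<^bsub>L\<^esub> \<in> U"
  shows "\<bottom>\<^bsub>L\<lparr>carrier := U\<rparr>\<^esub> = \<bottom>\<^bsub>L\<^esub>"
proof -
  interpret L: complete_lattice L by fact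
  interpret U: partial_order "L\<lparr>carrier := U\<rparr>"
    using suborder_partial_order[OF L.partial_order_axioms assms(2)] .
  have *: "least (L\<lparr>carrier := U\<rparr>) \<bottom>\<^bsub>L\<^esub> (carrier (L\<lparr>carrier := U\<rparr>))"
    using assms by (auto simp: least_def)
  then show ?thesis unfolding bottom_def[of "L\<lparr>carrier := U\<rparr>"] by (metis (lifting) U.least_unique someI_ex)
qed

lemma suborder_top:
  assumes "complete_lattice L" "U \<subseteq> carrier L" "\<top>\<^bsub>L\<^esub> \<in> U"
  shows "\<top>\<^bsub>L\<lparr>carrier := U\<rparr>\<^esub> = \<top>\<^bsub>L\<^esub>"
proof -
  interpret L: complete_lattice L by fact
  interpret U: partial_order "L\<lparr>carrier := U\<rparr>"
    using suborder_partial_order[OF L.partial_order_axioms assms(2)] .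
  have *: "greatest (L\<lparr>carrier := U\<rparr>) \<top>\<^bsub>L\<^esub> (carrier (L\<lparr>carrier := U\<rparr>))"
    using assms by (auto simp: greatest_def)
  then show ?thesis unfolding top_def[of "L\<lparr>carrier := U\<rparr>"] by (metis (lifting) U.greatest_unique someI_ex)
qed

lemma
  assumes "lattice L" "sublattice U L"
  shows sublat_lattice: "lattice (sublat L U)"
    and sublat_join: "x \<in> U \<Longrightarrow> y \<in> U \<Longrightarrow> x \<squnion>\<^bsub>sublat L U\<^esub> y = x \<squnion>\<^bsub>L\<^esub> y"
    and sublat_meet: "x \<in> U \<Longrightarrow> y \<in> U \<Longrightarrow> x \<sqinter>\<^bsub>sublat L U\<^esub> y = x \<sqinter>\<^bsub>L\<^esub> y"
proof -
  interpret L: lattice L by fact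
  have U: "U \<subseteq> carrier L" and cl: "\<And>x y. x \<in> U \<Longrightarrow> y \<in> U \<Longrightarrow> x \<squnion>\<^bsub>L\<^esub> y \<in> U \<and> x \<sqinter>\<^bsub>L\<^esub> y \<in> U"
    using assms by (auto simp: sublattice_def)
  interpret U: partial_order "sublat L U" by (rule suborder_partial_order[OF L.partial_order_axioms U])
  have s: "least L (x \<squnion>\<^bsub>L\<^esub> y) (Upper L {x, y})" if "x \<in> U" "y \<in> U" for x y
    using that U unfolding join_def by (auto intro!: L.weak.sup_of_two_least)
  have i: "greatest L (x \<sqinter>\<^bsub>L\<^esub> y) (Lower L {x, y})" if "x \<in> U" "y \<in> U" for x y
    using that U unfolding meet_def by (auto intro!: L.weak.inf_of_two_greatest)
  note S = suborder_sup[OF L.partial_order_axioms U _ _ s]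
  note I = suborder_inf[OF L.partial_order_axioms U _ _ i]
  show "x \<in> U \<Longrightarrow> y \<in> U \<Longrightarrow> x \<squnion>\<^bsub>sublat L U\<^esub> y = x \<squnion>\<^bsub>L\<^esub> y"
    using S(2)[of x y] cl unfolding join_def by simp
  show "x \<in> U \<Longrightarrow> y \<in> U \<Longrightarrow> x \<sqinter>\<^bsub>sublat L U\<^esub> y = x \<sqinter>\<^bsub>L\<^esub> y"
    using I(2)[of x y] cl unfolding meet_def by simp
  show "lattice (sublat L U)"
  proof
    fix x y assume "x \<in> carrier (sublat L U)" "y \<in> carrier (sublat L U)"
    then show "\<exists>s. least (sublat L U) s (Upper (sublat L U) {x, y})"
      "\<exists>s. greatest (sublat L U) s (Lower (sublat L U) {x, y})"
      using S(1)[of x y] I(1)[of x y] cl by auto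
  qed
qed

lemma
  assumes "frame L" "subframe U L"
  shows subframe_frame: "frame (L\<lparr>carrier := U\<rparr>)"
    and subframe_sup: "A \<subseteq> U \<Longrightarrow> \<Squnion>\<^bsub>L\<lparr>carrier := U\<rparr>\<^esub>A = \<Squnion>\<^bsub>L\<^esub>A"
    and subframe_sublattice: "bounded_sublattice U L"
proof -
  interpret L: frame L by fact
  have U: "U \<subseteq> carrier L" and top: "\<top>\<^bsub>L\<^esub> \<in> U" and meet: "\<And>x y. x \<in> U \<Longrightarrow> y \<in> U \<Longrightarrow> x \<sqinter>\<^bsub>L\<^esub> y \<in> U"
    and sup: "\<And>A. A \<subseteq> U \<Longrightarrow> \<Squnion>\<^bsub>L\<^esub>A \<in> U"
    using assms by (auto simp: subframe_def)
  have join: "x \<squnion>\<^bsub>L\<^esub> y \<in> U" if "x \<in> U" "y \<in> U" for x y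
    using sup[of "{x, y}"] that by (simp add: join_def)
  have bot: "\<bottom>\<^bsub>L\<^esub> \<in> U" using sup[of "{}"] by (simp add: L.sup_empty_bottom)
  show bs: "bounded_sublattice U L"
    using U top meet join bot by (simp add: bounded_sublattice_def sublattice_def)
  then have sl: "sublattice U L" by (simp add: bounded_sublattice_def)
  interpret U: partial_order "L\<lparr>carrier := U\<rparr>" by (rule suborder_partial_order[OF L.partial_order_axioms U])
  note S = suborder_sup[OF L.partial_order_axioms U _ _ L.sup_lub]
  show S2: "\<Squnion>\<^bsub>L\<lparr>carrier := U\<rparr>\<^esub>A = \<Squnion>\<^bsub>L\<^esub>A" if "A \<subseteq> U" for A
    using S(2)[of A] that sup U by auto
  have I: "\<exists>i. greatest (L\<lparr>carrier := U\<rparr>) i (Lower (L\<lparr>carrier := U\<rparr>) A)" if A: "A \<subseteq> U" for A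
  proof -
    define B where "B = {x \<in> U. \<forall>a\<in>A. x \<sqsubseteq>\<^bsub>L\<^esub> a}"
    have B: "B \<subseteq> carrier L" using U by (auto simp: B_def)
    have "greatest (L\<lparr>carrier := U\<rparr>) (\<Squnion>\<^bsub>L\<^esub>B) (Lower (L\<lparr>carrier := U\<rparr>) A)"
    proof (rule greatest_LowerI)
      fix a assume "a \<in> A"
      then have "\<Squnion>\<^bsub>L\<^esub>B \<sqsubseteq>\<^bsub>L\<^esub> a" using A U by (intro L.sup_least B) (auto simp: B_def)
      then show "\<Squnion>\<^bsub>L\<^esub>B \<sqsubseteq>\<^bsub>L\<lparr>carrier := U\<rparr>\<^esub> a" by simp
    next
      fix y assume "y \<in> Lower (L\<lparr>carrier := U\<rparr>) A"
      then have "y \<in> B" using A by (auto simp: Lower_def B_def)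
      then show "y \<sqsubseteq>\<^bsub>L\<lparr>carrier := U\<rparr>\<^esub> \<Squnion>\<^bsub>L\<^esub>B" using B by (simp add: L.sup_upper)
    next
      have "B \<subseteq> U" by (auto simp: B_def)
      then show "\<Squnion>\<^bsub>L\<^esub>B \<in> carrier (L\<lparr>carrier := U\<rparr>)" using sup by simp
    qed (use A in simp)
    then show ?thesis ..
  qed
  interpret U: complete_lattice "L\<lparr>carrier := U\<rparr>"
  proof
    fix A assume "A \<subseteq> carrier (L\<lparr>carrier := U\<rparr>)"
    then have A: "A \<subseteq> U" by simp
    then show "\<exists>i. greatest (L\<lparr>carrier := U\<rparr>) i (Lower (L\<lparr>carrier := U\<rparr>) A)" by (rule I)
    have "A \<subseteq> carrier L" using A U by blast
    with S(1)[OF A sup[OF A]]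
    show "\<exists>s. least (L\<lparr>carrier := U\<rparr>) s (Upper (L\<lparr>carrier := U\<rparr>) A)" by blast
  qed
  show "frame (L\<lparr>carrier := U\<rparr>)"
  proof
    fix x A assume x: "x \<in> carrier (L\<lparr>carrier := U\<rparr>)" and A: "A \<subseteq> carrier (L\<lparr>carrier := U\<rparr>)"
    have m: "x \<sqinter>\<^bsub>L\<lparr>carrier := U\<rparr>\<^esub> y = x \<sqinter>\<^bsub>L\<^esub> y" if "y \<in> U" for y
      using sublat_meet[OF L.lattice_axioms sl] x that by simp
    have "x \<sqinter>\<^bsub>L\<lparr>carrier := U\<rparr>\<^esub> \<Squnion>\<^bsub>L\<lparr>carrier := U\<rparr>\<^esub>A = x \<sqinter>\<^bsub>L\<^esub> \<Squnion>\<^bsub>L\<^esub>A"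
      using A sup by (simp add: S2 m)
    also have "\<dots> = \<Squnion>\<^bsub>L\<^esub>((\<lambda>a. x \<sqinter>\<^bsub>L\<^esub> a) ` A)" using x A U by (intro L.meet_sup_distrib) auto
    also have "(\<lambda>a. x \<sqinter>\<^bsub>L\<^esub> a) ` A = (\<lambda>a. x \<sqinter>\<^bsub>L\<lparr>carrier := U\<rparr>\<^esub> a) ` A"
      using A by (intro image_cong) (auto simp: m)
    also have "\<Squnion>\<^bsub>L\<^esub>\<dots> = \<Squnion>\<^bsub>L\<lparr>carrier := U\<rparr>\<^esub>\<dots>"
      using A x meet m by (subst S2) auto
    finally show "x \<sqinter>\<^bsub>L\<lparr>carrier := U\<rparr>\<^esub> \<Squnion>\<^bsub>L\<lparr>carrier := U\<rparr>\<^esub>A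
        = \<Squnion>\<^bsub>L\<lparr>carrier := U\<rparr>\<^esub>((\<lambda>a. x \<sqinter>\<^bsub>L\<lparr>carrier := U\<rparr>\<^esub> a) ` A)" .
  qed
qed

section \<open>Frames of sets ordered by inclusion\<close>

definition inclusion_order :: "'x set set \<Rightarrow> 'x set gorder" where
  "inclusion_order F = \<lparr>carrier = F, eq = (=), le = (\<subseteq>)\<rparr>"

lemma inclusion_order_simps [simp]:
  "carrier (inclusion_order F) = F" "le (inclusion_order F) = (\<subseteq>)"
  by (simp_all add: inclusion_order_def)

text \<open>A family closed under intersections is a complete lattice whose joins are usually not unions, so the
frame law cannot be read off elementwise. It follows from a Heyting implication: \<open>B \<inter> _\<close> then has a
right adjoint and therefore preserves joins. Both the ideals of a distributive lattice and the
congruences of a frame are treated in this way.\<close>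

lemma
  assumes top: "X \<in> F" "\<And>A. A \<in> F \<Longrightarrow> A \<subseteq> X"
    and int: "\<And>Q. Q \<subseteq> F \<Longrightarrow> Q \<noteq> {} \<Longrightarrow> \<Inter>Q \<in> F"
    and imp: "\<And>B C. B \<in> F \<Longrightarrow> C \<in> F \<Longrightarrow> \<exists>H\<in>F. \<forall>A\<in>F. A \<inter> B \<subseteq> C \<longleftrightarrow> A \<subseteq> H"
  shows inclusion_order_frame: "frame (inclusion_order F)"
    and inclusion_order_meet: "A \<in> F \<Longrightarrow> B \<in> F \<Longrightarrow> A \<sqinter>\<^bsub>inclusion_order F\<^esub> B = A \<inter> B"
    and inclusion_order_top: "\<top>\<^bsub>inclusion_order F\<^esub> = X"
proof -
  let ?L = "inclusion_order F"
  interpret L: partial_order ?L by standard (auto simp: inclusion_order_def)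
  have inf: "greatest ?L (\<Inter>Q) (Lower ?L Q)" if "Q \<subseteq> F" "Q \<noteq> {}" for Q
    using that int by (auto simp: greatest_def Lower_def)
  interpret L: complete_lattice ?L
  proof (rule L.complete_lattice_criterion1)
    show "\<exists>g. greatest ?L g (carrier ?L)" using top by (intro exI[of _ X]) (simp add: greatest_def)
    show "\<exists>i. greatest ?L i (Lower ?L Q)" if "Q \<subseteq> carrier ?L" "Q \<noteq> {}" for Q
      using inf[of Q] that by auto
  qed
  show meet: "A \<sqinter>\<^bsub>?L\<^esub> B = A \<inter> B" if "A \<in> F" "B \<in> F" for A B
    using L.greatest_unique[OF L.inf_glb[of "{A, B}"] inf[of "{A, B}"]] that by (simp add: meet_def)
  show "\<top>\<^bsub>?L\<^esub> = X" using top by (metis L.top_closed L.top_higher inclusion_order_simps subset_antisym)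
  show "frame ?L"
  proof
    fix B Q assume B: "B \<in> carrier ?L" and Q: "Q \<subseteq> carrier ?L"
    let ?R = "\<Squnion>\<^bsub>?L\<^esub>((\<lambda>A. B \<sqinter>\<^bsub>?L\<^esub> A) ` Q)"
    have sub: "(\<lambda>A. B \<sqinter>\<^bsub>?L\<^esub> A) ` Q \<subseteq> F" using B Q by (auto simp: subset_iff) (metis L.meet_closed inclusion_order_simps(1))
    then have R: "?R \<in> F" using L.sup_closed by simp
    obtain H where H: "H \<in> F" "\<And>A. A \<in> F \<Longrightarrow> A \<inter> B \<subseteq> ?R \<longleftrightarrow> A \<subseteq> H"
      using imp[of B ?R] B R by auto
    \<comment> \<open>\<open>H\<close> is the implication \<open>B \<longrightarrow> R\<close>; every member of \<open>Q\<close> lies below it, hence so does their join.\<close>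
    have "A \<subseteq> H" if A: "A \<in> Q" for A
    proof -
      have "B \<sqinter>\<^bsub>?L\<^esub> A \<subseteq> ?R" using L.sup_upper[of "(\<lambda>A. B \<sqinter>\<^bsub>?L\<^esub> A) ` Q"] sub A by auto
      moreover have AF: "A \<in> F" using A Q by auto
      ultimately have "A \<inter> B \<subseteq> ?R" using meet[of B A] B by (simp add: Int_commute)
      then show ?thesis using H(2) AF by simp
    qed
    then have "\<Squnion>\<^bsub>?L\<^esub>Q \<subseteq> H" using L.sup_least[of Q H] H Q by auto
    then have "\<Squnion>\<^bsub>?L\<^esub>Q \<inter> B \<subseteq> ?R" using H Q L.sup_closed[of Q] by auto
    then have 1: "B \<sqinter>\<^bsub>?L\<^esub> \<Squnion>\<^bsub>?L\<^esub>Q \<subseteq> ?R" using B Q L.sup_closed[of Q] meet by (auto simp: Int_commute)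
    have "B \<sqinter>\<^bsub>?L\<^esub> A \<subseteq> B \<sqinter>\<^bsub>?L\<^esub> \<Squnion>\<^bsub>?L\<^esub>Q" if "A \<in> Q" for A
      using L.sup_upper[of Q A] that B Q L.sup_closed[of Q] by (auto simp: meet subset_iff)
    then have 2: "?R \<subseteq> B \<sqinter>\<^bsub>?L\<^esub> \<Squnion>\<^bsub>?L\<^esub>Q"
      using L.sup_least[of "(\<lambda>A. B \<sqinter>\<^bsub>?L\<^esub> A) ` Q" "B \<sqinter>\<^bsub>?L\<^esub> \<Squnion>\<^bsub>?L\<^esub>Q"] sub B Q L.meet_closed L.sup_closed[of Q] by auto
    show "B \<sqinter>\<^bsub>?L\<^esub> \<Squnion>\<^bsub>?L\<^esub>Q = ?R" using 1 2 by simp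
  qed
qed

section \<open>Morphisms of Frith frames\<close>

lemma frith_frameD:
  assumes "frith_frame L S"
  shows "frame L" "bounded_sublattice S L" "sublattice S L" "S \<subseteq> carrier L" "\<bottom>\<^bsub>L\<^esub> \<in> S" "\<top>\<^bsub>L\<^esub> \<in> S"
    and "\<And>x y. x \<in> S \<Longrightarrow> y \<in> S \<Longrightarrow> x \<squnion>\<^bsub>L\<^esub> y \<in> S"
    and "\<And>x y. x \<in> S \<Longrightarrow> y \<in> S \<Longrightarrow> x \<sqinter>\<^bsub>L\<^esub> y \<in> S"
  using assms by (auto simp: frith_frame_def bounded_sublattice_def sublattice_def)

lemma frith_frame_basis:
  assumes "frith_frame L S" "x \<in> carrier L"
  obtains A where "A \<subseteq> S" "x = \<Squnion>\<^bsub>L\<^esub>A"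
  using assms by (auto simp: frith_frame_def)

lemma finite_sup_in_sublattice:
  assumes L: "frame L" and S: "bounded_sublattice S L" and "finite F" "F \<subseteq> S"
  shows "\<Squnion>\<^bsub>L\<^esub>F \<in> S"
proof -
  interpret frame L by (rule L)
  have "S \<subseteq> carrier L" "\<bottom>\<^bsub>L\<^esub> \<in> S" "\<And>x y. x \<in> S \<Longrightarrow> y \<in> S \<Longrightarrow> x \<squnion>\<^bsub>L\<^esub> y \<in> S"
    using S by (auto simp: bounded_sublattice_def sublattice_def)
  note S = this
  show ?thesis using assms(3,4)
  proof (induction F rule: finite_induct)
    case empty
    then show ?case using S(2) by (simp add: sup_empty_bottom)
  next
    case (insert a F)
    then have "\<Squnion>\<^bsub>L\<^esub>(insert a F) = a \<squnion>\<^bsub>L\<^esub> \<Squnion>\<^bsub>L\<^esub>F" using S(1) by (intro sup_insert) auto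
    then show ?case using insert S(3) by simp
  qed
qed

lemma
  assumes "frame_hom L M h"
  shows frame_hom_closed: "x \<in> carrier L \<Longrightarrow> h x \<in> carrier M"
    and frame_hom_sup: "A \<subseteq> carrier L \<Longrightarrow> h (\<Squnion>\<^bsub>L\<^esub>A) = \<Squnion>\<^bsub>M\<^esub>(h ` A)"
    and frame_hom_meet:
      "x \<in> carrier L \<Longrightarrow> y \<in> carrier L \<Longrightarrow> h (x \<sqinter>\<^bsub>L\<^esub> y) = h x \<sqinter>\<^bsub>M\<^esub> h y"
    and frame_hom_join:
      "x \<in> carrier L \<Longrightarrow> y \<in> carrier L \<Longrightarrow> h (x \<squnion>\<^bsub>L\<^esub> y) = h x \<squnion>\<^bsub>M\<^esub> h y"
    and frame_hom_bottom: "h \<bottom>\<^bsub>L\<^esub> = \<bottom>\<^bsub>M\<^esub>"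
    and frame_hom_top: "h \<top>\<^bsub>L\<^esub> = \<top>\<^bsub>M\<^esub>"
proof -
  interpret L: complete_lattice L using assms by (simp add: frame_hom_def sup_pres_def)
  interpret M: complete_lattice M using assms by (simp add: frame_hom_def sup_pres_def)
  show "x \<in> carrier L \<Longrightarrow> h x \<in> carrier M" "h \<top>\<^bsub>L\<^esub> = \<top>\<^bsub>M\<^esub>"
    "x \<in> carrier L \<Longrightarrow> y \<in> carrier L \<Longrightarrow> h (x \<sqinter>\<^bsub>L\<^esub> y) = h x \<sqinter>\<^bsub>M\<^esub> h y"
    using assms by (auto simp: frame_hom_def meet_pres_def)
  show sup: "h (\<Squnion>\<^bsub>L\<^esub>A) = \<Squnion>\<^bsub>M\<^esub>(h ` A)" if "A \<subseteq> carrier L" for A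
    using assms that by (simp add: frame_hom_def sup_pres_def)
  show "x \<in> carrier L \<Longrightarrow> y \<in> carrier L \<Longrightarrow> h (x \<squnion>\<^bsub>L\<^esub> y) = h x \<squnion>\<^bsub>M\<^esub> h y"
    using sup[of "{x, y}"] by (simp add: join_def)
  show "h \<bottom>\<^bsub>L\<^esub> = \<bottom>\<^bsub>M\<^esub>"
    using sup[of "{}"] L.weak_sup_empty M.weak_sup_empty by (simp add: L.eq_is_equal M.eq_is_equal)
qed

lemma frith_isoI:
  assumes mor: "frith_mor L S M T h" and S: "S \<subseteq> carrier L"
    and inj: "inj_on h (carrier L)" and surj: "h ` carrier L = carrier M" and onto: "h ` S = T"
  shows "frith_iso L S M T h"
proof -
  have hom: "frame_hom L M h" using mor by (simp add: frith_mor_def)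
  interpret L: complete_lattice L using hom by (simp add: frame_hom_def sup_pres_def)
  interpret M: complete_lattice M using hom by (simp add: frame_hom_def sup_pres_def)
  let ?g = "inv_into (carrier L) h"
  have gh: "?g (h x) = x" if "x \<in> carrier L" for x using inj that by simp
  have hg: "h (?g y) = y" "?g y \<in> carrier L" if "y \<in> carrier M" for y
    using that surj by (simp_all add: f_inv_into_f inv_into_into)
  have sup: "?g (\<Squnion>\<^bsub>M\<^esub>B) = \<Squnion>\<^bsub>L\<^esub>(?g ` B)" if B: "B \<subseteq> carrier M" for B
  proof -
    have g: "?g ` B \<subseteq> carrier L" using B hg(2) by auto
    have "h ` ?g ` B = B" unfolding image_image using B hg(1) by (force simp: subset_iff)
    then have "h (\<Squnion>\<^bsub>L\<^esub>(?g ` B)) = \<Squnion>\<^bsub>M\<^esub>B" using frame_hom_sup[OF hom g] by simp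
    then show ?thesis using gh[of "\<Squnion>\<^bsub>L\<^esub>(?g ` B)"] g by simp
  qed
  have meet: "?g (x \<sqinter>\<^bsub>M\<^esub> y) = ?g x \<sqinter>\<^bsub>L\<^esub> ?g y" if "x \<in> carrier M" "y \<in> carrier M" for x y
    using gh[of "?g x \<sqinter>\<^bsub>L\<^esub> ?g y"] frame_hom_meet[OF hom, of "?g x" "?g y"] that hg by simp
  have top: "?g \<top>\<^bsub>M\<^esub> = \<top>\<^bsub>L\<^esub>" using gh[of "\<top>\<^bsub>L\<^esub>"] frame_hom_top[OF hom] by simp
  have "?g ` T \<subseteq> S" using onto S gh by auto
  then have "frith_mor M T L S ?g"
    using sup meet top hg(2) L.complete_lattice_axioms M.complete_lattice_axioms
      L.lattice_axioms M.lattice_axioms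
    by (simp add: frith_mor_def frame_hom_def sup_pres_def meet_pres_def Pi_iff)
  then show ?thesis unfolding frith_iso_def using mor gh hg(1) by blast
qed

lemma frith_iso_inj: "frith_iso L S M T h \<Longrightarrow> inj_on h (carrier L)"
  unfolding frith_iso_def by (metis inj_onI)

text \<open>The join and meet laws of the restriction are inherited from \<open>h\<close>, so only bijectivity remains of the
condition that it be a lattice isomorphism.\<close>

lemma lattice_iso_sublat_iff:
  assumes M: "frith_frame M T" and L: "frith_frame L S" and mor: "frith_mor M T L S h"
  shows "lattice_iso (sublat M T) (sublat L S) h \<longleftrightarrow> bij_betw h T S"
proof
  show "lattice_iso (sublat M T) (sublat L S) h \<Longrightarrow> bij_betw h T S" by (simp add: lattice_iso_def)
next
  assume bij: "bij_betw h T S"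
  interpret L: frame L by (rule frith_frameD[OF L])
  interpret M: frame M by (rule frith_frameD[OF M])
  have hom: "frame_hom M L h" using mor by (simp add: frith_mor_def)
  have T: "x \<in> T \<Longrightarrow> x \<in> carrier M" for x using frith_frameD[OF M] by auto
  have hT: "x \<in> T \<Longrightarrow> h x \<in> S" for x using bij by (auto simp: bij_betw_def)
  note simps = sublat_join[OF M.lattice_axioms frith_frameD(3)[OF M]]
    sublat_join[OF L.lattice_axioms frith_frameD(3)[OF L]]
    sublat_meet[OF M.lattice_axioms frith_frameD(3)[OF M]]
    sublat_meet[OF L.lattice_axioms frith_frameD(3)[OF L]]
    frame_hom_join[OF hom] frame_hom_meet[OF hom] T hT
  have "bounded_lattice_hom (sublat M T) (sublat L S) h"
    unfolding bounded_lattice_hom_def join_pres_def meet_pres_def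
      suborder_bottom[OF M.complete_lattice_axioms frith_frameD(4,5)[OF M]]
      suborder_bottom[OF L.complete_lattice_axioms frith_frameD(4,5)[OF L]]
      suborder_top[OF M.complete_lattice_axioms frith_frameD(4,6)[OF M]]
      suborder_top[OF L.complete_lattice_axioms frith_frameD(4,6)[OF L]]
    using sublat_lattice[OF M.lattice_axioms frith_frameD(3)[OF M]]
      sublat_lattice[OF L.lattice_axioms frith_frameD(3)[OF L]]
    by (simp add: simps frame_hom_bottom[OF hom] frame_hom_top[OF hom])
  then show "lattice_iso (sublat M T) (sublat L S) h" using bij by (simp add: lattice_iso_def)
qed

section \<open>Coherent Frith frames\<close>

text \<open>Coherence says that the elements of \<open>S\<close> are compact in \<open>L\<close>. Covers by elements of \<open>S\<close> suffice because
\<open>S\<close> generates \<open>L\<close> by joins.\<close>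

definition coherent :: "'a gorder \<Rightarrow> 'a set \<Rightarrow> bool" where
  "coherent L S \<longleftrightarrow>
     (\<forall>s\<in>S. \<forall>A\<subseteq>S. s \<sqsubseteq>\<^bsub>L\<^esub> \<Squnion>\<^bsub>L\<^esub>A \<longrightarrow> (\<exists>F\<subseteq>A. finite F \<and> s \<sqsubseteq>\<^bsub>L\<^esub> \<Squnion>\<^bsub>L\<^esub>F))"

lemma coherentD:
  assumes "coherent L S" "s \<in> S" "A \<subseteq> S" "s \<sqsubseteq>\<^bsub>L\<^esub> \<Squnion>\<^bsub>L\<^esub>A"
  obtains F where "F \<subseteq> A" "finite F" "s \<sqsubseteq>\<^bsub>L\<^esub> \<Squnion>\<^bsub>L\<^esub>F"
  using assms unfolding coherent_def by blast

text \<open>Let \<open>h m = h n\<close> and let \<open>a \<in> T\<close> lie below \<open>m\<close>. Then \<open>h a\<close> is covered by the images of the elements of \<open>T\<close>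
below \<open>n\<close>, hence by finitely many of them, hence by the image of a single \<open>b \<in> T\<close> below \<open>n\<close>. On \<open>T\<close> the map
reflects the order, so \<open>a\<close> is below \<open>b\<close> and thus below \<open>n\<close>.\<close>

lemma coherent_imp_frith_iso:
  assumes L: "frith_frame L S" and coh: "coherent L S"
    and M: "frith_frame M T" and mor: "frith_mor M T L S h" and bij: "bij_betw h T S"
  shows "frith_iso M T L S h"
proof -
  interpret L: frame L by (rule frith_frameD[OF L])
  interpret M: frame M by (rule frith_frameD[OF M])
  have hom: "frame_hom M L h" using mor by (simp add: frith_mor_def)
  have T: "T \<subseteq> carrier M" using frith_frameD[OF M] by auto
  have hT: "h ` T = S" and injT: "inj_on h T" using bij by (auto simp: bij_betw_def)
  have reflT: "a \<sqsubseteq>\<^bsub>M\<^esub> b" if ab: "a \<in> T" "b \<in> T" "h a \<sqsubseteq>\<^bsub>L\<^esub> h b" for a b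
  proof -
    have car: "a \<in> carrier M" "b \<in> carrier M" using ab T by auto
    have "h (a \<sqinter>\<^bsub>M\<^esub> b) = h a"
      using car ab(3) frame_hom_meet[OF hom car] frame_hom_closed[OF hom] L.le_iff_join by metis
    then have "a \<sqinter>\<^bsub>M\<^esub> b = a" using inj_onD[OF injT] frith_frameD(8)[OF M] ab by blast
    then show ?thesis using M.meet_right[OF car] by simp
  qed
  have refl: "m \<sqsubseteq>\<^bsub>M\<^esub> n" if mn: "m \<in> carrier M" "n \<in> carrier M" "h m = h n" for m n
  proof -
    obtain A where A: "A \<subseteq> T" "m = \<Squnion>\<^bsub>M\<^esub>A" using frith_frame_basis[OF M mn(1)] by blast
    obtain B where B: "B \<subseteq> T" "n = \<Squnion>\<^bsub>M\<^esub>B" using frith_frame_basis[OF M mn(2)] by blast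
    have car: "A \<subseteq> carrier M" "B \<subseteq> carrier M" using A B T by auto
    have "a \<sqsubseteq>\<^bsub>M\<^esub> n" if a: "a \<in> A" for a
    proof -
      have "h a \<sqsubseteq>\<^bsub>L\<^esub> \<Squnion>\<^bsub>L\<^esub>(h ` A)"
        using a car frame_hom_closed[OF hom] by (intro L.sup_upper) auto
      then have "h a \<sqsubseteq>\<^bsub>L\<^esub> \<Squnion>\<^bsub>L\<^esub>(h ` B)"
        using mn(3) A B frame_hom_sup[OF hom car(1)] frame_hom_sup[OF hom car(2)] by simp
      moreover have "h a \<in> S" "h ` B \<subseteq> S" using a A B hT by auto
      ultimately obtain F where F: "F \<subseteq> h ` B" "finite F" "h a \<sqsubseteq>\<^bsub>L\<^esub> \<Squnion>\<^bsub>L\<^esub>F"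
        using coherentD[OF coh] by metis
      obtain B0 where B0: "B0 \<subseteq> B" "finite B0" "F = h ` B0" using finite_subset_image[OF F(2,1)] by auto
      have B0c: "B0 \<subseteq> carrier M" using B0 car by auto
      have "\<Squnion>\<^bsub>M\<^esub>B0 \<in> T"
        using finite_sup_in_sublattice[OF frith_frameD(1,2)[OF M] B0(2)] B0(1) B(1) by auto
      moreover have "h a \<sqsubseteq>\<^bsub>L\<^esub> h (\<Squnion>\<^bsub>M\<^esub>B0)" using F(3) B0(3) frame_hom_sup[OF hom B0c] by simp
      ultimately have "a \<sqsubseteq>\<^bsub>M\<^esub> \<Squnion>\<^bsub>M\<^esub>B0" using a A by (intro reflT) auto
      also have "\<Squnion>\<^bsub>M\<^esub>B0 \<sqsubseteq>\<^bsub>M\<^esub> n" using B0 B car M.sup_mono by simp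
      finally show ?thesis using a car B0c mn by auto
    qed
    then show ?thesis using A(2) car(1) mn(2) M.sup_least by blast
  qed
  have inj: "inj_on h (carrier M)" by (intro inj_onI M.le_antisym refl) auto
  have "y \<in> h ` carrier M" if y: "y \<in> carrier L" for y
  proof -
    obtain B where B: "B \<subseteq> S" "y = \<Squnion>\<^bsub>L\<^esub>B" using frith_frame_basis[OF L y] by blast
    then obtain A where A: "A \<subseteq> T" "B = h ` A" using hT by (metis subset_imageE)
    then have "A \<subseteq> carrier M" using T by auto
    then show ?thesis using frame_hom_sup[OF hom, of A] A B by (metis M.sup_closed image_eqI)
  qed
  then have "h ` carrier M = carrier L" using frame_hom_closed[OF hom] by blast
  then show ?thesis by (intro frith_isoI mor T inj hT)
qed

text \<open>If \<open>h c = h d\<close> and \<open>d'\<close> is a complement of \<open>d\<close>, then \<open>h\<close> maps \<open>c \<sqinter> d'\<close> to the bottom element. By density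
\<open>c\<close> is disjoint from \<open>d'\<close>, which puts it below \<open>d\<close>.\<close>

lemma dense_symmetric_inj:
  assumes M: "symmetric_frith_frame M C" and hom: "frame_hom M L h" and dense: "dense M L h"
  shows "inj_on h C"
proof -
  have fr: "frith_frame M C" using M by (simp add: symmetric_frith_frame_def)
  interpret M: frame M by (rule frith_frameD[OF fr])
  have C: "x \<in> C \<Longrightarrow> x \<in> carrier M" for x using frith_frameD[OF fr] by auto
  have "c \<sqsubseteq>\<^bsub>M\<^esub> d" if cd: "c \<in> C" "d \<in> C" "h c = h d" for c d
  proof -
    obtain d' where d': "d' \<in> C" "d \<sqinter>\<^bsub>M\<^esub> d' = \<bottom>\<^bsub>M\<^esub>" "d \<squnion>\<^bsub>M\<^esub> d' = \<top>\<^bsub>M\<^esub>"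
      using M cd unfolding symmetric_frith_frame_def by blast
    have "h (c \<sqinter>\<^bsub>M\<^esub> d') = h (d \<sqinter>\<^bsub>M\<^esub> d')" using cd d' C by (metis frame_hom_meet[OF hom])
    then have "c \<sqinter>\<^bsub>M\<^esub> d' = \<bottom>\<^bsub>M\<^esub>"
      using dense cd d' C frame_hom_bottom[OF hom] by (simp add: dense_def)
    then show ?thesis using M.cover_by_complement[of c d' d] cd d' C by (simp add: join_comm)
  qed
  then show ?thesis by (intro inj_onI M.le_antisym) (auto intro: C)
qed

section \<open>The ideal completion\<close>

definition lattice_ideal :: "'a gorder \<Rightarrow> 'a set \<Rightarrow> 'a set \<Rightarrow> bool" where
  "lattice_ideal L S I \<longleftrightarrow> I \<subseteq> S \<and> \<bottom>\<^bsub>L\<^esub> \<in> I \<and>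
     (\<forall>x\<in>I. \<forall>y\<in>I. x \<squnion>\<^bsub>L\<^esub> y \<in> I) \<and> (\<forall>x\<in>S. \<forall>y\<in>I. x \<sqsubseteq>\<^bsub>L\<^esub> y \<longrightarrow> x \<in> I)"

definition ideal_completion :: "'a gorder \<Rightarrow> 'a set \<Rightarrow> 'a set gorder" where
  "ideal_completion L S = inclusion_order {I. lattice_ideal L S I}"

text \<open>The generator \<open>u\<close> may lie outside \<open>S\<close>: the set is then the ideal of all elements of \<open>S\<close> below \<open>u\<close>, which
has join \<open>u\<close> but is principal only for \<open>u \<in> S\<close>.\<close>

definition principal_ideal :: "'a gorder \<Rightarrow> 'a set \<Rightarrow> 'a \<Rightarrow> 'a set" where
  "principal_ideal L S u = {x \<in> S. x \<sqsubseteq>\<^bsub>L\<^esub> u}"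

lemma lattice_idealI:
  assumes "I \<subseteq> S" "\<bottom>\<^bsub>L\<^esub> \<in> I" "\<And>x y. x \<in> I \<Longrightarrow> y \<in> I \<Longrightarrow> x \<squnion>\<^bsub>L\<^esub> y \<in> I"
    "\<And>x y. x \<in> S \<Longrightarrow> y \<in> I \<Longrightarrow> x \<sqsubseteq>\<^bsub>L\<^esub> y \<Longrightarrow> x \<in> I"
  shows "lattice_ideal L S I"
  using assms by (simp add: lattice_ideal_def)

lemma lattice_idealD:
  assumes "lattice_ideal L S I"
  shows "I \<subseteq> S" "\<bottom>\<^bsub>L\<^esub> \<in> I" "\<And>x y. x \<in> I \<Longrightarrow> y \<in> I \<Longrightarrow> x \<squnion>\<^bsub>L\<^esub> y \<in> I"
    "\<And>x y. x \<in> S \<Longrightarrow> y \<in> I \<Longrightarrow> x \<sqsubseteq>\<^bsub>L\<^esub> y \<Longrightarrow> x \<in> I"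
  using assms by (auto simp: lattice_ideal_def)

lemma carrier_ideal_completion: "carrier (ideal_completion L S) = {I. lattice_ideal L S I}"
  and le_ideal_completion: "le (ideal_completion L S) = (\<subseteq>)"
  by (simp_all add: ideal_completion_def)

context
  fixes L :: "'a gorder" and S :: "'a set"
  assumes LS: "frith_frame L S"
begin

interpretation L: frame L by (rule frith_frameD[OF LS])

private lemma S_in_L: "x \<in> S \<Longrightarrow> x \<in> carrier L"
  using frith_frameD[OF LS] by auto

private lemmas S_ops = frith_frameD(5-8)[OF LS]

private abbreviation "J \<equiv> ideal_completion L S"

private lemma ideal_S: "lattice_ideal L S I \<Longrightarrow> x \<in> I \<Longrightarrow> x \<in> S"
  using lattice_idealD(1) by blast

private lemma ideal_carrier: "lattice_ideal L S I \<Longrightarrow> I \<subseteq> carrier L"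
  using lattice_idealD(1) S_in_L by blast

lemma principal_ideal_lattice_ideal:
  assumes "u \<in> carrier L"
  shows "lattice_ideal L S (principal_ideal L S u)"
  using assms S_in_L S_ops unfolding principal_ideal_def
  by (intro lattice_idealI) (auto intro: L.join_le L.le_trans)

lemma
  shows ideal_completion_frame: "frame J"
    and ideal_completion_meet:
      "lattice_ideal L S I \<Longrightarrow> lattice_ideal L S K \<Longrightarrow> I \<sqinter>\<^bsub>J\<^esub> K = I \<inter> K"
    and ideal_completion_top: "\<top>\<^bsub>J\<^esub> = S"
proof -
  let ?F = "{I. lattice_ideal L S I}"
  have top: "S \<in> ?F" using S_ops by (auto intro!: lattice_idealI)
  have sub: "I \<subseteq> S" if "I \<in> ?F" for I using that lattice_idealD(1) by blast
  have int: "\<Inter>Q \<in> ?F" if Q: "Q \<subseteq> ?F" "Q \<noteq> {}" for Q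
  proof -
    have "lattice_ideal L S (\<Inter>Q)"
    proof (rule lattice_idealI)
      show "\<Inter>Q \<subseteq> S" using Q sub by blast
      have Qi: "lattice_ideal L S K" if "K \<in> Q" for K using Q that by auto
      show "\<bottom>\<^bsub>L\<^esub> \<in> \<Inter>Q" using lattice_idealD(2)[OF Qi] by simp
      show "x \<squnion>\<^bsub>L\<^esub> y \<in> \<Inter>Q" if "x \<in> \<Inter>Q" "y \<in> \<Inter>Q" for x y
        using that lattice_idealD(3)[OF Qi] by simp
      show "x \<in> \<Inter>Q" if "x \<in> S" "y \<in> \<Inter>Q" "x \<sqsubseteq>\<^bsub>L\<^esub> y" for x y
      proof
        fix K assume K: "K \<in> Q"
        show "x \<in> K" using lattice_idealD(4)[OF Qi[OF K] that(1) _ that(3)] that(2) K by blast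
      qed
    qed
    then show ?thesis by simp
  qed
  have imp: "\<exists>H\<in>?F. \<forall>A\<in>?F. A \<inter> B \<subseteq> C \<longleftrightarrow> A \<subseteq> H" if BC: "B \<in> ?F" "C \<in> ?F" for B C
  proof -
    \<comment> \<open>The Heyting implication of ideals; it is closed under joins because \<open>S\<close> is distributive.\<close>
    define H where "H = {s \<in> S. \<forall>b\<in>B. s \<sqinter>\<^bsub>L\<^esub> b \<in> C}"
    have B: "lattice_ideal L S B" and C: "lattice_ideal L S C" using BC by auto
    have BS: "b \<in> B \<Longrightarrow> b \<in> S" for b using ideal_S[OF B] .
    have "lattice_ideal L S H"
    proof (rule lattice_idealI)
      show "H \<subseteq> S" by (auto simp: H_def)
      show "\<bottom>\<^bsub>L\<^esub> \<in> H"
        using S_ops(1) lattice_idealD(2)[OF C] S_in_L[OF BS] by (simp add: H_def L.bottom_meet_eq)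
      show "x \<squnion>\<^bsub>L\<^esub> y \<in> H" if "x \<in> H" "y \<in> H" for x y
      proof -
        have "(x \<squnion>\<^bsub>L\<^esub> y) \<sqinter>\<^bsub>L\<^esub> b \<in> C" if b: "b \<in> B" for b
        proof -
          have "(x \<squnion>\<^bsub>L\<^esub> y) \<sqinter>\<^bsub>L\<^esub> b = (x \<sqinter>\<^bsub>L\<^esub> b) \<squnion>\<^bsub>L\<^esub> (y \<sqinter>\<^bsub>L\<^esub> b)"
            using \<open>x \<in> H\<close> \<open>y \<in> H\<close> S_in_L BS[OF b] L.meet_join_distrib[of b x y]
            by (simp add: H_def meet_comm)
          then show ?thesis using \<open>x \<in> H\<close> \<open>y \<in> H\<close> b lattice_idealD(3)[OF C] by (simp add: H_def)
        qed
        then show ?thesis using that S_ops by (simp add: H_def)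
      qed
      show "x \<in> H" if x: "x \<in> S" and y: "y \<in> H" and le: "x \<sqsubseteq>\<^bsub>L\<^esub> y" for x y
      proof -
        have "x \<sqinter>\<^bsub>L\<^esub> b \<in> C" if b: "b \<in> B" for b
        proof (rule lattice_idealD(4)[OF C])
          show "x \<sqinter>\<^bsub>L\<^esub> b \<in> S" using x BS[OF b] S_ops by simp
          show "y \<sqinter>\<^bsub>L\<^esub> b \<in> C" using y b by (simp add: H_def)
          show "x \<sqinter>\<^bsub>L\<^esub> b \<sqsubseteq>\<^bsub>L\<^esub> y \<sqinter>\<^bsub>L\<^esub> b"
            using x y le S_in_L BS[OF b] by (intro L.meet_mono) (auto simp: H_def)
        qed
        then show ?thesis using x by (simp add: H_def)
      qed
    qed
    moreover have "A \<inter> B \<subseteq> C \<longleftrightarrow> A \<subseteq> H" if A: "lattice_ideal L S A" for A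
    proof
      assume AB: "A \<inter> B \<subseteq> C"
      have "s \<sqinter>\<^bsub>L\<^esub> b \<in> C" if sb: "s \<in> A" "b \<in> B" for s b
      proof -
        have c: "s \<in> carrier L" "b \<in> carrier L" "s \<sqinter>\<^bsub>L\<^esub> b \<in> S"
          using sb S_in_L BS ideal_S[OF A] S_ops by auto
        then have "s \<sqinter>\<^bsub>L\<^esub> b \<in> A" "s \<sqinter>\<^bsub>L\<^esub> b \<in> B"
          using lattice_idealD(4)[OF A c(3) sb(1) L.meet_left] lattice_idealD(4)[OF B c(3) sb(2) L.meet_right]
          by simp_all
        then show ?thesis using AB by blast
      qed
      then show "A \<subseteq> H" using ideal_S[OF A] by (auto simp: H_def)
    next
      assume AH: "A \<subseteq> H"
      show "A \<inter> B \<subseteq> C"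
      proof
        fix x assume x: "x \<in> A \<inter> B"
        then have "x \<sqinter>\<^bsub>L\<^esub> x \<in> C" using AH by (auto simp: H_def)
        moreover have "x \<sqinter>\<^bsub>L\<^esub> x = x" using x S_in_L BS L.le_iff_join[of x x] by auto
        ultimately show "x \<in> C" by simp
      qed
    qed
    ultimately show ?thesis by blast
  qed
  note * = inclusion_order_frame inclusion_order_meet inclusion_order_top
  show "frame J" "lattice_ideal L S I \<Longrightarrow> lattice_ideal L S K \<Longrightarrow> I \<sqinter>\<^bsub>J\<^esub> K = I \<inter> K" "\<top>\<^bsub>J\<^esub> = S"
    unfolding ideal_completion_def
    using *[where F = ?F and X = S, OF top sub int imp] by auto
qed

interpretation J: frame J by (rule ideal_completion_frame)

lemma ideal_completion_bottom: "\<bottom>\<^bsub>J\<^esub> = {\<bottom>\<^bsub>L\<^esub>}"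
proof -
  have "lattice_ideal L S {\<bottom>\<^bsub>L\<^esub>}"
  proof (rule lattice_idealI)
    show "x \<in> {\<bottom>\<^bsub>L\<^esub>}" if "x \<in> S" "y \<in> {\<bottom>\<^bsub>L\<^esub>}" "x \<sqsubseteq>\<^bsub>L\<^esub> y" for x y
      using that S_in_L L.bottom_lower L.le_antisym by auto
  qed (use S_ops L.bottom_join_eq in auto)
  then have "\<bottom>\<^bsub>J\<^esub> \<subseteq> {\<bottom>\<^bsub>L\<^esub>}" "lattice_ideal L S \<bottom>\<^bsub>J\<^esub>"
    using J.bottom_lower[of "{\<bottom>\<^bsub>L\<^esub>}"] J.bottom_closed by (auto simp: carrier_ideal_completion le_ideal_completion)
  then show ?thesis using lattice_idealD(2) by blast
qed

text \<open>For joins, the elements of \<open>S\<close> below the join \<open>u\<close> of the values \<open>\<Squnion>I\<close> form an ideal that contains every \<open>I\<close>,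
hence the join of these ideals. For binary meets, two applications of the frame law reduce
\<open>\<Squnion>I \<sqinter> \<Squnion>K\<close> to the elements \<open>i \<sqinter> k\<close>, which belong to \<open>I \<inter> K\<close>.\<close>

lemma ideal_sup_frame_hom: "frame_hom J L (Lattice.sup L)"
proof -
  have mono: "\<Squnion>\<^bsub>L\<^esub>I \<sqsubseteq>\<^bsub>L\<^esub> \<Squnion>\<^bsub>L\<^esub>K" if "I \<subseteq> K" "lattice_ideal L S K" for I K
    by (rule L.sup_mono[OF that(1) ideal_carrier[OF that(2)]])
  have closed: "\<Squnion>\<^bsub>L\<^esub>I \<in> carrier L" if "lattice_ideal L S I" for I
    by (rule L.sup_closed[OF ideal_carrier[OF that]])
  have top: "\<Squnion>\<^bsub>L\<^esub>\<top>\<^bsub>J\<^esub> = \<top>\<^bsub>L\<^esub>"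
  proof -
    have "\<top>\<^bsub>L\<^esub> \<sqsubseteq>\<^bsub>L\<^esub> \<Squnion>\<^bsub>L\<^esub>S" using S_in_L S_ops by (intro L.sup_upper) auto
    then show ?thesis unfolding ideal_completion_top
      using S_in_L L.le_antisym L.top_higher L.sup_closed by (meson L.top_closed subsetI)
  qed
  have sup: "\<Squnion>\<^bsub>L\<^esub>(\<Squnion>\<^bsub>J\<^esub>Q) = \<Squnion>\<^bsub>L\<^esub>(Lattice.sup L ` Q)" if Q: "Q \<subseteq> carrier J" for Q
  proof (rule L.le_antisym)
    have Qi: "\<And>I. I \<in> Q \<Longrightarrow> lattice_ideal L S I" using Q by (auto simp: carrier_ideal_completion)
    have img: "Lattice.sup L ` Q \<subseteq> carrier L" using Qi closed by auto
    have sup_ideal: "lattice_ideal L S (\<Squnion>\<^bsub>J\<^esub>Q)" using J.sup_closed[OF Q] by (simp add: carrier_ideal_completion)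
    let ?u = "\<Squnion>\<^bsub>L\<^esub>(Lattice.sup L ` Q)"
    have u: "?u \<in> carrier L" using img by simp
    have "I \<subseteq> principal_ideal L S ?u" if I: "I \<in> Q" for I
    proof
      fix x assume x: "x \<in> I"
      have "x \<sqsubseteq>\<^bsub>L\<^esub> \<Squnion>\<^bsub>L\<^esub>I" using x ideal_carrier[OF Qi[OF I]] by (intro L.sup_upper)
      moreover have "\<Squnion>\<^bsub>L\<^esub>I \<sqsubseteq>\<^bsub>L\<^esub> ?u" using I img by (intro L.sup_upper) auto
      moreover have "x \<in> S" using x Qi[OF I] ideal_S by blast
      ultimately show "x \<in> principal_ideal L S ?u"
        using S_in_L[of x] closed[OF Qi[OF I]] u L.le_trans unfolding principal_ideal_def by blast
    qed
    then have "\<Squnion>\<^bsub>J\<^esub>Q \<subseteq> principal_ideal L S ?u"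
      using J.sup_least[OF Q, of "principal_ideal L S ?u"] principal_ideal_lattice_ideal[OF u]
      by (simp add: carrier_ideal_completion le_ideal_completion)
    then show "\<Squnion>\<^bsub>L\<^esub>(\<Squnion>\<^bsub>J\<^esub>Q) \<sqsubseteq>\<^bsub>L\<^esub> ?u"
      using u ideal_carrier[OF sup_ideal] by (intro L.sup_least) (auto simp: principal_ideal_def)
    have "\<Squnion>\<^bsub>L\<^esub>I \<sqsubseteq>\<^bsub>L\<^esub> \<Squnion>\<^bsub>L\<^esub>(\<Squnion>\<^bsub>J\<^esub>Q)" if I: "I \<in> Q" for I
      using J.sup_upper[OF Q I] mono[OF _ sup_ideal] by (simp add: le_ideal_completion)
    then show "?u \<sqsubseteq>\<^bsub>L\<^esub> \<Squnion>\<^bsub>L\<^esub>(\<Squnion>\<^bsub>J\<^esub>Q)" using img closed[OF sup_ideal] by (intro L.sup_least) auto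
    show "?u \<in> carrier L" by fact
    show "\<Squnion>\<^bsub>L\<^esub>(\<Squnion>\<^bsub>J\<^esub>Q) \<in> carrier L" using closed[OF sup_ideal] .
  qed
  have meet: "\<Squnion>\<^bsub>L\<^esub>(I \<sqinter>\<^bsub>J\<^esub> K) = \<Squnion>\<^bsub>L\<^esub>I \<sqinter>\<^bsub>L\<^esub> \<Squnion>\<^bsub>L\<^esub>K"
    if I: "lattice_ideal L S I" and K: "lattice_ideal L S K" for I K
  proof (rule L.le_antisym)
    have IK: "lattice_ideal L S (I \<inter> K)"
      using J.meet_closed[of I K] ideal_completion_meet[OF I K] I K by (simp add: carrier_ideal_completion)
    note c = closed[OF I] closed[OF K] closed[OF IK]
    show "\<Squnion>\<^bsub>L\<^esub>(I \<sqinter>\<^bsub>J\<^esub> K) \<sqsubseteq>\<^bsub>L\<^esub> \<Squnion>\<^bsub>L\<^esub>I \<sqinter>\<^bsub>L\<^esub> \<Squnion>\<^bsub>L\<^esub>K"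
      unfolding ideal_completion_meet[OF I K] using c by (intro L.meet_le mono I K) auto
    have "\<Squnion>\<^bsub>L\<^esub>I \<sqinter>\<^bsub>L\<^esub> k \<sqsubseteq>\<^bsub>L\<^esub> \<Squnion>\<^bsub>L\<^esub>(I \<inter> K)" if k: "k \<in> K" for k
    proof -
      have kc: "k \<in> carrier L" using k ideal_carrier[OF K] by blast
      have "k \<sqinter>\<^bsub>L\<^esub> i \<sqsubseteq>\<^bsub>L\<^esub> \<Squnion>\<^bsub>L\<^esub>(I \<inter> K)" if i: "i \<in> I" for i
      proof (rule L.sup_upper)
        have ic: "i \<in> carrier L" using i ideal_carrier[OF I] by blast
        have "k \<sqinter>\<^bsub>L\<^esub> i \<in> S" using ideal_S[OF I i] ideal_S[OF K k] S_ops by simp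
        then show "k \<sqinter>\<^bsub>L\<^esub> i \<in> I \<inter> K"
          using lattice_idealD(4)[OF I _ i] lattice_idealD(4)[OF K _ k]
            L.meet_left[OF kc ic] L.meet_right[OF kc ic] by simp
        show "I \<inter> K \<subseteq> carrier L" by (rule ideal_carrier[OF IK])
      qed
      then have "k \<sqinter>\<^bsub>L\<^esub> \<Squnion>\<^bsub>L\<^esub>I \<sqsubseteq>\<^bsub>L\<^esub> \<Squnion>\<^bsub>L\<^esub>(I \<inter> K)"
        unfolding L.meet_sup_distrib[OF kc ideal_carrier[OF I]]
        using kc c ideal_carrier[OF I] by (intro L.sup_least) auto
      then show ?thesis by (simp add: meet_comm)
    qed
    then show "\<Squnion>\<^bsub>L\<^esub>I \<sqinter>\<^bsub>L\<^esub> \<Squnion>\<^bsub>L\<^esub>K \<sqsubseteq>\<^bsub>L\<^esub> \<Squnion>\<^bsub>L\<^esub>(I \<sqinter>\<^bsub>J\<^esub> K)"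
      unfolding ideal_completion_meet[OF I K] L.meet_sup_distrib[OF c(1) ideal_carrier[OF K]]
      using c ideal_carrier[OF K] by (intro L.sup_least) auto
    show "\<Squnion>\<^bsub>L\<^esub>(I \<sqinter>\<^bsub>J\<^esub> K) \<in> carrier L" "\<Squnion>\<^bsub>L\<^esub>I \<sqinter>\<^bsub>L\<^esub> \<Squnion>\<^bsub>L\<^esub>K \<in> carrier L"
      unfolding ideal_completion_meet[OF I K] using c by auto
  qed
  show ?thesis
    using sup meet top closed L.complete_lattice_axioms J.complete_lattice_axioms
      L.lattice_axioms J.lattice_axioms
    by (simp add: frame_hom_def sup_pres_def meet_pres_def Pi_iff carrier_ideal_completion)
qed

lemma sup_principal_ideal:
  assumes "u \<in> carrier L"
  shows "\<Squnion>\<^bsub>L\<^esub>(principal_ideal L S u) = u"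
proof (rule L.le_antisym)
  have sub: "principal_ideal L S u \<subseteq> carrier L" using S_in_L by (auto simp: principal_ideal_def)
  show "\<Squnion>\<^bsub>L\<^esub>(principal_ideal L S u) \<sqsubseteq>\<^bsub>L\<^esub> u"
    using assms sub by (intro L.sup_least) (auto simp: principal_ideal_def)
  obtain A where A: "A \<subseteq> S" "u = \<Squnion>\<^bsub>L\<^esub>A" using frith_frame_basis[OF LS assms] by blast
  then have "A \<subseteq> principal_ideal L S u" using S_in_L by (auto simp: principal_ideal_def intro!: L.sup_upper)
  then show "u \<sqsubseteq>\<^bsub>L\<^esub> \<Squnion>\<^bsub>L\<^esub>(principal_ideal L S u)" using A L.sup_mono sub by blast
qed (use assms S_in_L in \<open>auto simp: principal_ideal_def intro!: L.sup_closed\<close>)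

private abbreviation "D \<equiv> principal_ideal L S"

lemma principal_ideal_subset_iff:
  assumes "s \<in> S" "lattice_ideal L S I"
  shows "D s \<subseteq> I \<longleftrightarrow> s \<in> I"
  using assms lattice_idealD(4)[OF assms(2)] S_in_L[of s] by (auto simp: principal_ideal_def)

private lemma D_ideal: "s \<in> S \<Longrightarrow> lattice_ideal L S (D s)"
  using principal_ideal_lattice_ideal S_in_L by blast

lemma principal_ideal_meet:
  assumes "s \<in> S" "t \<in> S"
  shows "D s \<sqinter>\<^bsub>J\<^esub> D t = D (s \<sqinter>\<^bsub>L\<^esub> t)"
  unfolding ideal_completion_meet[OF D_ideal D_ideal, OF assms]
  using assms S_in_L by (auto simp: principal_ideal_def intro: L.meet_le L.le_trans[OF _ L.meet_left] L.le_trans[OF _ L.meet_right])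

lemma principal_ideal_join:
  assumes "s \<in> S" "t \<in> S"
  shows "D s \<squnion>\<^bsub>J\<^esub> D t = D (s \<squnion>\<^bsub>L\<^esub> t)"
proof -
  have c: "D s \<in> carrier J" "D t \<in> carrier J" "D (s \<squnion>\<^bsub>L\<^esub> t) \<in> carrier J"
    using assms D_ideal S_ops by (auto simp: carrier_ideal_completion)
  have K: "lattice_ideal L S (D s \<squnion>\<^bsub>J\<^esub> D t)" using J.join_closed[OF c(1,2)] by (simp add: carrier_ideal_completion)
  have "s \<in> D s \<squnion>\<^bsub>J\<^esub> D t" "t \<in> D s \<squnion>\<^bsub>J\<^esub> D t"
    using J.join_left[OF c(1,2)] J.join_right[OF c(1,2)] principal_ideal_subset_iff[OF _ K] assms
    by (auto simp: le_ideal_completion)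
  then have "D (s \<squnion>\<^bsub>L\<^esub> t) \<subseteq> D s \<squnion>\<^bsub>J\<^esub> D t"
    using principal_ideal_subset_iff[OF S_ops(3)[OF assms] K] lattice_idealD(3)[OF K] by simp
  moreover have "D s \<squnion>\<^bsub>J\<^esub> D t \<subseteq> D (s \<squnion>\<^bsub>L\<^esub> t)"
  proof -
    have "D s \<subseteq> D (s \<squnion>\<^bsub>L\<^esub> t)" "D t \<subseteq> D (s \<squnion>\<^bsub>L\<^esub> t)"
      using assms S_in_L by (auto simp: principal_ideal_def intro: L.le_trans[OF _ L.join_left] L.le_trans[OF _ L.join_right])
    then show ?thesis using J.join_le[of "D s" "D (s \<squnion>\<^bsub>L\<^esub> t)" "D t"] c by (simp add: le_ideal_completion)
  qed
  ultimately show ?thesis by blast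
qed

lemma principal_ideal_bottom: "D \<bottom>\<^bsub>L\<^esub> = \<bottom>\<^bsub>J\<^esub>"
  unfolding ideal_completion_bottom
  using S_in_L S_ops L.le_antisym L.bottom_lower by (auto simp: principal_ideal_def)

lemma principal_ideal_top: "D \<top>\<^bsub>L\<^esub> = \<top>\<^bsub>J\<^esub>"
  unfolding ideal_completion_top using S_in_L L.top_higher by (auto simp: principal_ideal_def)

lemma ideal_completion_frith: "frith_frame J (D ` S)"
proof -
  have "bounded_sublattice (D ` S) J"
    unfolding bounded_sublattice_def sublattice_def principal_ideal_bottom[symmetric] principal_ideal_top[symmetric]
    using D_ideal S_ops by (auto simp: carrier_ideal_completion principal_ideal_join principal_ideal_meet)
  moreover have "\<exists>A\<subseteq>D ` S. I = \<Squnion>\<^bsub>J\<^esub>A" if I: "I \<in> carrier J" for I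
  proof (intro exI conjI)
    have I': "lattice_ideal L S I" using I by (simp add: carrier_ideal_completion)
    then have IS: "I \<subseteq> S" by (rule lattice_idealD)
    then show "D ` I \<subseteq> D ` S" by blast
    have sub: "D ` I \<subseteq> carrier J" using IS D_ideal by (auto simp: carrier_ideal_completion)
    then have K: "lattice_ideal L S (\<Squnion>\<^bsub>J\<^esub>(D ` I))" using J.sup_closed by (simp add: carrier_ideal_completion)
    have "\<Squnion>\<^bsub>J\<^esub>(D ` I) \<subseteq> I"
      using J.sup_least[OF sub I] principal_ideal_subset_iff[OF _ I'] IS by (auto simp: le_ideal_completion)
    moreover have "s \<in> \<Squnion>\<^bsub>J\<^esub>(D ` I)" if "s \<in> I" for s
      using J.sup_upper[OF sub, of "D s"] principal_ideal_subset_iff[OF _ K, of s] IS that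
      by (auto simp: le_ideal_completion)
    ultimately show "I = \<Squnion>\<^bsub>J\<^esub>(D ` I)" by blast
  qed
  ultimately show ?thesis by (simp add: frith_frame_def ideal_completion_frame)
qed

lemma ideal_completion_symmetric:
  assumes "symmetric_frith_frame L S"
  shows "symmetric_frith_frame J (D ` S)"
proof -
  have "\<exists>t\<in>D ` S. d \<sqinter>\<^bsub>J\<^esub> t = \<bottom>\<^bsub>J\<^esub> \<and> d \<squnion>\<^bsub>J\<^esub> t = \<top>\<^bsub>J\<^esub>" if d: "d \<in> D ` S" for d
  proof -
    obtain s where s: "s \<in> S" "d = D s" using d by blast
    obtain t where t: "t \<in> S" "s \<sqinter>\<^bsub>L\<^esub> t = \<bottom>\<^bsub>L\<^esub>" "s \<squnion>\<^bsub>L\<^esub> t = \<top>\<^bsub>L\<^esub>"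
      using assms s unfolding symmetric_frith_frame_def by blast
    then have "d \<sqinter>\<^bsub>J\<^esub> D t = \<bottom>\<^bsub>J\<^esub> \<and> d \<squnion>\<^bsub>J\<^esub> D t = \<top>\<^bsub>J\<^esub>"
      using s by (simp add: principal_ideal_meet principal_ideal_join principal_ideal_bottom principal_ideal_top)
    then show ?thesis using t(1) by blast
  qed
  then show ?thesis by (simp add: symmetric_frith_frame_def ideal_completion_frith)
qed

lemma ideal_sup_image: "Lattice.sup L ` D ` S = S"
  unfolding image_image using S_in_L by (simp add: sup_principal_ideal cong: image_cong)

lemma ideal_sup_mor: "frith_mor J (D ` S) L S (Lattice.sup L)"
  by (simp add: frith_mor_def ideal_sup_frame_hom ideal_sup_image)

lemma ideal_sup_bij: "bij_betw (Lattice.sup L) (D ` S) S"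
  unfolding bij_betw_def ideal_sup_image using S_in_L by (auto simp: inj_on_def sup_principal_ideal)

lemma ideal_sup_dense: "dense J L (Lattice.sup L)"
  unfolding dense_def
proof (intro ballI impI)
  fix I assume I: "I \<in> carrier J" and bot: "\<Squnion>\<^bsub>L\<^esub>I = \<bottom>\<^bsub>L\<^esub>"
  have I': "lattice_ideal L S I" using I by (simp add: carrier_ideal_completion)
  have "x = \<bottom>\<^bsub>L\<^esub>" if "x \<in> I" for x
    using L.sup_upper[OF ideal_carrier[OF I'] that] ideal_carrier[OF I'] that bot L.le_antisym L.bottom_lower
    by auto
  then show "I = \<bottom>\<^bsub>J\<^esub>" unfolding ideal_completion_bottom using lattice_idealD(2)[OF I'] by blast
qed

text \<open>The elements of \<open>S\<close> covered by finite subsets of \<open>A\<close> form an ideal with the same join as the ideal of all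
elements of \<open>S\<close> below \<open>\<Squnion>A\<close>. If the join map is injective, the two ideals agree, and this is compactness.\<close>

lemma ideal_sup_inj_imp_coherent:
  assumes inj: "inj_on (Lattice.sup L) (carrier J)"
  shows "coherent L S"
  unfolding coherent_def
proof (intro ballI allI impI)
  fix s A assume s: "s \<in> S" and A: "A \<subseteq> S" and le: "s \<sqsubseteq>\<^bsub>L\<^esub> \<Squnion>\<^bsub>L\<^esub>A"
  have Ac: "A \<subseteq> carrier L" using A S_in_L by blast
  define I where "I = {x \<in> S. \<exists>F\<subseteq>A. finite F \<and> x \<sqsubseteq>\<^bsub>L\<^esub> \<Squnion>\<^bsub>L\<^esub>F}"
  have I: "lattice_ideal L S I"
  proof (rule lattice_idealI)
    show "I \<subseteq> S" by (auto simp: I_def)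
    show "\<bottom>\<^bsub>L\<^esub> \<in> I" using S_ops by (auto simp: I_def intro!: exI[of _ "{}"])
    show "x \<squnion>\<^bsub>L\<^esub> y \<in> I" if xI: "x \<in> I" and yI: "y \<in> I" for x y
    proof -
      obtain F G where F: "F \<subseteq> A" "finite F" "x \<sqsubseteq>\<^bsub>L\<^esub> \<Squnion>\<^bsub>L\<^esub>F" and G: "G \<subseteq> A" "finite G" "y \<sqsubseteq>\<^bsub>L\<^esub> \<Squnion>\<^bsub>L\<^esub>G"
        using xI yI unfolding I_def by blast
      have xy: "x \<in> S" "y \<in> S" using xI yI by (auto simp: I_def)
      have c: "F \<union> G \<subseteq> carrier L" "F \<subseteq> carrier L" "G \<subseteq> carrier L" using F G Ac by auto
      have "x \<sqsubseteq>\<^bsub>L\<^esub> \<Squnion>\<^bsub>L\<^esub>(F \<union> G)" "y \<sqsubseteq>\<^bsub>L\<^esub> \<Squnion>\<^bsub>L\<^esub>(F \<union> G)"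
        using F(3) G(3) L.sup_mono[of F "F \<union> G"] L.sup_mono[of G "F \<union> G"] c xy S_in_L
        by (meson L.le_trans L.sup_closed Un_upper1 Un_upper2)+
      then have "x \<squnion>\<^bsub>L\<^esub> y \<sqsubseteq>\<^bsub>L\<^esub> \<Squnion>\<^bsub>L\<^esub>(F \<union> G)" using xy S_in_L c by (intro L.join_le) auto
      moreover have "finite (F \<union> G)" "F \<union> G \<subseteq> A" using F G by auto
      ultimately show ?thesis using xy S_ops unfolding I_def by blast
    qed
    show "x \<in> I" if x: "x \<in> S" and y: "y \<in> I" and le: "x \<sqsubseteq>\<^bsub>L\<^esub> y" for x y
    proof -
      obtain F where F: "F \<subseteq> A" "finite F" "y \<sqsubseteq>\<^bsub>L\<^esub> \<Squnion>\<^bsub>L\<^esub>F" "y \<in> S" using y by (auto simp: I_def)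
      then have "F \<subseteq> carrier L" using Ac by blast
      then have "x \<sqsubseteq>\<^bsub>L\<^esub> \<Squnion>\<^bsub>L\<^esub>F" using F le x S_in_L by (meson L.le_trans L.sup_closed)
      then show ?thesis using F x by (auto simp: I_def)
    qed
  qed
  have u: "\<Squnion>\<^bsub>L\<^esub>A \<in> carrier L" using Ac by simp
  have "\<Squnion>\<^bsub>L\<^esub>I = \<Squnion>\<^bsub>L\<^esub>A"
  proof (rule L.le_antisym)
    have "x \<sqsubseteq>\<^bsub>L\<^esub> \<Squnion>\<^bsub>L\<^esub>A" if x: "x \<in> I" for x
    proof -
      obtain F where F: "F \<subseteq> A" "x \<sqsubseteq>\<^bsub>L\<^esub> \<Squnion>\<^bsub>L\<^esub>F" "x \<in> S" using x by (auto simp: I_def)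
      then show ?thesis using L.sup_mono[of F A] Ac S_in_L u by (meson L.le_trans L.sup_closed subset_trans)
    qed
    then show "\<Squnion>\<^bsub>L\<^esub>I \<sqsubseteq>\<^bsub>L\<^esub> \<Squnion>\<^bsub>L\<^esub>A" using u ideal_carrier[OF I] by (intro L.sup_least)
    have "a \<in> I" if a: "a \<in> A" for a
    proof -
      have "a \<sqsubseteq>\<^bsub>L\<^esub> \<Squnion>\<^bsub>L\<^esub>{a}" using a Ac by auto
      then show ?thesis using a A by (auto simp: I_def intro!: exI[of _ "{a}"])
    qed
    then show "\<Squnion>\<^bsub>L\<^esub>A \<sqsubseteq>\<^bsub>L\<^esub> \<Squnion>\<^bsub>L\<^esub>I" using ideal_carrier[OF I] by (intro L.sup_mono) auto
  qed (use u ideal_carrier[OF I] in auto)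
  also have "\<dots> = \<Squnion>\<^bsub>L\<^esub>(D (\<Squnion>\<^bsub>L\<^esub>A))" using sup_principal_ideal[OF u] by simp
  finally have "I = D (\<Squnion>\<^bsub>L\<^esub>A)"
    using inj I principal_ideal_lattice_ideal[OF u] by (auto simp: inj_on_def carrier_ideal_completion)
  moreover have "s \<in> D (\<Squnion>\<^bsub>L\<^esub>A)" using s le by (simp add: principal_ideal_def)
  ultimately show "\<exists>F\<subseteq>A. finite F \<and> s \<sqsubseteq>\<^bsub>L\<^esub> \<Squnion>\<^bsub>L\<^esub>F" by (auto simp: I_def)
qed

text \<open>If \<open>S\<close> is Boolean, the join map from the ideals of \<open>S\<close> is itself a dense extremal epimorphism with symmetric
domain, so completeness makes it injective. Conversely, every dense extremal epimorphism from a
symmetric Frith frame is bijective on the distinguished sublattices.\<close>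

lemma symmetric_complete_iff_coherent:
  assumes sym: "symmetric_frith_frame L S"
  shows "symmetric_complete L S \<longleftrightarrow> coherent L S"
proof
  assume complete: "symmetric_complete L S"
  have "frith_extremal_epi J (D ` S) L S (Lattice.sup L)"
    by (simp add: frith_extremal_epi_def ideal_sup_mor ideal_sup_image)
  then have "frith_iso J (D ` S) L S (Lattice.sup L)"
    using complete ideal_completion_symmetric[OF sym] ideal_sup_dense
    unfolding symmetric_complete_def by blast
  then show "coherent L S" by (intro ideal_sup_inj_imp_coherent frith_iso_inj)
next
  assume coh: "coherent L S"
  show "symmetric_complete L S" unfolding symmetric_complete_def
  proof (intro allI impI)
    fix M :: "'a set gorder" and C h
    assume M: "symmetric_frith_frame M C" and h: "frith_extremal_epi M C L S h" and dense: "dense M L h"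
    have mor: "frith_mor M C L S h" and hC: "h ` C = S" using h by (auto simp: frith_extremal_epi_def)
    have "inj_on h C" using dense_symmetric_inj[OF M _ dense] mor by (simp add: frith_mor_def)
    then have "bij_betw h C S" using hC by (simp add: bij_betw_def)
    moreover have "frith_frame M C" using M by (simp add: symmetric_frith_frame_def)
    ultimately show "frith_iso M C L S h" using coherent_imp_frith_iso[OF LS coh _ mor] by blast
  qed
qed

end

section \<open>The frame of congruences\<close>

definition lattice_congruence :: "'a gorder \<Rightarrow> ('a \<times> 'a) set \<Rightarrow> bool" where
  "lattice_congruence L R \<longleftrightarrow> equiv (carrier L) R \<and>
     (\<forall>(x, y)\<in>R. \<forall>(x', y')\<in>R. (x \<sqinter>\<^bsub>L\<^esub> x', y \<sqinter>\<^bsub>L\<^esub> y') \<in> R \<and> (x \<squnion>\<^bsub>L\<^esub> x', y \<squnion>\<^bsub>L\<^esub> y') \<in> R)"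

lemma lattice_congruenceD:
  assumes "lattice_congruence L R"
  shows "R \<subseteq> carrier L \<times> carrier L" "x \<in> carrier L \<Longrightarrow> (x, x) \<in> R" "(x, y) \<in> R \<Longrightarrow> (y, x) \<in> R"
    and "(x, y) \<in> R \<Longrightarrow> (y, z) \<in> R \<Longrightarrow> (x, z) \<in> R"
    and "(x, y) \<in> R \<Longrightarrow> (x', y') \<in> R \<Longrightarrow> (x \<sqinter>\<^bsub>L\<^esub> x', y \<sqinter>\<^bsub>L\<^esub> y') \<in> R"
    and "(x, y) \<in> R \<Longrightarrow> (x', y') \<in> R \<Longrightarrow> (x \<squnion>\<^bsub>L\<^esub> x', y \<squnion>\<^bsub>L\<^esub> y') \<in> R"
    and "(x, y) \<in> R \<Longrightarrow> x \<in> carrier L" "(x, y) \<in> R \<Longrightarrow> y \<in> carrier L"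
  using assms unfolding lattice_congruence_def
  by (auto elim!: equivE dest: refl_onD symD transD)

lemma congruence_imp_lattice_congruence:
  assumes "congruence L R"
  shows "lattice_congruence L R"
proof -
  have "(x \<squnion>\<^bsub>L\<^esub> x', y \<squnion>\<^bsub>L\<^esub> y') \<in> R" if "(x, y) \<in> R" "(x', y') \<in> R" for x y x' y'
  proof -
    have "{(x, y), (x', y')} \<subseteq> R" using that by simp
    then have "(\<Squnion>\<^bsub>L\<^esub>(fst ` {(x, y), (x', y')}), \<Squnion>\<^bsub>L\<^esub>(snd ` {(x, y), (x', y')})) \<in> R"
      using assms unfolding congruence_def by blast
    then show ?thesis by (simp add: join_def)
  qed
  then show ?thesis using assms unfolding lattice_congruence_def congruence_def by blast
qed

lemmas congruenceD = lattice_congruenceD[OF congruence_imp_lattice_congruence]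

lemma congruence_sup:
  assumes "congruence L R" "P \<subseteq> R"
  shows "(\<Squnion>\<^bsub>L\<^esub>(fst ` P), \<Squnion>\<^bsub>L\<^esub>(snd ` P)) \<in> R"
  using assms unfolding congruence_def by blast

lemma congruenceI:
  assumes "R \<subseteq> carrier L \<times> carrier L" "\<And>x. x \<in> carrier L \<Longrightarrow> (x, x) \<in> R"
    and "\<And>x y. (x, y) \<in> R \<Longrightarrow> (y, x) \<in> R"
    and "\<And>x y z. (x, y) \<in> R \<Longrightarrow> (y, z) \<in> R \<Longrightarrow> (x, z) \<in> R"
    and "\<And>x y x' y'. (x, y) \<in> R \<Longrightarrow> (x', y') \<in> R \<Longrightarrow> (x \<sqinter>\<^bsub>L\<^esub> x', y \<sqinter>\<^bsub>L\<^esub> y') \<in> R"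
    and "\<And>P. P \<subseteq> R \<Longrightarrow> (\<Squnion>\<^bsub>L\<^esub>(fst ` P), \<Squnion>\<^bsub>L\<^esub>(snd ` P)) \<in> R"
  shows "congruence L R"
  unfolding congruence_def
proof (intro conjI)
  show "equiv (carrier L) R"
  proof (rule equivI)
    show "R \<subseteq> carrier L \<times> carrier L" by (rule assms(1))
    show "refl_on (carrier L) R" by (rule refl_onI) (rule assms(2))
    show "sym R" by (rule symI) (rule assms(3))
    show "trans R" by (rule transI) (rule assms(4))
  qed
  show "\<forall>(x, y)\<in>R. \<forall>(x', y')\<in>R. (x \<sqinter>\<^bsub>L\<^esub> x', y \<sqinter>\<^bsub>L\<^esub> y') \<in> R" using assms(5) by blast
  show "\<forall>P\<subseteq>R. (\<Squnion>\<^bsub>L\<^esub>(fst ` P), \<Squnion>\<^bsub>L\<^esub>(snd ` P)) \<in> R" using assms(6) by blast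
qed

lemma carrier_congruence_frame: "carrier (congruence_frame L) = {R. congruence L R}"
  and le_congruence_frame: "le (congruence_frame L) = (\<subseteq>)"
  by (simp_all add: congruence_frame_def)

context
  fixes L :: "'a gorder"
  assumes fr: "frame L"
begin

interpretation L: frame L by (rule fr)

private abbreviation "Con \<equiv> congruence_frame L"

lemma congruence_Id: "congruence L (Id_on (carrier L))"
proof (rule congruenceI)
  fix P assume P: "P \<subseteq> Id_on (carrier L)"
  have p: "fst p = snd p" "snd p \<in> carrier L" if "p \<in> P" for p using subsetD[OF P that] by auto
  then have "fst ` P = snd ` P" "snd ` P \<subseteq> carrier L" by (auto intro: image_cong)
  then show "(\<Squnion>\<^bsub>L\<^esub>(fst ` P), \<Squnion>\<^bsub>L\<^esub>(snd ` P)) \<in> Id_on (carrier L)"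
    using L.sup_closed[of "snd ` P"] by (simp add: Id_on_iff)
qed auto

lemma congruence_full: "congruence L (carrier L \<times> carrier L)"
proof (rule congruenceI)
  fix P assume P: "P \<subseteq> carrier L \<times> carrier L"
  then have "fst ` P \<subseteq> carrier L" "snd ` P \<subseteq> carrier L" by force+
  then show "(\<Squnion>\<^bsub>L\<^esub>(fst ` P), \<Squnion>\<^bsub>L\<^esub>(snd ` P)) \<in> carrier L \<times> carrier L" by simp
qed auto

lemma congruence_Inter:
  assumes "Q \<noteq> {}" "\<And>R. R \<in> Q \<Longrightarrow> congruence L R"
  shows "congruence L (\<Inter>Q)"
proof (rule congruenceI)
  show "\<Inter>Q \<subseteq> carrier L \<times> carrier L" using assms congruenceD(1) by blast
  show "(x, x) \<in> \<Inter>Q" if "x \<in> carrier L" for x using that congruenceD(2)[OF assms(2)] by simp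
  show "(y, x) \<in> \<Inter>Q" if "(x, y) \<in> \<Inter>Q" for x y using that congruenceD(3)[OF assms(2)] by simp
  show "(x, z) \<in> \<Inter>Q" if xy: "(x, y) \<in> \<Inter>Q" and yz: "(y, z) \<in> \<Inter>Q" for x y z
  proof
    fix R assume "R \<in> Q"
    then show "(x, z) \<in> R" using xy yz congruenceD(4)[OF assms(2), of R x y z] by blast
  qed
  show "(x \<sqinter>\<^bsub>L\<^esub> x', y \<sqinter>\<^bsub>L\<^esub> y') \<in> \<Inter>Q" if "(x, y) \<in> \<Inter>Q" "(x', y') \<in> \<Inter>Q" for x y x' y'
    using that congruenceD(5)[OF assms(2)] by simp
  show "(\<Squnion>\<^bsub>L\<^esub>(fst ` P), \<Squnion>\<^bsub>L\<^esub>(snd ` P)) \<in> \<Inter>Q" if P: "P \<subseteq> \<Inter>Q" for P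
  proof
    fix R assume "R \<in> Q"
    then show "(\<Squnion>\<^bsub>L\<^esub>(fst ` P), \<Squnion>\<^bsub>L\<^esub>(snd ` P)) \<in> R" using P by (intro congruence_sup assms) auto
  qed
qed

text \<open>For \<open>x \<sqsubseteq> y\<close> this is the retraction of \<open>L\<close> onto the interval from \<open>x\<close> to \<open>y\<close>. It preserves binary meets and
nonempty joins, so congruences can be pulled back along it. Pulling back the identity gives
\<open>nabla L x\<close> when \<open>y\<close> is the top element and \<open>delta L y\<close> when \<open>x\<close> is the bottom element.\<close>

definition window :: "'a \<Rightarrow> 'a \<Rightarrow> 'a \<Rightarrow> 'a" where
  "window x y a = y \<sqinter>\<^bsub>L\<^esub> (x \<squnion>\<^bsub>L\<^esub> a)"

lemma window_closed: "x \<in> carrier L \<Longrightarrow> y \<in> carrier L \<Longrightarrow> a \<in> carrier L \<Longrightarrow> window x y a \<in> carrier L"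
  by (simp add: window_def)

lemma window_meet:
  assumes "x \<in> carrier L" "y \<in> carrier L" "a \<in> carrier L" "b \<in> carrier L"
  shows "window x y (a \<sqinter>\<^bsub>L\<^esub> b) = window x y a \<sqinter>\<^bsub>L\<^esub> window x y b"
proof (rule L.le_antisym)
  have c: "x \<squnion>\<^bsub>L\<^esub> a \<in> carrier L" "x \<squnion>\<^bsub>L\<^esub> b \<in> carrier L" using assms by auto
  let ?l = "y \<sqinter>\<^bsub>L\<^esub> ((x \<squnion>\<^bsub>L\<^esub> a) \<sqinter>\<^bsub>L\<^esub> (x \<squnion>\<^bsub>L\<^esub> b))"
  let ?r = "(y \<sqinter>\<^bsub>L\<^esub> (x \<squnion>\<^bsub>L\<^esub> a)) \<sqinter>\<^bsub>L\<^esub> (y \<sqinter>\<^bsub>L\<^esub> (x \<squnion>\<^bsub>L\<^esub> b))"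
  have eq: "window x y (a \<sqinter>\<^bsub>L\<^esub> b) = ?l" "window x y a \<sqinter>\<^bsub>L\<^esub> window x y b = ?r"
    using assms by (simp_all add: window_def L.join_meet_distrib)
  show "window x y (a \<sqinter>\<^bsub>L\<^esub> b) \<sqsubseteq>\<^bsub>L\<^esub> window x y a \<sqinter>\<^bsub>L\<^esub> window x y b" unfolding eq
    using assms c by (intro L.meet_le L.meet_mono L.le_refl L.meet_left L.meet_right) auto
  have "?r \<sqsubseteq>\<^bsub>L\<^esub> y" using assms c by (meson L.le_trans L.meet_closed L.meet_left)
  moreover have "?r \<sqsubseteq>\<^bsub>L\<^esub> (x \<squnion>\<^bsub>L\<^esub> a) \<sqinter>\<^bsub>L\<^esub> (x \<squnion>\<^bsub>L\<^esub> b)"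
    by (rule L.meet_mono) (use assms c in \<open>auto intro: L.meet_right\<close>)
  ultimately show "window x y a \<sqinter>\<^bsub>L\<^esub> window x y b \<sqsubseteq>\<^bsub>L\<^esub> window x y (a \<sqinter>\<^bsub>L\<^esub> b)" unfolding eq
    by (rule L.meet_le) (use assms c in auto)
qed (use assms in \<open>auto simp: window_closed\<close>)

text \<open>The retraction sends the bottom element to \<open>y \<sqinter> x\<close>; adding this value accounts for the empty join.\<close>

lemma window_sup:
  assumes x: "x \<in> carrier L" and y: "y \<in> carrier L" and A: "A \<subseteq> carrier L"
  shows "window x y (\<Squnion>\<^bsub>L\<^esub>A) = \<Squnion>\<^bsub>L\<^esub>(insert (window x y \<bottom>\<^bsub>L\<^esub>) (window x y ` A))"
proof (rule L.le_antisym)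
  have sub: "insert (window x y \<bottom>\<^bsub>L\<^esub>) (window x y ` A) \<subseteq> carrier L"
    using assms window_closed by auto
  have wb: "window x y \<bottom>\<^bsub>L\<^esub> = y \<sqinter>\<^bsub>L\<^esub> x"
    using L.bottom_join_eq[OF x] by (simp add: window_def join_comm)
  let ?r = "\<Squnion>\<^bsub>L\<^esub>(insert (window x y \<bottom>\<^bsub>L\<^esub>) (window x y ` A))"
  have r: "?r \<in> carrier L" using sub by simp
  have "window x y (\<Squnion>\<^bsub>L\<^esub>A) = (y \<sqinter>\<^bsub>L\<^esub> x) \<squnion>\<^bsub>L\<^esub> (y \<sqinter>\<^bsub>L\<^esub> \<Squnion>\<^bsub>L\<^esub>A)"
    unfolding window_def using assms by (simp add: L.meet_join_distrib)
  also have "\<dots> \<sqsubseteq>\<^bsub>L\<^esub> ?r"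
  proof (rule L.join_le)
    show "y \<sqinter>\<^bsub>L\<^esub> x \<sqsubseteq>\<^bsub>L\<^esub> ?r" using sub unfolding wb[symmetric] by (intro L.sup_upper) auto
    have "y \<sqinter>\<^bsub>L\<^esub> a \<sqsubseteq>\<^bsub>L\<^esub> ?r" if a: "a \<in> A" for a
    proof -
      have ac: "a \<in> carrier L" using a A by auto
      have "y \<sqinter>\<^bsub>L\<^esub> a \<sqsubseteq>\<^bsub>L\<^esub> window x y a"
        unfolding window_def using x y ac by (intro L.meet_mono L.join_right L.le_refl) auto
      moreover have "window x y a \<sqsubseteq>\<^bsub>L\<^esub> ?r" using sub a by (intro L.sup_upper) auto
      ultimately show ?thesis using L.le_trans r x y ac window_closed by (meson L.meet_closed)
    qed
    then show "y \<sqinter>\<^bsub>L\<^esub> \<Squnion>\<^bsub>L\<^esub>A \<sqsubseteq>\<^bsub>L\<^esub> ?r"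
      unfolding L.meet_sup_distrib[OF y A] using r y A by (intro L.sup_least) auto
  qed (use assms r in auto)
  finally show "window x y (\<Squnion>\<^bsub>L\<^esub>A) \<sqsubseteq>\<^bsub>L\<^esub> ?r" .
  have mono: "window x y a \<sqsubseteq>\<^bsub>L\<^esub> window x y (\<Squnion>\<^bsub>L\<^esub>A)" if "a \<sqsubseteq>\<^bsub>L\<^esub> \<Squnion>\<^bsub>L\<^esub>A" "a \<in> carrier L" for a
    unfolding window_def using that x y A by (intro L.meet_mono L.join_mono L.le_refl) auto
  show "?r \<sqsubseteq>\<^bsub>L\<^esub> window x y (\<Squnion>\<^bsub>L\<^esub>A)"
  proof (rule L.sup_least[OF sub])
    show "window x y (\<Squnion>\<^bsub>L\<^esub>A) \<in> carrier L" using assms window_closed by simp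
    fix z assume "z \<in> insert (window x y \<bottom>\<^bsub>L\<^esub>) (window x y ` A)"
    then show "z \<sqsubseteq>\<^bsub>L\<^esub> window x y (\<Squnion>\<^bsub>L\<^esub>A)"
      using A mono[OF L.bottom_lower] mono[OF L.sup_upper[OF A]] by auto
  qed
  show "?r \<in> carrier L" by fact
qed (use assms window_closed in auto)

lemma window_congruence:
  assumes R: "congruence L R" and x: "x \<in> carrier L" and y: "y \<in> carrier L"
  shows "congruence L {(a, b). a \<in> carrier L \<and> b \<in> carrier L \<and> (window x y a, window x y b) \<in> R}"
    (is "congruence L ?W")
proof (rule congruenceI)
  note w = window_closed[OF x y]
  show "(a, a) \<in> ?W" if "a \<in> carrier L" for a using that congruenceD(2)[OF R w] by simp
  show "(b, a) \<in> ?W" if "(a, b) \<in> ?W" for a b using that congruenceD(3)[OF R] by simp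
  show "(a, c) \<in> ?W" if "(a, b) \<in> ?W" "(b, c) \<in> ?W" for a b c
    using that congruenceD(4)[OF R, of "window x y a" "window x y b"] by simp
  show "(a \<sqinter>\<^bsub>L\<^esub> a', b \<sqinter>\<^bsub>L\<^esub> b') \<in> ?W" if "(a, b) \<in> ?W" "(a', b') \<in> ?W" for a b a' b'
    using that congruenceD(5)[OF R] by (simp add: window_meet x y)
  show "(\<Squnion>\<^bsub>L\<^esub>(fst ` P), \<Squnion>\<^bsub>L\<^esub>(snd ` P)) \<in> ?W" if P: "P \<subseteq> ?W" for P
  proof -
    let ?b = "window x y \<bottom>\<^bsub>L\<^esub>"
    define P' where "P' = insert (?b, ?b) (map_prod (window x y) (window x y) ` P)"
    have "P' \<subseteq> R" using P congruenceD(2)[OF R w[OF L.bottom_closed]] by (auto simp: P'_def)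
    then have "(\<Squnion>\<^bsub>L\<^esub>(fst ` P'), \<Squnion>\<^bsub>L\<^esub>(snd ` P')) \<in> R" by (rule congruence_sup[OF R])
    moreover have "fst ` P' = insert ?b (window x y ` fst ` P)" "snd ` P' = insert ?b (window x y ` snd ` P)"
      by (auto simp: P'_def image_image)
    moreover have "fst ` P \<subseteq> carrier L" "snd ` P \<subseteq> carrier L" using P by auto
    ultimately show ?thesis by (simp add: window_sup x y)
  qed
qed auto

lemma congruence_interval:
  assumes R: "congruence L R" and ab: "(a, b) \<in> R"
  shows "(a \<sqinter>\<^bsub>L\<^esub> b, a \<squnion>\<^bsub>L\<^esub> b) \<in> R"
proof -
  have c: "a \<in> carrier L" "b \<in> carrier L" using congruenceD(7,8)[OF R ab] .
  have "(a \<sqinter>\<^bsub>L\<^esub> a, a \<sqinter>\<^bsub>L\<^esub> b) \<in> R" "(a \<squnion>\<^bsub>L\<^esub> a, a \<squnion>\<^bsub>L\<^esub> b) \<in> R"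
    using congruenceD(5,6)[OF R congruenceD(2)[OF R c(1)] ab] .
  moreover have "a \<sqinter>\<^bsub>L\<^esub> a = a" "a \<squnion>\<^bsub>L\<^esub> a = a" using c(1) L.le_iff_join L.le_iff_meet by fastforce+
  ultimately show ?thesis using congruenceD(3,4)[OF R] by metis
qed

text \<open>The implication \<open>T \<longrightarrow> R\<close> consists of the pairs \<open>(a, b)\<close> whose retractions to any interval collapsed by \<open>T\<close> are
identified by \<open>R\<close>. A congruence \<open>K\<close> with \<open>K \<inter> T \<subseteq> R\<close> is contained in it since both retractions of a pair in \<open>K\<close>
are \<open>T\<close>-related to the lower end of the interval. For the converse, a pair in \<open>T\<close> is retracted to
its own interval from \<open>a \<sqinter> b\<close> to \<open>a \<squnion> b\<close>, which leaves \<open>a\<close> and \<open>b\<close> unchanged.\<close>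

lemma congruence_heyting:
  assumes T: "congruence L T" and R: "congruence L R"
  shows "\<exists>H. congruence L H \<and> (\<forall>K. congruence L K \<longrightarrow> (K \<inter> T \<subseteq> R \<longleftrightarrow> K \<subseteq> H))"
proof -
  define W where "W x y = {(a, b). a \<in> carrier L \<and> b \<in> carrier L \<and> (window x y a, window x y b) \<in> R}" for x y
  \<comment> \<open>The full relation keeps the intersection nonempty and inside the carrier even without intervals.\<close>
  define Q where "Q = insert (carrier L \<times> carrier L) {W x y | x y. (x, y) \<in> T \<and> x \<sqsubseteq>\<^bsub>L\<^esub> y}"
  have "congruence L (\<Inter>Q)"
  proof (rule congruence_Inter)
    fix K assume "K \<in> Q"
    then show "congruence L K"
      unfolding Q_def W_def using congruence_full window_congruence[OF R] congruenceD(7,8)[OF T] by blast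
  qed (simp add: Q_def)
  moreover have "K \<inter> T \<subseteq> R \<longleftrightarrow> K \<subseteq> \<Inter>Q" if K: "congruence L K" for K
  proof
    assume sub: "K \<inter> T \<subseteq> R"
    have "(a, b) \<in> W x y" if ab: "(a, b) \<in> K" and xy: "(x, y) \<in> T" "x \<sqsubseteq>\<^bsub>L\<^esub> y" for a b x y
    proof -
      have c: "x \<in> carrier L" "y \<in> carrier L" "a \<in> carrier L" "b \<in> carrier L"
        using congruenceD(7,8)[OF T xy(1)] congruenceD(7,8)[OF K ab] .
      have "(window x y a, window x y b) \<in> K"
        unfolding window_def using c ab by (intro congruenceD(5,6)[OF K] congruenceD(2)[OF K])
      moreover
      have to_x: "(window x y d, x) \<in> T" if d: "d \<in> carrier L" for d
      proof -
        have "(y \<sqinter>\<^bsub>L\<^esub> (x \<squnion>\<^bsub>L\<^esub> d), x \<sqinter>\<^bsub>L\<^esub> (x \<squnion>\<^bsub>L\<^esub> d)) \<in> T"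
          using c d congruenceD(3)[OF T xy(1)] by (intro congruenceD(5)[OF T] congruenceD(2)[OF T]) auto
        then show ?thesis using L.meet_join_absorb[OF c(1) d] by (simp add: window_def)
      qed
      have "(window x y a, window x y b) \<in> T"
        by (rule congruenceD(4)[OF T to_x[OF c(3)] congruenceD(3)[OF T to_x[OF c(4)]]])
      ultimately show ?thesis using sub c by (auto simp: W_def)
    qed
    then show "K \<subseteq> \<Inter>Q" using congruenceD(1)[OF K] unfolding Q_def by blast
  next
    assume sub: "K \<subseteq> \<Inter>Q"
    show "K \<inter> T \<subseteq> R"
    proof (rule subrelI)
      fix a b assume ab: "(a, b) \<in> K \<inter> T"
      have c: "a \<in> carrier L" "b \<in> carrier L" using congruenceD(7,8)[OF T] ab by auto
      let ?x = "a \<sqinter>\<^bsub>L\<^esub> b" and ?y = "a \<squnion>\<^bsub>L\<^esub> b"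
      have "(?x, ?y) \<in> T" using congruence_interval[OF T] ab by blast
      moreover have "?x \<sqsubseteq>\<^bsub>L\<^esub> ?y" using c by (meson L.join_closed L.join_left L.le_trans L.meet_closed L.meet_left)
      ultimately have "W ?x ?y \<in> Q" unfolding Q_def by blast
      then have "(a, b) \<in> W ?x ?y" using ab sub by blast
      moreover have "window ?x ?y a = a"
        using c L.join_meet_absorb[OF c] L.meet_join_absorb[OF c] unfolding window_def by (metis join_comm meet_comm)
      moreover have "window ?x ?y b = b"
        using c L.join_meet_absorb[OF c(2,1)] L.meet_join_absorb[OF c(2,1)] unfolding window_def by (metis join_comm meet_comm)
      ultimately show "(a, b) \<in> R" by (simp add: W_def)
    qed
  qed
  ultimately show ?thesis by blast
qed

lemma
  shows congruence_frame_frame: "frame Con"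
    and congruence_frame_meet: "congruence L R \<Longrightarrow> congruence L T \<Longrightarrow> R \<sqinter>\<^bsub>Con\<^esub> T = R \<inter> T"
    and congruence_frame_top: "\<top>\<^bsub>Con\<^esub> = carrier L \<times> carrier L"
proof -
  have Con: "Con = inclusion_order {R. congruence L R}" by (simp add: congruence_frame_def inclusion_order_def)
  note * = inclusion_order_frame inclusion_order_meet inclusion_order_top
  have top: "carrier L \<times> carrier L \<in> {R. congruence L R}" using congruence_full by simp
  have sub: "R \<subseteq> carrier L \<times> carrier L" if "R \<in> {R. congruence L R}" for R using that congruenceD(1) by blast
  have int: "\<Inter>Q \<in> {R. congruence L R}" if "Q \<subseteq> {R. congruence L R}" "Q \<noteq> {}" for Q
    using that congruence_Inter by blast
  have imp: "\<exists>H\<in>{R. congruence L R}. \<forall>A\<in>{R. congruence L R}. A \<inter> T \<subseteq> R \<longleftrightarrow> A \<subseteq> H"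
    if "T \<in> {R. congruence L R}" "R \<in> {R. congruence L R}" for T R
    using that congruence_heyting[of T R] by auto
  show "frame Con" "congruence L R \<Longrightarrow> congruence L T \<Longrightarrow> R \<sqinter>\<^bsub>Con\<^esub> T = R \<inter> T"
    "\<top>\<^bsub>Con\<^esub> = carrier L \<times> carrier L"
    unfolding Con using *[where F = "{R. congruence L R}", OF top sub int imp] by auto
qed

interpretation Con: frame Con by (rule congruence_frame_frame)

lemma congruence_frame_bottom: "\<bottom>\<^bsub>Con\<^esub> = Id_on (carrier L)"
proof -
  have "congruence L \<bottom>\<^bsub>Con\<^esub>" using Con.bottom_closed by (simp add: carrier_congruence_frame)
  from congruenceD(2)[OF this] have "Id_on (carrier L) \<subseteq> \<bottom>\<^bsub>Con\<^esub>" by auto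
  moreover have "\<bottom>\<^bsub>Con\<^esub> \<subseteq> Id_on (carrier L)"
    using Con.bottom_lower[of "Id_on (carrier L)"] congruence_Id by (simp add: carrier_congruence_frame le_congruence_frame)
  ultimately show ?thesis by blast
qed

lemma congruence_full_if_bottom_top:
  assumes R: "congruence L R" and bt: "(\<bottom>\<^bsub>L\<^esub>, \<top>\<^bsub>L\<^esub>) \<in> R"
  shows "R = carrier L \<times> carrier L"
proof -
  have to_bottom: "(x, \<bottom>\<^bsub>L\<^esub>) \<in> R" if x: "x \<in> carrier L" for x
    using congruenceD(5)[OF R congruenceD(3)[OF R bt] congruenceD(2)[OF R x]] x
    by (simp add: L.bottom_meet_eq L.top_meet_eq)
  have "(x, y) \<in> R" if "x \<in> carrier L" "y \<in> carrier L" for x y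
    by (rule congruenceD(4)[OF R to_bottom[OF that(1)] congruenceD(3)[OF R to_bottom[OF that(2)]]])
  then show ?thesis using congruenceD(1)[OF R] by auto
qed

lemma
  assumes a: "a \<in> carrier L"
  shows nabla_congruence: "congruence L (nabla L a)"
    and delta_congruence: "congruence L (delta L a)"
proof -
  have "nabla L a = {(b, c). b \<in> carrier L \<and> c \<in> carrier L \<and> (window a \<top>\<^bsub>L\<^esub> b, window a \<top>\<^bsub>L\<^esub> c) \<in> Id_on (carrier L)}"
    using a by (auto simp: nabla_def window_def L.top_meet_eq)
  then show "congruence L (nabla L a)" using window_congruence[OF congruence_Id a L.top_closed] by simp
  have "delta L a = {(b, c). b \<in> carrier L \<and> c \<in> carrier L \<and> (window \<bottom>\<^bsub>L\<^esub> a b, window \<bottom>\<^bsub>L\<^esub> a c) \<in> Id_on (carrier L)}"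
    using a by (auto simp: delta_def window_def L.bottom_join_eq)
  then show "congruence L (delta L a)" using window_congruence[OF congruence_Id L.bottom_closed a] by simp
qed

text \<open>Together with the next lemma: \<open>nabla L a\<close> is the least congruence that identifies \<open>a\<close> with the bottom element, and
\<open>delta L a\<close> the least one that identifies it with the top element.\<close>

lemma nabla_subset_iff:
  assumes a: "a \<in> carrier L" and R: "congruence L R"
  shows "nabla L a \<subseteq> R \<longleftrightarrow> (\<bottom>\<^bsub>L\<^esub>, a) \<in> R"
proof
  have "a \<squnion>\<^bsub>L\<^esub> \<bottom>\<^bsub>L\<^esub> = a" "a \<squnion>\<^bsub>L\<^esub> a = a"
    using a L.bottom_join_eq[OF a] L.le_iff_meet[OF a a] by (simp_all add: join_comm)
  then have "(\<bottom>\<^bsub>L\<^esub>, a) \<in> nabla L a" using a by (simp add: nabla_def)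
  then show "nabla L a \<subseteq> R \<Longrightarrow> (\<bottom>\<^bsub>L\<^esub>, a) \<in> R" by blast
next
  assume 0: "(\<bottom>\<^bsub>L\<^esub>, a) \<in> R"
  have join: "(x, a \<squnion>\<^bsub>L\<^esub> x) \<in> R" if "x \<in> carrier L" for x
    using congruenceD(6)[OF R 0 congruenceD(2)[OF R that]] L.bottom_join_eq[OF that] by simp
  show "nabla L a \<subseteq> R"
  proof (rule subrelI)
    fix x y assume xy: "(x, y) \<in> nabla L a"
    then have "(x, a \<squnion>\<^bsub>L\<^esub> x) \<in> R" "(y, a \<squnion>\<^bsub>L\<^esub> x) \<in> R" using join[of x] join[of y] by (auto simp: nabla_def)
    then show "(x, y) \<in> R" by (meson congruenceD(3)[OF R] congruenceD(4)[OF R])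
  qed
qed

lemma delta_subset_iff:
  assumes a: "a \<in> carrier L" and R: "congruence L R"
  shows "delta L a \<subseteq> R \<longleftrightarrow> (a, \<top>\<^bsub>L\<^esub>) \<in> R"
proof
  have "a \<sqinter>\<^bsub>L\<^esub> \<top>\<^bsub>L\<^esub> = a" "a \<sqinter>\<^bsub>L\<^esub> a = a"
    using a L.top_meet_eq[OF a] L.le_iff_join[OF a a] by (simp_all add: meet_comm)
  then have "(a, \<top>\<^bsub>L\<^esub>) \<in> delta L a" using a by (simp add: delta_def)
  then show "delta L a \<subseteq> R \<Longrightarrow> (a, \<top>\<^bsub>L\<^esub>) \<in> R" by blast
next
  assume 1: "(a, \<top>\<^bsub>L\<^esub>) \<in> R"
  have meet: "(a \<sqinter>\<^bsub>L\<^esub> x, x) \<in> R" if "x \<in> carrier L" for x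
    using congruenceD(5)[OF R 1 congruenceD(2)[OF R that]] L.top_meet_eq[OF that] by simp
  show "delta L a \<subseteq> R"
  proof (rule subrelI)
    fix x y assume xy: "(x, y) \<in> delta L a"
    then have "(a \<sqinter>\<^bsub>L\<^esub> x, x) \<in> R" "(a \<sqinter>\<^bsub>L\<^esub> x, y) \<in> R" using meet[of x] meet[of y] by (auto simp: delta_def)
    then show "(x, y) \<in> R" by (meson congruenceD(3)[OF R] congruenceD(4)[OF R])
  qed
qed

lemma nabla_subset_nabla_iff:
  assumes "a \<in> carrier L" "b \<in> carrier L"
  shows "nabla L a \<subseteq> nabla L b \<longleftrightarrow> a \<sqsubseteq>\<^bsub>L\<^esub> b"
proof -
  have "nabla L a \<subseteq> nabla L b \<longleftrightarrow> b \<squnion>\<^bsub>L\<^esub> \<bottom>\<^bsub>L\<^esub> = b \<squnion>\<^bsub>L\<^esub> a"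
    using assms nabla_subset_iff[OF assms(1) nabla_congruence[OF assms(2)]] by (simp add: nabla_def)
  also have "\<dots> \<longleftrightarrow> a \<sqsubseteq>\<^bsub>L\<^esub> b"
    using assms L.le_iff_meet[OF assms] L.bottom_join_eq[OF assms(2)] by (auto simp: join_comm)
  finally show ?thesis .
qed

lemma nabla_bottom: "nabla L \<bottom>\<^bsub>L\<^esub> = \<bottom>\<^bsub>Con\<^esub>"
  unfolding congruence_frame_bottom by (auto simp: nabla_def L.bottom_join_eq)

lemma delta_bottom: "delta L \<bottom>\<^bsub>L\<^esub> = \<top>\<^bsub>Con\<^esub>"
  unfolding congruence_frame_top by (auto simp: delta_def L.bottom_meet_eq)

lemma congruence_frame_sup_closed: "Q \<subseteq> {R. congruence L R} \<Longrightarrow> congruence L (\<Squnion>\<^bsub>Con\<^esub>Q)"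
  using Con.sup_closed[of Q] by (simp add: carrier_congruence_frame)

lemma congruence_frame_sup_upper: "Q \<subseteq> {R. congruence L R} \<Longrightarrow> R \<in> Q \<Longrightarrow> R \<subseteq> \<Squnion>\<^bsub>Con\<^esub>Q"
  using Con.sup_upper[of Q R] by (simp add: carrier_congruence_frame le_congruence_frame)

lemma congruence_frame_sup_least:
  "Q \<subseteq> {R. congruence L R} \<Longrightarrow> congruence L T \<Longrightarrow> (\<And>R. R \<in> Q \<Longrightarrow> R \<subseteq> T) \<Longrightarrow> \<Squnion>\<^bsub>Con\<^esub>Q \<subseteq> T"
  using Con.sup_least[of Q T] by (simp add: carrier_congruence_frame le_congruence_frame)

lemma nabla_sup:
  assumes A: "A \<subseteq> carrier L"
  shows "nabla L (\<Squnion>\<^bsub>L\<^esub>A) = \<Squnion>\<^bsub>Con\<^esub>(nabla L ` A)"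
proof
  have sub: "nabla L ` A \<subseteq> {R. congruence L R}" using A nabla_congruence by auto
  note T = congruence_frame_sup_closed[OF sub]
  have "(\<lambda>a. (\<bottom>\<^bsub>L\<^esub>, a)) ` A \<subseteq> \<Squnion>\<^bsub>Con\<^esub>(nabla L ` A)"
  proof
    fix p assume "p \<in> (\<lambda>a. (\<bottom>\<^bsub>L\<^esub>, a)) ` A"
    then obtain a where a: "a \<in> A" "p = (\<bottom>\<^bsub>L\<^esub>, a)" by blast
    have "nabla L a \<subseteq> \<Squnion>\<^bsub>Con\<^esub>(nabla L ` A)" using a by (intro congruence_frame_sup_upper[OF sub]) auto
    then show "p \<in> \<Squnion>\<^bsub>Con\<^esub>(nabla L ` A)" using nabla_subset_iff[OF _ T, of a] a A by auto
  qed
  from congruence_sup[OF T this]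
  have "(\<Squnion>\<^bsub>L\<^esub>((\<lambda>_. \<bottom>\<^bsub>L\<^esub>) ` A), \<Squnion>\<^bsub>L\<^esub>A) \<in> \<Squnion>\<^bsub>Con\<^esub>(nabla L ` A)" by (simp add: image_image)
  moreover have "\<Squnion>\<^bsub>L\<^esub>((\<lambda>_. \<bottom>\<^bsub>L\<^esub>) ` A) = \<bottom>\<^bsub>L\<^esub>" by (cases "A = {}") (simp_all add: L.sup_empty_bottom image_constant_conv)
  ultimately show "nabla L (\<Squnion>\<^bsub>L\<^esub>A) \<subseteq> \<Squnion>\<^bsub>Con\<^esub>(nabla L ` A)"
    using nabla_subset_iff[OF _ T, of "\<Squnion>\<^bsub>L\<^esub>A"] A by simp
  show "\<Squnion>\<^bsub>Con\<^esub>(nabla L ` A) \<subseteq> nabla L (\<Squnion>\<^bsub>L\<^esub>A)"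
  proof (rule congruence_frame_sup_least[OF sub nabla_congruence])
    show "\<Squnion>\<^bsub>L\<^esub>A \<in> carrier L" using A by simp
    fix R assume "R \<in> nabla L ` A"
    then obtain a where a: "a \<in> A" "R = nabla L a" by blast
    then have "a \<in> carrier L" "a \<sqsubseteq>\<^bsub>L\<^esub> \<Squnion>\<^bsub>L\<^esub>A" using A L.sup_upper[OF A] by auto
    then show "R \<subseteq> nabla L (\<Squnion>\<^bsub>L\<^esub>A)" using a(2) nabla_subset_nabla_iff[of a "\<Squnion>\<^bsub>L\<^esub>A"] A by simp
  qed
qed

lemma nabla_meet_delta:
  assumes a: "a \<in> carrier L"
  shows "nabla L a \<sqinter>\<^bsub>Con\<^esub> delta L a = \<bottom>\<^bsub>Con\<^esub>"
proof -
  have "x = y" if "(x, y) \<in> nabla L a" "(x, y) \<in> delta L a" for x y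
  proof -
    have xy: "x \<in> carrier L" "y \<in> carrier L" "a \<squnion>\<^bsub>L\<^esub> x = a \<squnion>\<^bsub>L\<^esub> y" "a \<sqinter>\<^bsub>L\<^esub> x = a \<sqinter>\<^bsub>L\<^esub> y"
      using that by (auto simp: nabla_def delta_def)
    have "x = x \<sqinter>\<^bsub>L\<^esub> (a \<squnion>\<^bsub>L\<^esub> x)" using L.meet_join_absorb[OF xy(1) a] by (simp add: join_comm)
    also have "\<dots> = (a \<sqinter>\<^bsub>L\<^esub> x) \<squnion>\<^bsub>L\<^esub> (x \<sqinter>\<^bsub>L\<^esub> y)" using xy a by (simp add: L.meet_join_distrib meet_comm)
    also have "\<dots> = (y \<sqinter>\<^bsub>L\<^esub> a) \<squnion>\<^bsub>L\<^esub> (y \<sqinter>\<^bsub>L\<^esub> x)" using xy by (simp add: meet_comm)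
    also have "\<dots> = y \<sqinter>\<^bsub>L\<^esub> (a \<squnion>\<^bsub>L\<^esub> y)"
      unfolding xy(3)[symmetric] using xy(1,2) a by (simp add: L.meet_join_distrib)
    also have "\<dots> = y" using L.meet_join_absorb[OF xy(2) a] by (simp add: join_comm)
    finally show ?thesis .
  qed
  then have "nabla L a \<inter> delta L a \<subseteq> Id_on (carrier L)" by (auto simp: nabla_def)
  moreover have "Id_on (carrier L) \<subseteq> nabla L a \<inter> delta L a" by (auto simp: nabla_def delta_def)
  ultimately show ?thesis
    unfolding congruence_frame_meet[OF nabla_congruence delta_congruence, OF a a] congruence_frame_bottom by blast
qed

lemma nabla_join_delta:
  assumes a: "a \<in> carrier L"
  shows "nabla L a \<squnion>\<^bsub>Con\<^esub> delta L a = \<top>\<^bsub>Con\<^esub>"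
proof -
  have sub: "{nabla L a, delta L a} \<subseteq> {R. congruence L R}" using a nabla_congruence delta_congruence by simp
  let ?J = "\<Squnion>\<^bsub>Con\<^esub>{nabla L a, delta L a}"
  note J = congruence_frame_sup_closed[OF sub]
  have "(\<bottom>\<^bsub>L\<^esub>, a) \<in> ?J" "(a, \<top>\<^bsub>L\<^esub>) \<in> ?J"
    using congruence_frame_sup_upper[OF sub] nabla_subset_iff[OF a J] delta_subset_iff[OF a J] by auto
  then have "(\<bottom>\<^bsub>L\<^esub>, \<top>\<^bsub>L\<^esub>) \<in> ?J" by (rule congruenceD(4)[OF J])
  then show ?thesis unfolding join_def congruence_frame_top by (rule congruence_full_if_bottom_top[OF J])
qed

end

section \<open>Frame congruences induced by lattice congruences\<close>

definition covered :: "'a gorder \<Rightarrow> 'a set \<Rightarrow> ('a \<times> 'a) set \<Rightarrow> 'a \<Rightarrow> 'a \<Rightarrow> bool" where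
  "covered L S R x y \<longleftrightarrow> (\<forall>s\<in>S. s \<sqsubseteq>\<^bsub>L\<^esub> x \<longrightarrow> (\<exists>t\<in>S. t \<sqsubseteq>\<^bsub>L\<^esub> y \<and> (s, t) \<in> R))"

text \<open>If \<open>L\<close> is identified with the ideals of \<open>S\<close>, two ideals are related when they have the same image in the
quotient of \<open>S\<close> by \<open>R\<close>. Thus a congruence of the lattice \<open>S\<close> is turned into a congruence of the frame \<open>L\<close>.\<close>

definition extension :: "'a gorder \<Rightarrow> 'a set \<Rightarrow> ('a \<times> 'a) set \<Rightarrow> ('a \<times> 'a) set" where
  "extension L S R = {(x, y). x \<in> carrier L \<and> y \<in> carrier L \<and> covered L S R x y \<and> covered L S R y x}"

lemma coveredD:
  assumes "covered L S R x y" "s \<in> S" "s \<sqsubseteq>\<^bsub>L\<^esub> x"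
  obtains t where "t \<in> S" "t \<sqsubseteq>\<^bsub>L\<^esub> y" "(s, t) \<in> R"
  using assms unfolding covered_def by blast

lemma extension_mono: "R \<subseteq> R' \<Longrightarrow> extension L S R \<subseteq> extension L S R'"
  unfolding extension_def covered_def by blast

section \<open>The symmetric Frith frame of congruences generated by a Frith frame\<close>

lemma subframe_generated_contains: "G \<subseteq> subframe_generated L G"
  by (auto simp: subframe_generated_def)

lemma subframe_generated_least: "subframe U L \<Longrightarrow> G \<subseteq> U \<Longrightarrow> subframe_generated L G \<subseteq> U"
  by (auto simp: subframe_generated_def)

lemma sublattice_generated_contains: "G \<subseteq> sublattice_generated L G"
  by (auto simp: sublattice_generated_def)

lemma sublattice_generated_least: "sublattice U L \<Longrightarrow> G \<subseteq> U \<Longrightarrow> sublattice_generated L G \<subseteq> U"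
  by (auto simp: sublattice_generated_def)

lemma sublattice_generated_sublattice:
  assumes "lattice L" "G \<subseteq> carrier L"
  shows "sublattice (sublattice_generated L G) L"
proof -
  interpret lattice L by fact
  let ?U = "sublattice_generated L G"
  have U: "?U = \<Inter>{U. sublattice U L \<and> G \<subseteq> U}" by (simp add: sublattice_generated_def)
  have "sublattice (carrier L) L" by (simp add: sublattice_def)
  then have "?U \<subseteq> carrier L" using assms(2) unfolding U by blast
  moreover have "x \<squnion>\<^bsub>L\<^esub> y \<in> ?U \<and> x \<sqinter>\<^bsub>L\<^esub> y \<in> ?U" if "x \<in> ?U" "y \<in> ?U" for x y
    using that unfolding U by (auto simp: sublattice_def)
  ultimately show ?thesis by (simp add: sublattice_def)
qed

context
  fixes L :: "'a gorder" and S :: "'a set"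
  assumes LS: "frith_frame L S"
begin

interpretation L: frame L by (rule frith_frameD[OF LS])

private abbreviation "C \<equiv> congruence_frame L"
private abbreviation "CS \<equiv> CS_frame L S"
private abbreviation "SB \<equiv> S_bar L S"

private lemma fr: "frame L"
  by (rule frith_frameD[OF LS])

private lemma S: "x \<in> S \<Longrightarrow> x \<in> carrier L"
  using frith_frameD[OF LS] by auto

private lemmas S_closed = frith_frameD(5-8)[OF LS]

interpretation C: frame C by (rule congruence_frame_frame[OF fr])

private abbreviation "U \<equiv> subframe_generated C (nabla L ` carrier L \<union> delta L ` S)"

private lemma generators: "nabla L ` carrier L \<union> delta L ` S \<subseteq> carrier C"
  using nabla_congruence[OF fr] delta_congruence[OF fr] S by (auto simp: carrier_congruence_frame)

private lemma U: "subframe U C"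
  by (rule C.subframe_generated_subframe[OF generators])

private lemma U_C: "U \<subseteq> carrier C"
  using U by (simp add: subframe_def)

private lemma CS: "CS = C\<lparr>carrier := U\<rparr>"
  by (simp add: CS_frame_def)

interpretation CS: frame CS
  unfolding CS by (rule subframe_frame[OF congruence_frame_frame[OF fr] U])

private lemma U_sublattice: "bounded_sublattice U C"
  by (rule subframe_sublattice[OF congruence_frame_frame[OF fr] U])

private lemma CS_sup: "A \<subseteq> U \<Longrightarrow> \<Squnion>\<^bsub>CS\<^esub>A = \<Squnion>\<^bsub>C\<^esub>A"
  unfolding CS by (rule subframe_sup[OF congruence_frame_frame[OF fr] U])

private lemma CS_join: "x \<in> U \<Longrightarrow> y \<in> U \<Longrightarrow> x \<squnion>\<^bsub>CS\<^esub> y = x \<squnion>\<^bsub>C\<^esub> y"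
  and CS_meet: "x \<in> U \<Longrightarrow> y \<in> U \<Longrightarrow> x \<sqinter>\<^bsub>CS\<^esub> y = x \<sqinter>\<^bsub>C\<^esub> y"
proof -
  have "sublattice U C" using U_sublattice by (simp add: bounded_sublattice_def)
  note * = sublat_join[OF C.lattice_axioms this] sublat_meet[OF C.lattice_axioms this]
  show "x \<in> U \<Longrightarrow> y \<in> U \<Longrightarrow> x \<squnion>\<^bsub>CS\<^esub> y = x \<squnion>\<^bsub>C\<^esub> y" "x \<in> U \<Longrightarrow> y \<in> U \<Longrightarrow> x \<sqinter>\<^bsub>CS\<^esub> y = x \<sqinter>\<^bsub>C\<^esub> y"
    unfolding CS using * by simp_all
qed

private lemma CS_bottom: "\<bottom>\<^bsub>CS\<^esub> = \<bottom>\<^bsub>C\<^esub>" and CS_top: "\<top>\<^bsub>CS\<^esub> = \<top>\<^bsub>C\<^esub>"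
  unfolding CS using U_sublattice suborder_bottom[OF C.complete_lattice_axioms U_C]
    suborder_top[OF C.complete_lattice_axioms U_C]
  by (simp_all add: bounded_sublattice_def)

private lemma nabla_U: "a \<in> carrier L \<Longrightarrow> nabla L a \<in> U"
  and delta_U: "s \<in> S \<Longrightarrow> delta L s \<in> U"
  using subframe_generated_contains[of "nabla L ` carrier L \<union> delta L ` S" C] by auto

private lemma SB_sublattice_CS: "sublattice SB CS"
  unfolding S_bar_def using nabla_U delta_U S
  by (intro sublattice_generated_sublattice CS.lattice_axioms) (auto simp: CS)

private lemma SB_U: "x \<in> SB \<Longrightarrow> x \<in> U"
  using SB_sublattice_CS by (auto simp: sublattice_def CS)

private lemma SB_C: "x \<in> SB \<Longrightarrow> x \<in> carrier C"
  using SB_U U_C by blast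

lemma S_bar_congruence: "R \<in> SB \<Longrightarrow> congruence L R"
  using SB_C by (simp add: carrier_congruence_frame)

lemma nabla_S_bar: "s \<in> S \<Longrightarrow> nabla L s \<in> SB"
  and delta_S_bar: "s \<in> S \<Longrightarrow> delta L s \<in> SB"
  using sublattice_generated_contains[of "nabla L ` S \<union> delta L ` S" CS] by (auto simp: S_bar_def)

private lemma SB_sublattice: "bounded_sublattice SB C"
proof -
  have "x \<squnion>\<^bsub>C\<^esub> y \<in> SB \<and> x \<sqinter>\<^bsub>C\<^esub> y \<in> SB" if "x \<in> SB" "y \<in> SB" for x y
  proof -
    have "x \<squnion>\<^bsub>CS\<^esub> y \<in> SB" "x \<sqinter>\<^bsub>CS\<^esub> y \<in> SB"
      using SB_sublattice_CS that unfolding sublattice_def by blast+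
    then show ?thesis using CS_join[OF SB_U SB_U, OF that] CS_meet[OF SB_U SB_U, OF that] by simp
  qed
  then show ?thesis
    using SB_C S_closed nabla_S_bar[of "\<bottom>\<^bsub>L\<^esub>"] delta_S_bar[of "\<bottom>\<^bsub>L\<^esub>"]
    by (auto simp: bounded_sublattice_def sublattice_def nabla_bottom[OF fr] delta_bottom[OF fr])
qed

lemma S_bar_join: "x \<in> SB \<Longrightarrow> y \<in> SB \<Longrightarrow> x \<squnion>\<^bsub>C\<^esub> y \<in> SB"
  and S_bar_meet: "x \<in> SB \<Longrightarrow> y \<in> SB \<Longrightarrow> x \<sqinter>\<^bsub>C\<^esub> y \<in> SB"
  using SB_sublattice by (auto simp: bounded_sublattice_def sublattice_def)

text \<open>Joins and meets are those of the full frame of congruences, which agree with those of \<open>CS_frame L S\<close>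
on its carrier.\<close>

lemma S_bar_induct [consumes 1, case_names nabla delta join meet]:
  assumes "x \<in> SB"
    and "\<And>s. s \<in> S \<Longrightarrow> P (nabla L s)" "\<And>s. s \<in> S \<Longrightarrow> P (delta L s)"
    and "\<And>x y. x \<in> SB \<Longrightarrow> y \<in> SB \<Longrightarrow> P x \<Longrightarrow> P y \<Longrightarrow> P (x \<squnion>\<^bsub>C\<^esub> y)"
    and "\<And>x y. x \<in> SB \<Longrightarrow> y \<in> SB \<Longrightarrow> P x \<Longrightarrow> P y \<Longrightarrow> P (x \<sqinter>\<^bsub>C\<^esub> y)"
  shows "P x"
proof -
  have "sublattice {x \<in> SB. P x} CS"
    using assms(4,5) S_bar_join S_bar_meet SB_U by (auto simp: sublattice_def CS_join CS_meet) (simp add: CS)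
  then have "SB \<subseteq> {x \<in> SB. P x}"
    using assms(2,3) nabla_S_bar delta_S_bar
    by (subst S_bar_def, intro sublattice_generated_least) auto
  then show ?thesis using assms(1) by blast
qed

lemma S_bar_complement:
  assumes "x \<in> SB"
  shows "\<exists>y\<in>SB. x \<sqinter>\<^bsub>C\<^esub> y = \<bottom>\<^bsub>C\<^esub> \<and> x \<squnion>\<^bsub>C\<^esub> y = \<top>\<^bsub>C\<^esub>"
  using assms
proof (induction rule: S_bar_induct)
  case (nabla s)
  then show ?case using S delta_S_bar nabla_meet_delta[OF fr] nabla_join_delta[OF fr] by blast
next
  case (delta s)
  have "delta L s \<sqinter>\<^bsub>C\<^esub> nabla L s = \<bottom>\<^bsub>C\<^esub>" "delta L s \<squnion>\<^bsub>C\<^esub> nabla L s = \<top>\<^bsub>C\<^esub>"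
    using nabla_meet_delta[OF fr S[OF delta]] nabla_join_delta[OF fr S[OF delta]]
    by (simp_all add: meet_comm join_comm)
  then show ?case using nabla_S_bar[OF delta] by blast
next
  case (join x y)
  then obtain c d where cd: "c \<in> SB" "d \<in> SB" "x \<sqinter>\<^bsub>C\<^esub> c = \<bottom>\<^bsub>C\<^esub>" "x \<squnion>\<^bsub>C\<^esub> c = \<top>\<^bsub>C\<^esub>"
    "y \<sqinter>\<^bsub>C\<^esub> d = \<bottom>\<^bsub>C\<^esub>" "y \<squnion>\<^bsub>C\<^esub> d = \<top>\<^bsub>C\<^esub>" by blast
  then show ?case using C.complement_join[of x y c d] S_bar_meet[of c d] join SB_C by blast
next
  case (meet x y)
  then obtain c d where cd: "c \<in> SB" "d \<in> SB" "x \<sqinter>\<^bsub>C\<^esub> c = \<bottom>\<^bsub>C\<^esub>" "x \<squnion>\<^bsub>C\<^esub> c = \<top>\<^bsub>C\<^esub>"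
    "y \<sqinter>\<^bsub>C\<^esub> d = \<bottom>\<^bsub>C\<^esub>" "y \<squnion>\<^bsub>C\<^esub> d = \<top>\<^bsub>C\<^esub>" by blast
  then show ?case using C.complement_meet[of x y c d] S_bar_join[of c d] meet SB_C by blast
qed

text \<open>The joins of elements of \<open>S_bar L S\<close> form a subframe, and this subframe contains \<open>nabla L a\<close> for every \<open>a\<close>
because \<open>a\<close> is a join of elements of \<open>S\<close> and \<open>nabla L\<close> preserves joins. So it is all of \<open>CS_frame L S\<close>.\<close>

lemma CS_frame_symmetric: "symmetric_frith_frame CS SB"
proof -
  have "bounded_sublattice SB CS"
    using SB_sublattice_CS SB_sublattice by (simp add: bounded_sublattice_def CS_bottom CS_top)
  moreover have "U \<subseteq> {\<Squnion>\<^bsub>C\<^esub>A | A. A \<subseteq> SB}"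
  proof (rule subframe_generated_least[OF C.sups_subframe[OF SB_sublattice]])
    have "nabla L a \<in> {\<Squnion>\<^bsub>C\<^esub>A | A. A \<subseteq> SB}" if a: "a \<in> carrier L" for a
    proof -
      obtain A where A: "A \<subseteq> S" "a = \<Squnion>\<^bsub>L\<^esub>A" using frith_frame_basis[OF LS a] by blast
      then have "A \<subseteq> carrier L" "nabla L ` A \<subseteq> SB" using S nabla_S_bar by auto
      then show ?thesis using nabla_sup[OF fr, of A] A(2) by auto
    qed
    moreover have "delta L s \<in> {\<Squnion>\<^bsub>C\<^esub>A | A. A \<subseteq> SB}" if s: "s \<in> S" for s
    proof -
      have "\<Squnion>\<^bsub>C\<^esub>{delta L s} = delta L s" using SB_C[OF delta_S_bar[OF s]] by simp
      then show ?thesis using delta_S_bar[OF s] by (intro CollectI exI[of _ "{delta L s}"]) simp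
    qed
    ultimately show "nabla L ` carrier L \<union> delta L ` S \<subseteq> {\<Squnion>\<^bsub>C\<^esub>A | A. A \<subseteq> SB}" by blast
  qed
  moreover have "\<Squnion>\<^bsub>CS\<^esub>A = \<Squnion>\<^bsub>C\<^esub>A" if "A \<subseteq> SB" for A
    using that SB_U by (intro CS_sup) blast
  ultimately have "frith_frame CS SB"
    unfolding frith_frame_def using CS.frame_axioms CS.complete_lattice_axioms
    by (auto simp: CS_frame_def frame_def) blast
  moreover have "\<exists>t\<in>SB. x \<sqinter>\<^bsub>CS\<^esub> t = \<bottom>\<^bsub>CS\<^esub> \<and> x \<squnion>\<^bsub>CS\<^esub> t = \<top>\<^bsub>CS\<^esub>" if x: "x \<in> SB" for x
    using S_bar_complement[OF x] SB_U x CS_join CS_meet by (auto simp: CS_bottom CS_top)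
  ultimately show ?thesis by (simp add: symmetric_frith_frame_def)
qed

lemma coherent_CS_frame_iff:
  "coherent CS SB \<longleftrightarrow>
     (\<forall>R\<in>SB. \<forall>A\<subseteq>SB. R \<subseteq> \<Squnion>\<^bsub>C\<^esub>A \<longrightarrow> (\<exists>F\<subseteq>A. finite F \<and> R \<subseteq> \<Squnion>\<^bsub>C\<^esub>F))"
proof -
  have s: "\<Squnion>\<^bsub>CS\<^esub>A = \<Squnion>\<^bsub>C\<^esub>A" if "A \<subseteq> SB" for A
    using that SB_U by (intro CS_sup) blast
  have le: "le CS = (\<subseteq>)" by (simp add: CS_frame_def le_congruence_frame)
  show ?thesis unfolding coherent_def le
    by (intro ball_cong refl all_cong imp_cong) (auto simp: s, metis s subset_trans, metis s subset_trans)
qed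

text \<open>The map \<open>nabla L\<close> preserves joins, reflects the order and maps \<open>S\<close> into \<open>S_bar L S\<close>, so compactness can be
pulled back along it.\<close>

lemma coherent_CS_frame_imp_coherent:
  assumes "coherent CS SB"
  shows "coherent L S"
  unfolding coherent_def
proof (intro ballI allI impI)
  fix s A assume s: "s \<in> S" and A: "A \<subseteq> S" and le: "s \<sqsubseteq>\<^bsub>L\<^esub> \<Squnion>\<^bsub>L\<^esub>A"
  have Ac: "A \<subseteq> carrier L" using A S by blast
  have "nabla L s \<subseteq> \<Squnion>\<^bsub>C\<^esub>(nabla L ` A)"
    using le nabla_subset_nabla_iff[OF fr S[OF s], of "\<Squnion>\<^bsub>L\<^esub>A"] nabla_sup[OF fr Ac] Ac by simp
  moreover have "nabla L ` A \<subseteq> SB" using A nabla_S_bar by blast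
  ultimately obtain F where F: "F \<subseteq> nabla L ` A" "finite F" "nabla L s \<subseteq> \<Squnion>\<^bsub>C\<^esub>F"
    using assms nabla_S_bar[OF s] unfolding coherent_CS_frame_iff by meson
  obtain F' where F': "F' \<subseteq> A" "finite F'" "F = nabla L ` F'" using finite_subset_image[OF F(2,1)] by blast
  have F'c: "F' \<subseteq> carrier L" using F' Ac by blast
  have "s \<sqsubseteq>\<^bsub>L\<^esub> \<Squnion>\<^bsub>L\<^esub>F'"
    using F(3) F'(3) nabla_subset_nabla_iff[OF fr S[OF s], of "\<Squnion>\<^bsub>L\<^esub>F'"] nabla_sup[OF fr F'c] F'c by simp
  then show "\<exists>F\<subseteq>A. finite F \<and> s \<sqsubseteq>\<^bsub>L\<^esub> \<Squnion>\<^bsub>L\<^esub>F" using F' by blast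
qed

section \<open>Compactness of the sublattice of congruences\<close>

context
  assumes coh: "coherent L S"
begin

text \<open>This is where compactness is used: an element \<open>s \<in> S\<close> below \<open>\<Squnion>X\<close> is below a join of finitely many elements of
\<open>S\<close>, each below some member of \<open>X\<close> and so \<open>R\<close>-related to an element of \<open>S\<close> below \<open>\<Squnion>Y\<close>. As \<open>R\<close> preserves finite
joins, these combine to an element that only has to be cut down by \<open>s\<close>.\<close>

lemma covered_sup:
  assumes R: "lattice_congruence L R" and X: "X \<subseteq> carrier L" and Y: "Y \<subseteq> carrier L"
    and XY: "\<And>x. x \<in> X \<Longrightarrow> \<exists>y\<in>Y. covered L S R x y"
  shows "covered L S R (\<Squnion>\<^bsub>L\<^esub>X) (\<Squnion>\<^bsub>L\<^esub>Y)"
  unfolding covered_def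
proof (intro ballI impI)
  fix s assume s: "s \<in> S" and le: "s \<sqsubseteq>\<^bsub>L\<^esub> \<Squnion>\<^bsub>L\<^esub>X"
  let ?w = "\<Squnion>\<^bsub>L\<^esub>Y"
  have w: "?w \<in> carrier L" using Y by simp
  define A where "A = {a \<in> S. \<exists>x\<in>X. a \<sqsubseteq>\<^bsub>L\<^esub> x}"
  have AS: "A \<subseteq> S" by (auto simp: A_def)
  then have Ac: "A \<subseteq> carrier L" using S by blast
  have "x \<sqsubseteq>\<^bsub>L\<^esub> \<Squnion>\<^bsub>L\<^esub>A" if x: "x \<in> X" for x
  proof -
    obtain B where B: "B \<subseteq> S" "x = \<Squnion>\<^bsub>L\<^esub>B" using frith_frame_basis[OF LS subsetD[OF X x]] .
    then have Bc: "B \<subseteq> carrier L" using S by blast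
    have "B \<subseteq> A" unfolding A_def using B x L.sup_upper[OF Bc] by blast
    then show ?thesis unfolding B(2) by (rule L.sup_mono[OF _ Ac])
  qed
  then have "\<Squnion>\<^bsub>L\<^esub>X \<sqsubseteq>\<^bsub>L\<^esub> \<Squnion>\<^bsub>L\<^esub>A" using Ac X by (intro L.sup_least) auto
  then have "s \<sqsubseteq>\<^bsub>L\<^esub> \<Squnion>\<^bsub>L\<^esub>A" using L.le_trans[OF le] S[OF s] X Ac by simp
  then obtain F where F: "F \<subseteq> A" "finite F" "s \<sqsubseteq>\<^bsub>L\<^esub> \<Squnion>\<^bsub>L\<^esub>F" using coherentD[OF coh s AS] by blast
  have "\<exists>t\<in>S. t \<sqsubseteq>\<^bsub>L\<^esub> ?w \<and> (\<Squnion>\<^bsub>L\<^esub>F, t) \<in> R" using F(2,1)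
  proof (induction F rule: finite_induct)
    case empty
    then show ?case using S_closed w lattice_congruenceD(2)[OF R L.bottom_closed]
      by (intro bexI[of _ "\<bottom>\<^bsub>L\<^esub>"]) (auto simp: L.sup_empty_bottom)
  next
    case (insert a F)
    then obtain t where t: "t \<in> S" "t \<sqsubseteq>\<^bsub>L\<^esub> ?w" "(\<Squnion>\<^bsub>L\<^esub>F, t) \<in> R" by auto
    obtain x where x: "x \<in> X" "a \<in> S" "a \<sqsubseteq>\<^bsub>L\<^esub> x" using insert by (auto simp: A_def)
    obtain y where y: "y \<in> Y" "covered L S R x y" using XY[OF x(1)] by blast
    obtain u where u: "u \<in> S" "u \<sqsubseteq>\<^bsub>L\<^esub> y" "(a, u) \<in> R" using coveredD[OF y(2) x(2,3)] by blast
    have "u \<sqsubseteq>\<^bsub>L\<^esub> ?w" using L.le_trans[OF u(2) L.sup_upper[OF Y y(1)]] S u(1) y(1) Y w by auto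
    then have "u \<squnion>\<^bsub>L\<^esub> t \<sqsubseteq>\<^bsub>L\<^esub> ?w" using t u S w by (intro L.join_le) auto
    moreover have "(\<Squnion>\<^bsub>L\<^esub>(insert a F), u \<squnion>\<^bsub>L\<^esub> t) \<in> R"
    proof -
      have "a \<in> carrier L" "F \<subseteq> carrier L" using insert.prems Ac by auto
      then show ?thesis using lattice_congruenceD(6)[OF R u(3) t(3)] L.sup_insert[of a F] by simp
    qed
    ultimately show ?case using S_closed(3)[OF u(1) t(1)] by blast
  qed
  then obtain t where t: "t \<in> S" "t \<sqsubseteq>\<^bsub>L\<^esub> ?w" "(\<Squnion>\<^bsub>L\<^esub>F, t) \<in> R" by blast
  have Fc: "\<Squnion>\<^bsub>L\<^esub>F \<in> carrier L" using F Ac by (intro L.sup_closed) blast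
  have "(s \<sqinter>\<^bsub>L\<^esub> \<Squnion>\<^bsub>L\<^esub>F, s \<sqinter>\<^bsub>L\<^esub> t) \<in> R"
    by (rule lattice_congruenceD(5)[OF R lattice_congruenceD(2)[OF R S[OF s]] t(3)])
  moreover have "s \<sqinter>\<^bsub>L\<^esub> \<Squnion>\<^bsub>L\<^esub>F = s" using F(3) L.le_iff_join[OF S[OF s] Fc] by simp
  moreover have "s \<sqinter>\<^bsub>L\<^esub> t \<sqsubseteq>\<^bsub>L\<^esub> ?w"
    using L.le_trans[OF L.meet_right t(2)] S[OF s] S[OF t(1)] w by simp
  ultimately show "\<exists>t\<in>S. t \<sqsubseteq>\<^bsub>L\<^esub> ?w \<and> (s, t) \<in> R" using S_closed(4)[OF s t(1)] by auto
qed

lemma covered_meet: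
  assumes R: "lattice_congruence L R"
    and c: "x \<in> carrier L" "y \<in> carrier L" "x' \<in> carrier L" "y' \<in> carrier L"
    and cov: "covered L S R x y" "covered L S R x' y'"
  shows "covered L S R (x \<sqinter>\<^bsub>L\<^esub> x') (y \<sqinter>\<^bsub>L\<^esub> y')"
  unfolding covered_def
proof (intro ballI impI)
  fix s assume s: "s \<in> S" and le: "s \<sqsubseteq>\<^bsub>L\<^esub> x \<sqinter>\<^bsub>L\<^esub> x'"
  have sx: "s \<sqsubseteq>\<^bsub>L\<^esub> x" "s \<sqsubseteq>\<^bsub>L\<^esub> x'"
    using L.le_trans[OF le L.meet_left] L.le_trans[OF le L.meet_right] c S[OF s] by auto
  obtain t where t: "t \<in> S" "t \<sqsubseteq>\<^bsub>L\<^esub> y" "(s, t) \<in> R" using coveredD[OF cov(1) s sx(1)] by blast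
  obtain t' where t': "t' \<in> S" "t' \<sqsubseteq>\<^bsub>L\<^esub> y'" "(s, t') \<in> R" using coveredD[OF cov(2) s sx(2)] by blast
  have "s \<sqinter>\<^bsub>L\<^esub> s = s" using L.le_iff_join[of s s] S[OF s] by simp
  then have "(s, t \<sqinter>\<^bsub>L\<^esub> t') \<in> R" using lattice_congruenceD(5)[OF R t(3) t'(3)] by simp
  moreover have "t \<sqinter>\<^bsub>L\<^esub> t' \<sqsubseteq>\<^bsub>L\<^esub> y \<sqinter>\<^bsub>L\<^esub> y'" using t t' c S by (intro L.meet_mono) auto
  ultimately show "\<exists>t\<in>S. t \<sqsubseteq>\<^bsub>L\<^esub> y \<sqinter>\<^bsub>L\<^esub> y' \<and> (s, t) \<in> R" using S_closed(4)[OF t(1) t'(1)] by blast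
qed

lemma covered_trans:
  assumes "lattice_congruence L R" "covered L S R x y" "covered L S R y z"
  shows "covered L S R x z"
  unfolding covered_def
proof (intro ballI impI)
  fix s assume "s \<in> S" "s \<sqsubseteq>\<^bsub>L\<^esub> x"
  then obtain t where t: "t \<in> S" "t \<sqsubseteq>\<^bsub>L\<^esub> y" "(s, t) \<in> R" using coveredD[OF assms(2)] by blast
  then obtain u where "u \<in> S" "u \<sqsubseteq>\<^bsub>L\<^esub> z" "(t, u) \<in> R" using coveredD[OF assms(3)] by blast
  then show "\<exists>u\<in>S. u \<sqsubseteq>\<^bsub>L\<^esub> z \<and> (s, u) \<in> R" using lattice_congruenceD(4)[OF assms(1) t(3)] by blast
qed

lemma extension_congruence:
  assumes R: "lattice_congruence L R"
  shows "congruence L (extension L S R)"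
proof (rule congruenceI)
  show "extension L S R \<subseteq> carrier L \<times> carrier L" by (auto simp: extension_def)
  show "(x, x) \<in> extension L S R" if "x \<in> carrier L" for x
  proof -
    have "covered L S R x x" unfolding covered_def using lattice_congruenceD(2)[OF R S] by blast
    then show ?thesis using that by (simp add: extension_def)
  qed
  show "(y, x) \<in> extension L S R" if "(x, y) \<in> extension L S R" for x y
    using that by (simp add: extension_def)
  show "(x, z) \<in> extension L S R" if "(x, y) \<in> extension L S R" "(y, z) \<in> extension L S R" for x y z
    using that covered_trans[OF R, of x y z] covered_trans[OF R, of z y x] by (simp add: extension_def)
  show "(x \<sqinter>\<^bsub>L\<^esub> x', y \<sqinter>\<^bsub>L\<^esub> y') \<in> extension L S R"
    if "(x, y) \<in> extension L S R" "(x', y') \<in> extension L S R" for x y x' y'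
    using that covered_meet[OF R, of x y x' y'] covered_meet[OF R, of y x y' x'] by (simp add: extension_def)
  show "(\<Squnion>\<^bsub>L\<^esub>(fst ` P), \<Squnion>\<^bsub>L\<^esub>(snd ` P)) \<in> extension L S R" if P: "P \<subseteq> extension L S R" for P
  proof -
    have Pd: "fst p \<in> carrier L" "snd p \<in> carrier L" "covered L S R (fst p) (snd p)" "covered L S R (snd p) (fst p)"
      if "p \<in> P" for p
      using subsetD[OF P that] by (auto simp: extension_def)
    have c: "fst ` P \<subseteq> carrier L" "snd ` P \<subseteq> carrier L" using Pd by auto
    have "covered L S R (\<Squnion>\<^bsub>L\<^esub>(fst ` P)) (\<Squnion>\<^bsub>L\<^esub>(snd ` P))"
      by (rule covered_sup[OF R c]) (use Pd in blast)
    moreover have "covered L S R (\<Squnion>\<^bsub>L\<^esub>(snd ` P)) (\<Squnion>\<^bsub>L\<^esub>(fst ` P))"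
      by (rule covered_sup[OF R c(2,1)]) (use Pd in blast)
    ultimately show ?thesis using c by (simp add: extension_def)
  qed
qed

lemma subset_extensionI:
  assumes T: "congruence L T" and "\<And>x y. (x, y) \<in> T \<Longrightarrow> covered L S R x y"
  shows "T \<subseteq> extension L S R"
  using assms(2) congruenceD(3,7,8)[OF T] unfolding extension_def by blast

text \<open>If \<open>s\<close> is below \<open>a \<squnion> y\<close>, compactness gives \<open>t \<in> S\<close> below \<open>y\<close> with \<open>s\<close> below \<open>a \<squnion> t\<close>, and then
\<open>a \<squnion> (s \<sqinter> t) = a \<squnion> s\<close>.\<close>

lemma nabla_extension:
  assumes a: "a \<in> S"
  shows "nabla L a \<subseteq> extension L S (nabla L a)"
proof (rule subset_extensionI[OF nabla_congruence[OF fr S[OF a]]])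
  note ac = S[OF a]
  fix x y assume xy: "(x, y) \<in> nabla L a"
  then have c: "x \<in> carrier L" "y \<in> carrier L" and eq: "a \<squnion>\<^bsub>L\<^esub> x = a \<squnion>\<^bsub>L\<^esub> y" by (auto simp: nabla_def)
  show "covered L S (nabla L a) x y" unfolding covered_def
  proof (intro ballI impI)
    fix s assume s: "s \<in> S" and le: "s \<sqsubseteq>\<^bsub>L\<^esub> x"
    note sc = S[OF s]
    obtain B where B: "B \<subseteq> S" "y = \<Squnion>\<^bsub>L\<^esub>B" using frith_frame_basis[OF LS c(2)] by blast
    have Bc: "B \<subseteq> carrier L" using B(1) S by blast
    have "s \<sqsubseteq>\<^bsub>L\<^esub> a \<squnion>\<^bsub>L\<^esub> y" unfolding eq[symmetric]
      using L.le_trans[OF le L.join_right[OF ac c(1)]] c sc ac by simp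
    also have "a \<squnion>\<^bsub>L\<^esub> y = \<Squnion>\<^bsub>L\<^esub>(insert a B)" using B(2) L.sup_insert[OF ac Bc] by simp
    finally obtain F where F: "F \<subseteq> insert a B" "finite F" "s \<sqsubseteq>\<^bsub>L\<^esub> \<Squnion>\<^bsub>L\<^esub>F"
      using coherentD[OF coh s, of "insert a B"] a B(1) by blast
    define t where "t = \<Squnion>\<^bsub>L\<^esub>(F \<inter> B)"
    have t: "t \<in> S" unfolding t_def
      using F B by (intro finite_sup_in_sublattice[OF fr frith_frameD(2)[OF LS]]) auto
    note tc = S[OF t]
    have ty: "t \<sqsubseteq>\<^bsub>L\<^esub> y" unfolding t_def B(2) using Bc by (intro L.sup_mono) auto
    have FBc: "F \<inter> B \<subseteq> carrier L" using Bc by blast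
    have "\<Squnion>\<^bsub>L\<^esub>F \<sqsubseteq>\<^bsub>L\<^esub> \<Squnion>\<^bsub>L\<^esub>(insert a (F \<inter> B))" using F FBc ac by (intro L.sup_mono) auto
    also have "\<Squnion>\<^bsub>L\<^esub>(insert a (F \<inter> B)) = a \<squnion>\<^bsub>L\<^esub> t" unfolding t_def using L.sup_insert[OF ac FBc] .
    finally have "s \<sqsubseteq>\<^bsub>L\<^esub> a \<squnion>\<^bsub>L\<^esub> t"
      using L.le_trans[OF F(3)] sc ac tc F(1) Bc by (meson L.join_closed L.sup_closed insert_subset subset_trans)
    then have "a \<squnion>\<^bsub>L\<^esub> s \<sqsubseteq>\<^bsub>L\<^esub> a \<squnion>\<^bsub>L\<^esub> t" using L.join_left[OF ac tc] ac sc tc by (intro L.join_le) auto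
    then have "(a \<squnion>\<^bsub>L\<^esub> s) \<sqinter>\<^bsub>L\<^esub> (a \<squnion>\<^bsub>L\<^esub> t) = a \<squnion>\<^bsub>L\<^esub> s"
      using L.le_iff_join[of "a \<squnion>\<^bsub>L\<^esub> s" "a \<squnion>\<^bsub>L\<^esub> t"] ac sc tc by simp
    then have "(s, s \<sqinter>\<^bsub>L\<^esub> t) \<in> nabla L a"
      using ac sc tc by (simp add: nabla_def L.join_meet_distrib)
    moreover have "s \<sqinter>\<^bsub>L\<^esub> t \<sqsubseteq>\<^bsub>L\<^esub> y" using L.le_trans[OF L.meet_right[OF sc tc] ty] sc tc c by simp
    ultimately show "\<exists>t\<in>S. t \<sqsubseteq>\<^bsub>L\<^esub> y \<and> (s, t) \<in> nabla L a" using S_closed(4)[OF s t] by blast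
  qed
qed

lemma delta_extension:
  assumes a: "a \<in> S"
  shows "delta L a \<subseteq> extension L S (delta L a)"
proof (rule subset_extensionI[OF delta_congruence[OF fr S[OF a]]])
  note ac = S[OF a]
  fix x y assume xy: "(x, y) \<in> delta L a"
  then have c: "x \<in> carrier L" "y \<in> carrier L" and eq: "a \<sqinter>\<^bsub>L\<^esub> x = a \<sqinter>\<^bsub>L\<^esub> y" by (auto simp: delta_def)
  show "covered L S (delta L a) x y" unfolding covered_def
  proof (intro ballI impI)
    fix s assume s: "s \<in> S" and le: "s \<sqsubseteq>\<^bsub>L\<^esub> x"
    note sc = S[OF s]
    have "a \<sqinter>\<^bsub>L\<^esub> s \<sqsubseteq>\<^bsub>L\<^esub> a \<sqinter>\<^bsub>L\<^esub> y" unfolding eq[symmetric] using le ac sc c by (intro L.meet_mono) auto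
    then have "a \<sqinter>\<^bsub>L\<^esub> s \<sqsubseteq>\<^bsub>L\<^esub> y" using L.le_trans[OF _ L.meet_right[OF ac c(2)]] ac sc c by simp
    moreover have "(s, a \<sqinter>\<^bsub>L\<^esub> s) \<in> delta L a"
    proof -
      have "a \<sqinter>\<^bsub>L\<^esub> (a \<sqinter>\<^bsub>L\<^esub> s) = (a \<sqinter>\<^bsub>L\<^esub> a) \<sqinter>\<^bsub>L\<^esub> s" using ac sc by (simp add: L.meet_assoc)
      also have "a \<sqinter>\<^bsub>L\<^esub> a = a" using L.le_iff_join[OF ac ac] ac by simp
      finally show ?thesis using ac sc by (simp add: delta_def)
    qed
    ultimately show "\<exists>t\<in>S. t \<sqsubseteq>\<^bsub>L\<^esub> y \<and> (s, t) \<in> delta L a" using S_closed(4)[OF a s] by blast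
  qed
qed

lemma meet_extension:
  assumes R: "congruence L R" "R \<subseteq> extension L S R" and T: "congruence L T" "T \<subseteq> extension L S T"
    and RT: "congruence L (R \<inter> T)"
  shows "R \<inter> T \<subseteq> extension L S (R \<inter> T)"
proof (rule subset_extensionI[OF RT])
  fix x y assume xy: "(x, y) \<in> R \<inter> T"
  have c: "x \<in> carrier L" "y \<in> carrier L" using congruenceD(7,8)[OF RT xy] .
  have cov: "covered L S R x y" "covered L S T x y" using xy R(2) T(2) by (auto simp: extension_def)
  show "covered L S (R \<inter> T) x y" unfolding covered_def
  proof (intro ballI impI)
    fix s assume s: "s \<in> S" and le: "s \<sqsubseteq>\<^bsub>L\<^esub> x"
    note sc = S[OF s]
    obtain t where t: "t \<in> S" "t \<sqsubseteq>\<^bsub>L\<^esub> y" "(s, t) \<in> R" using coveredD[OF cov(1) s le] by blast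
    obtain u where u: "u \<in> S" "u \<sqsubseteq>\<^bsub>L\<^esub> y" "(s, u) \<in> T" using coveredD[OF cov(2) s le] by blast
    note tu = S[OF t(1)] S[OF u(1)]
    have step: "(s, s \<sqinter>\<^bsub>L\<^esub> (p \<squnion>\<^bsub>L\<^esub> q)) \<in> K"
      if K: "congruence L K" and p: "p \<in> S" "(s, p) \<in> K" and q: "q \<in> S" for K p q
    proof -
      note pq = S[OF p(1)] S[OF q]
      have "(s \<sqinter>\<^bsub>L\<^esub> (s \<squnion>\<^bsub>L\<^esub> q), s \<sqinter>\<^bsub>L\<^esub> (p \<squnion>\<^bsub>L\<^esub> q)) \<in> K"
        using p pq sc by (intro congruenceD(5,6)[OF K] congruenceD(2)[OF K]) auto
      then show ?thesis using L.meet_join_absorb[OF sc pq(2)] by simp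
    qed
    \<comment> \<open>One witness for both congruences: it lies below \<open>s\<close> and above \<open>s \<sqinter> t\<close> and \<open>s \<sqinter> u\<close>, and the classes are convex.\<close>
    let ?r = "s \<sqinter>\<^bsub>L\<^esub> (t \<squnion>\<^bsub>L\<^esub> u)"
    have "(s, ?r) \<in> R" using step[OF R(1) t(1,3) u(1)] .
    moreover have "(s, ?r) \<in> T" using step[OF T(1) u(1,3) t(1)] by (simp add: join_comm)
    moreover have "t \<squnion>\<^bsub>L\<^esub> u \<sqsubseteq>\<^bsub>L\<^esub> y" using t u tu c by (intro L.join_le) auto
    then have "?r \<sqsubseteq>\<^bsub>L\<^esub> y" using L.le_trans[OF L.meet_right] sc tu c by simp
    moreover have "?r \<in> S" using s t u S_closed by simp
    ultimately show "\<exists>t\<in>S. t \<sqsubseteq>\<^bsub>L\<^esub> y \<and> (s, t) \<in> R \<inter> T" by blast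
  qed
qed

text \<open>The members of \<open>S_bar L S\<close> are determined by what they identify in \<open>S\<close>. The join step is the reason for
working with \<open>extension\<close>: instead of describing the join of two congruences, one observes that
\<open>extension L S (R \<squnion> T)\<close> is a congruence above \<open>R\<close> and \<open>T\<close>.\<close>

lemma S_bar_extension: "R \<in> SB \<Longrightarrow> R \<subseteq> extension L S R"
proof (induction rule: S_bar_induct)
  case (nabla s)
  then show ?case by (rule nabla_extension)
next
  case (delta s)
  then show ?case by (rule delta_extension)
next
  case (join R T)
  have c: "congruence L R" "congruence L T" using join S_bar_congruence by auto
  let ?J = "R \<squnion>\<^bsub>C\<^esub> T"
  have Rc: "R \<in> carrier C" "T \<in> carrier C" using c by (simp_all add: carrier_congruence_frame)
  then have J: "congruence L ?J" using C.join_closed[OF Rc] by (simp add: carrier_congruence_frame)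
  have E: "congruence L (extension L S ?J)"
    by (rule extension_congruence[OF congruence_imp_lattice_congruence[OF J]])
  have "R \<subseteq> ?J" "T \<subseteq> ?J"
    using C.join_left[OF Rc] C.join_right[OF Rc] by (simp_all add: le_congruence_frame)
  then have "R \<subseteq> extension L S ?J" "T \<subseteq> extension L S ?J"
    using join.IH extension_mono[of R ?J L S] extension_mono[of T ?J L S] by auto
  then show ?case
    using C.join_le[of R "extension L S ?J" T] Rc E by (simp add: carrier_congruence_frame le_congruence_frame)
next
  case (meet R T)
  have c: "congruence L R" "congruence L T" "congruence L (R \<sqinter>\<^bsub>C\<^esub> T)"
    using meet S_bar_congruence S_bar_meet by auto
  then show ?case using meet_extension[of R T] meet.IH
    unfolding congruence_frame_meet[OF fr c(1,2)] by blast
qed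

text \<open>The union of the joins of the finite subsets of \<open>A\<close> is only a lattice congruence, but its extension is a frame
congruence that contains every member of \<open>A\<close>. Hence the extension relates top and bottom, which means that the
union does, so some finite join already does.\<close>

lemma S_bar_top_compact:
  assumes A: "A \<subseteq> SB" and top: "\<Squnion>\<^bsub>C\<^esub>A = \<top>\<^bsub>C\<^esub>"
  shows "\<exists>F\<subseteq>A. finite F \<and> \<Squnion>\<^bsub>C\<^esub>F = \<top>\<^bsub>C\<^esub>"
proof -
  have Ac: "A \<subseteq> {R. congruence L R}" using A S_bar_congruence by blast
  define R where "R = (\<Union>F\<in>{F. F \<subseteq> A \<and> finite F}. \<Squnion>\<^bsub>C\<^esub>F)"
  have con: "congruence L (\<Squnion>\<^bsub>C\<^esub>F)" if "F \<subseteq> A" for F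
    using that Ac by (intro congruence_frame_sup_closed[OF fr]) blast
  have memI: "(x, y) \<in> R" if "F \<subseteq> A" "finite F" "(x, y) \<in> \<Squnion>\<^bsub>C\<^esub>F" for x y F using that by (auto simp: R_def)
  have memD: "\<exists>F\<subseteq>A. finite F \<and> (x, y) \<in> \<Squnion>\<^bsub>C\<^esub>F" if "(x, y) \<in> R" for x y using that by (auto simp: R_def)
  have directed: "\<exists>F\<subseteq>A. finite F \<and> (x, y) \<in> \<Squnion>\<^bsub>C\<^esub>F \<and> (x', y') \<in> \<Squnion>\<^bsub>C\<^esub>F"
    if xy: "(x, y) \<in> R" "(x', y') \<in> R" for x y x' y'
  proof -
    obtain F G where F: "F \<subseteq> A" "finite F" "(x, y) \<in> \<Squnion>\<^bsub>C\<^esub>F" and G: "G \<subseteq> A" "finite G" "(x', y') \<in> \<Squnion>\<^bsub>C\<^esub>G"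
      using memD[OF xy(1)] memD[OF xy(2)] by blast
    have FG: "F \<union> G \<subseteq> carrier C" using F G Ac by (auto simp: carrier_congruence_frame)
    have "\<Squnion>\<^bsub>C\<^esub>F \<subseteq> \<Squnion>\<^bsub>C\<^esub>(F \<union> G)" "\<Squnion>\<^bsub>C\<^esub>G \<subseteq> \<Squnion>\<^bsub>C\<^esub>(F \<union> G)"
      using C.sup_mono[OF _ FG, of F] C.sup_mono[OF _ FG, of G] by (auto simp: le_congruence_frame)
    then show ?thesis using F G by (intro exI[of _ "F \<union> G"]) auto
  qed
  have R: "lattice_congruence L R" unfolding lattice_congruence_def
  proof (intro conjI)
    show "equiv (carrier L) R"
    proof (rule equivI)
      show "R \<subseteq> carrier L \<times> carrier L" unfolding R_def using congruenceD(1)[OF con] by blast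
      show "refl_on (carrier L) R"
        using memI[of "{}"] congruenceD(2)[OF con[of "{}"]] by (intro refl_onI) simp
      show "sym R"
      proof (rule symI)
        fix x y assume "(x, y) \<in> R"
        then obtain F where F: "F \<subseteq> A" "finite F" "(x, y) \<in> \<Squnion>\<^bsub>C\<^esub>F" using memD by blast
        show "(y, x) \<in> R" by (rule memI[OF F(1,2) congruenceD(3)[OF con[OF F(1)] F(3)]])
      qed
      show "trans R"
      proof (rule transI)
        fix x y z assume xyz: "(x, y) \<in> R" "(y, z) \<in> R"
        obtain F where F: "F \<subseteq> A" "finite F" "(x, y) \<in> \<Squnion>\<^bsub>C\<^esub>F" "(y, z) \<in> \<Squnion>\<^bsub>C\<^esub>F"
          using directed[OF xyz] by blast
        show "(x, z) \<in> R" by (rule memI[OF F(1,2) congruenceD(4)[OF con[OF F(1)] F(3,4)]])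
      qed
    qed
    have "(x \<sqinter>\<^bsub>L\<^esub> x', y \<sqinter>\<^bsub>L\<^esub> y') \<in> R \<and> (x \<squnion>\<^bsub>L\<^esub> x', y \<squnion>\<^bsub>L\<^esub> y') \<in> R"
      if xy: "(x, y) \<in> R" "(x', y') \<in> R" for x y x' y'
    proof -
      obtain F where F: "F \<subseteq> A" "finite F" "(x, y) \<in> \<Squnion>\<^bsub>C\<^esub>F" "(x', y') \<in> \<Squnion>\<^bsub>C\<^esub>F"
        using directed[OF xy] by blast
      then show ?thesis
        using memI[OF F(1,2)] congruenceD(5)[OF con[OF F(1)] F(3,4)] congruenceD(6)[OF con[OF F(1)] F(3,4)] by simp
    qed
    then show "\<forall>(x, y)\<in>R. \<forall>(x', y')\<in>R.
      (x \<sqinter>\<^bsub>L\<^esub> x', y \<sqinter>\<^bsub>L\<^esub> y') \<in> R \<and> (x \<squnion>\<^bsub>L\<^esub> x', y \<squnion>\<^bsub>L\<^esub> y') \<in> R" by blast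
  qed
  note E = extension_congruence[OF R]
  have "T \<subseteq> extension L S R" if T: "T \<in> A" for T
  proof -
    have "\<Squnion>\<^bsub>C\<^esub>{T} = T"
      using subsetD[OF Ac T] by (intro C.sup_of_singleton) (simp add: carrier_congruence_frame)
    then have "T \<subseteq> R" using memI[of "{T}"] T by (intro subrelI) simp
    then show ?thesis using S_bar_extension[of T] extension_mono[of T R L S] T A by blast
  qed
  then have "\<Squnion>\<^bsub>C\<^esub>A \<subseteq> extension L S R" by (rule congruence_frame_sup_least[OF fr Ac E])
  then have "(\<top>\<^bsub>L\<^esub>, \<bottom>\<^bsub>L\<^esub>) \<in> extension L S R" unfolding top congruence_frame_top[OF fr] by auto
  then have "covered L S R \<top>\<^bsub>L\<^esub> \<bottom>\<^bsub>L\<^esub>" by (simp add: extension_def)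
  then obtain t where t: "t \<in> S" "t \<sqsubseteq>\<^bsub>L\<^esub> \<bottom>\<^bsub>L\<^esub>" "(\<top>\<^bsub>L\<^esub>, t) \<in> R"
    using coveredD[of L S R "\<top>\<^bsub>L\<^esub>" "\<bottom>\<^bsub>L\<^esub>" "\<top>\<^bsub>L\<^esub>"] S_closed(2) by auto
  have "t = \<bottom>\<^bsub>L\<^esub>" using t S L.bottom_lower L.le_antisym by auto
  then obtain F where F: "F \<subseteq> A" "finite F" "(\<top>\<^bsub>L\<^esub>, \<bottom>\<^bsub>L\<^esub>) \<in> \<Squnion>\<^bsub>C\<^esub>F" using t(3) memD by blast
  then have "\<Squnion>\<^bsub>C\<^esub>F = \<top>\<^bsub>C\<^esub>" unfolding congruence_frame_top[OF fr]
    using congruence_full_if_bottom_top[OF fr con[OF F(1)]] congruenceD(3)[OF con[OF F(1)]] by blast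
  then show ?thesis using F by blast
qed

text \<open>Every member \<open>R\<close> of \<open>S_bar L S\<close> has a complement \<open>T\<close> there. Adding \<open>T\<close> to a cover of \<open>R\<close> gives a cover of the top
element, and \<open>T\<close> contributes nothing to covering \<open>R\<close>.\<close>

lemma coherent_CS_frame: "coherent (CS_frame L S) SB"
  unfolding coherent_CS_frame_iff
proof (intro ballI allI impI)
  fix R A assume R: "R \<in> SB" and A: "A \<subseteq> SB" and le: "R \<subseteq> \<Squnion>\<^bsub>C\<^esub>A"
  have SBc: "X \<in> SB \<Longrightarrow> X \<in> carrier C" for X using S_bar_congruence by (simp add: carrier_congruence_frame)
  have Ac: "A \<subseteq> carrier C" using A SBc by blast
  obtain T where T: "T \<in> SB" "R \<sqinter>\<^bsub>C\<^esub> T = \<bottom>\<^bsub>C\<^esub>" "R \<squnion>\<^bsub>C\<^esub> T = \<top>\<^bsub>C\<^esub>" using S_bar_complement[OF R] by blast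
  note c = SBc[OF R] SBc[OF T(1)]
  have "R \<squnion>\<^bsub>C\<^esub> T \<sqsubseteq>\<^bsub>C\<^esub> \<Squnion>\<^bsub>C\<^esub>A \<squnion>\<^bsub>C\<^esub> T"
    using le c Ac by (intro C.join_mono) (auto simp: le_congruence_frame)
  also have "\<Squnion>\<^bsub>C\<^esub>A \<squnion>\<^bsub>C\<^esub> T = \<Squnion>\<^bsub>C\<^esub>(insert T A)" using C.sup_insert[OF c(2) Ac] by (simp add: join_comm)
  finally have "\<top>\<^bsub>C\<^esub> \<sqsubseteq>\<^bsub>C\<^esub> \<Squnion>\<^bsub>C\<^esub>(insert T A)" unfolding T(3) .
  moreover have iA: "insert T A \<subseteq> carrier C" using c Ac by simp
  ultimately have cover: "\<Squnion>\<^bsub>C\<^esub>(insert T A) = \<top>\<^bsub>C\<^esub>" by (intro C.le_antisym C.top_higher) auto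
  have "insert T A \<subseteq> SB" using T A by simp
  then obtain F where F: "F \<subseteq> insert T A" "finite F" "\<Squnion>\<^bsub>C\<^esub>F = \<top>\<^bsub>C\<^esub>"
    using S_bar_top_compact[OF _ cover] by auto
  have FA: "F \<inter> A \<subseteq> carrier C" using Ac by blast
  have "\<Squnion>\<^bsub>C\<^esub>F \<sqsubseteq>\<^bsub>C\<^esub> \<Squnion>\<^bsub>C\<^esub>(insert T (F \<inter> A))" using F(1) FA c by (intro C.sup_mono) auto
  then have "\<top>\<^bsub>C\<^esub> \<sqsubseteq>\<^bsub>C\<^esub> T \<squnion>\<^bsub>C\<^esub> \<Squnion>\<^bsub>C\<^esub>(F \<inter> A)" using F(3) C.sup_insert[OF c(2) FA] by simp
  then have "T \<squnion>\<^bsub>C\<^esub> \<Squnion>\<^bsub>C\<^esub>(F \<inter> A) = \<top>\<^bsub>C\<^esub>" using c FA by (intro C.le_antisym C.top_higher) auto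
  then have "R \<sqsubseteq>\<^bsub>C\<^esub> \<Squnion>\<^bsub>C\<^esub>(F \<inter> A)"
    using C.cover_by_complement[OF c _ T(2)] FA by simp
  then show "\<exists>F\<subseteq>A. finite F \<and> R \<subseteq> \<Squnion>\<^bsub>C\<^esub>F"
    using F(2) by (intro exI[of _ "F \<inter> A"]) (auto simp: le_congruence_frame)
qed

end

end

section \<open>Completeness in terms of lattice isomorphisms\<close>

lemma frith_complete_iff_coherent:
  assumes "frith_frame L S"
  shows "frith_complete L S \<longleftrightarrow> coherent L S"
proof -
  have sym: "symmetric_frith_frame (CS_frame L S) (S_bar L S)" by (rule CS_frame_symmetric[OF assms])
  then have "frith_frame (CS_frame L S) (S_bar L S)" by (simp add: symmetric_frith_frame_def)
  from symmetric_complete_iff_coherent[OF this sym]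
  show ?thesis unfolding frith_complete_def
    using coherent_CS_frame[OF assms] coherent_CS_frame_imp_coherent[OF assms] by blast
qed

theorem proposition6p6:
  fixes L :: "'a gorder" and S :: "'a set"
  assumes "frith_frame L S"
  shows "(frith_complete L S \<longleftrightarrow>
            (\<forall>(M :: 'a set gorder) T h. frith_frame M T \<longrightarrow> frith_mor M T L S h \<longrightarrow>
               lattice_iso (sublat M T) (sublat L S) h \<longrightarrow> frith_iso M T L S h)) \<and>
         (frith_complete L S \<longrightarrow>
            (\<forall>(M :: 'm gorder) T h. frith_frame M T \<longrightarrow> frith_mor M T L S h \<longrightarrow>
               lattice_iso (sublat M T) (sublat L S) h \<longrightarrow> frith_iso M T L S h))"
proof (intro conjI iffI impI allI)
  fix M :: "'a set gorder" and T h
  assume "frith_complete L S" "frith_frame M T" "frith_mor M T L S h"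
    "lattice_iso (sublat M T) (sublat L S) h"
  then show "frith_iso M T L S h"
    using coherent_imp_frith_iso frith_complete_iff_coherent lattice_iso_sublat_iff assms by metis
next
  fix M :: "'m gorder" and T h
  assume "frith_complete L S" "frith_frame M T" "frith_mor M T L S h"
    "lattice_iso (sublat M T) (sublat L S) h"
  then show "frith_iso M T L S h"
    using coherent_imp_frith_iso frith_complete_iff_coherent lattice_iso_sublat_iff assms by metis
next
  assume isos: "\<forall>(M :: 'a set gorder) T h. frith_frame M T \<longrightarrow> frith_mor M T L S h \<longrightarrow>
    lattice_iso (sublat M T) (sublat L S) h \<longrightarrow> frith_iso M T L S h"
  \<comment> \<open>The join map from the ideals of \<open>S\<close> is the universal test case.\<close>
  let ?J = "ideal_completion L S" and ?D = "principal_ideal L S ` S"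
  note J = ideal_completion_frith[OF assms] and mor = ideal_sup_mor[OF assms]
  have "lattice_iso (sublat ?J ?D) (sublat L S) (Lattice.sup L)"
    using lattice_iso_sublat_iff[OF J assms mor] ideal_sup_bij[OF assms] by simp
  then have "frith_iso ?J ?D L S (Lattice.sup L)" using isos J mor by blast
  then have "coherent L S" by (rule ideal_sup_inj_imp_coherent[OF assms frith_iso_inj])
  then show "frith_complete L S" by (simp add: frith_complete_iff_coherent[OF assms])
qed

end
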